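(* Let $(X_k)_{k\ge 0}$ be a stationary sequence of bounded, centered real random variables defined on a common probability space $(\Omega,\mathcal F,\nu)$; put $S_0:=0$ and $S_n:=\sum_{k=1}^n X_k$ for $n\ge 1$. Suppose that there exist real numbers $C\ge 1$, $M\ge \max(1,\Vert X_0\Vert_\infty)$ and $r\ge 0$, and a family of real numbers $(\varphi_{p,l})_{p,l\ge 0}$ (indexed by integers $p,l\ge 0$) bounded above by $1$ and satisfying $$\sum_{p\ge 1}p\max_{l=0,\dots,\lfloor p/(r+1)\rfloor}\varphi_{p,l}<+\infty ,$$ such that for all integers $a,b,c\ge 0$ with $a+b+c\le 3$, all integers $j,k,l,p,q,s$ with $1\le j\le k\le l\le l+p\le l+q\le l+s$, and every differentiable function $F:\mathbf R^4\to\mathbf R$ such that $F(S_{j-1},X_j,X_k,X_l)$ is integrable, one has $$\left\vert \mathrm{Cov}\left(F(S_{j-1},X_j,X_k,X_l),\,X_{l+p}^{a}X_{l+q}^{b}X_{l+s}^{c}\right)\right\vert\le C\left(\left\Vert F(S_{j-1},X_j,X_k,X_l)\right\Vert_{L^1}+\left\Vert\sup_{\vert u\vert,\vert v\vert,\vert w\vert,\vert x\vert\le M}\left\vert DF(S_{j-1}+u,X_j+v,X_k+w,X_l+x)\right\vert_\infty\right\Vert_{L^1}\right)\varphi_{p,s-p}.$$ Then the limit $$\sigma:=\lim_{n\to+\infty}\frac1{\sqrt n}\left(\mathbf E[S_n^2]\right)^{1/2}$$ exists. If $\sigma=0$, then the sequence $(S_n)_n$ is bounded in $L^2$. If $\sigma>0$,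 then $\left(\frac{S_n}{\sqrt n}\right)_{n\ge1}$ converges in distribution to a centered normal random variable $N$ with variance $\sigma^2$, and there exists a real number $B>0$ such that for every integer $n\ge 1$, $$\sup_{x\in\mathbf R}\left\vert \nu\left(\frac{S_n}{\sqrt n}\le x\right)-\mathbf P(N\le x)\right\vert\le\frac{B}{\sqrt n}.$$
   Context: $\mathbf E$ denotes expectation with respect to $\nu$, and $\mathrm{Cov}(f,g)=\mathbf E[fg]-\mathbf E[f]\mathbf E[g]$. $DF$ is the differential of $F$ and $\vert DF(\cdot)\vert_\infty$ is the maximum of the absolute values of the partial derivatives of $F$ at the given point. The $L^1$ norms may take the value $+\infty$, in which case the inequality is vacuous. $\lfloor\cdot\rfloor$ is the integer part. *)

theory Defs
  imports "HOL-Probability.Probability"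
begin

definition stationary :: "'a measure \<Rightarrow> (nat \<Rightarrow> 'a \<Rightarrow> real) \<Rightarrow> bool" where
  "stationary \<nu> X \<longleftrightarrow>
     (\<forall>k. X k \<in> borel_measurable \<nu>) \<and>
     (\<forall>m. distr \<nu> (PiM UNIV (\<lambda>_. borel)) (\<lambda>\<omega> k. X (k + m) \<omega>)
        = distr \<nu> (PiM UNIV (\<lambda>_. borel)) (\<lambda>\<omega> k. X k \<omega>))"

definition Linf_norm :: "'a measure \<Rightarrow> ('a \<Rightarrow> real) \<Rightarrow> ereal" where
  "Linf_norm \<nu> f = esssup \<nu> (\<lambda>\<omega>. ereal \<bar>f \<omega>\<bar>)"

definition cov :: "'a measure \<Rightarrow> ('a \<Rightarrow> real) \<Rightarrow> ('a \<Rightarrow> real) \<Rightarrow> real" where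
  "cov \<nu> f g = (\<integral>\<omega>. f \<omega> * g \<omega> \<partial>\<nu>) - (\<integral>\<omega>. f \<omega> \<partial>\<nu>) * (\<integral>\<omega>. g \<omega> \<partial>\<nu>)"

definition S :: "(nat \<Rightarrow> 'a \<Rightarrow> real) \<Rightarrow> nat \<Rightarrow> 'a \<Rightarrow> real" where
  "S X n \<omega> = (\<Sum>k=1..n. X k \<omega>)"

type_synonym R4 = "real \<times> real \<times> real \<times> real"

text \<open>\<open>Basis\<close> of \<open>R4\<close> consists of the four standard unit vectors, so the derivative evaluated
  on it yields the partial derivatives.\<close>

definition max_partial :: "(R4 \<Rightarrow> real) \<Rightarrow> R4 \<Rightarrow> real" where
  "max_partial F z = Max ((\<lambda>b. \<bar>frechet_derivative F (at z) b\<bar>) ` Basis)"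

definition sup_partial :: "real \<Rightarrow> (R4 \<Rightarrow> real) \<Rightarrow> R4 \<Rightarrow> ennreal" where
  "sup_partial M F z =
     (SUP t \<in> {(u, v, w, x). \<bar>u\<bar> \<le> M \<and> \<bar>v\<bar> \<le> M \<and> \<bar>w\<bar> \<le> M \<and> \<bar>x\<bar> \<le> M}.
        ennreal (max_partial F (z + t)))"

text \<open>The \<open>L\<^sup>1\<close> norm of the supremum is a nonnegative integral with values in \<open>[0, \<infinity>]\<close>. For a
  general differentiable \<open>F\<close> the integrand is measurable only with respect to the completion
  of \<open>\<nu>\<close>; \<open>nn_integral\<close> takes the same value for \<open>\<nu>\<close> and for its completion
  (\<open>nn_integral_completion\<close>). The finiteness premise is spelled out because
  \<open>\<infinity> * 0 = 0\<close> in \<open>ennreal\<close>, whereas an infinite norm has to make the bound vacuous even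
  where \<open>\<phi>\<close> vanishes.\<close>

definition cov_bound ::
  "'a measure \<Rightarrow> (nat \<Rightarrow> 'a \<Rightarrow> real) \<Rightarrow> real \<Rightarrow> real \<Rightarrow> (nat \<Rightarrow> nat \<Rightarrow> real) \<Rightarrow> bool" where
  "cov_bound \<nu> X C M \<phi> \<longleftrightarrow>
     (\<forall>a b c j k l p q s :: nat. \<forall>F :: R4 \<Rightarrow> real.
        a + b + c \<le> 3 \<longrightarrow>
        1 \<le> j \<longrightarrow> j \<le> k \<longrightarrow> k \<le> l \<longrightarrow> l \<le> l + p \<longrightarrow> l + p \<le> l + q \<longrightarrow> l + q \<le> l + s \<longrightarrow>
        (\<forall>z. F differentiable (at z)) \<longrightarrow>
        (let Y = (\<lambda>\<omega>. (S X (j - 1) \<omega>, X j \<omega>, X k \<omega>, X l \<omega>));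
             D = (\<integral>\<^sup>+\<omega>. sup_partial M F (Y \<omega>) \<partial>\<nu>)
         in integrable \<nu> (\<lambda>\<omega>. F (Y \<omega>)) \<longrightarrow> D < \<infinity> \<longrightarrow>
            \<bar>cov \<nu> (\<lambda>\<omega>. F (Y \<omega>)) (\<lambda>\<omega>. X (l + p) \<omega> ^ a * X (l + q) \<omega> ^ b * X (l + s) \<omega> ^ c)\<bar>
              \<le> C * ((\<integral>\<omega>. \<bar>F (Y \<omega>)\<bar> \<partial>\<nu>) + enn2real D) * \<phi> p (s - p)))"

definition centered_normal :: "real \<Rightarrow> real measure" where
  "centered_normal \<sigma> = density lborel (normal_density 0 \<sigma>)"

end

theory Submission
  imports Defs "HOL-Library.Discrete_Functions" "HOL-Real_Asymp.Real_Asymp"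
begin

text \<open>
  Lindeberg's method along the heat flow, closed by an induction on \<open>n\<close>. As
  \<open>Phi ((x - y) / (\<sigma> * sqrt t))\<close> solves the heat equation, the difference between
  \<open>E Phi ((x - S\<^sub>n) / (\<sigma> * sqrt m))\<close> and \<open>Phi (x / (\<sigma> * sqrt (n + m)))\<close> telescopes into steps that
  compare \<open>S\<^sub>k\<close> with \<open>S\<^sub>k\<^sub>-\<^sub>1\<close> plus a Gaussian variable, at the remaining time \<open>N = n - k + m\<close>, that is
  at the spatial scale \<open>L = floor (sqrt N)\<close>. A step is expanded to third order, and the covariances
  of the derivatives \<open>f\<^sup>(\<^sup>i\<^sup>)(S\<^sub>k\<^sub>-\<^sub>1)\<close> with products of the \<open>X\<^sub>j\<close> are developed along the increments of the
  past sum. The development stops at lags of order \<open>L\<close>: this is what makes the first moment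
  of \<open>\<phi>\<close> suffice, since beyond that lag a first- or second-order covariance is already small enough.

  The error of a step is proportional to \<open>Q = E exp (- |x - S\<^sub>k\<^sub>-\<^sub>1| / L)\<close>, which the Berry-Esseen bound
  \<open>B / sqrt j\<close> for \<open>j < n\<close> controls by \<open>(1 + B / sqrt m) * L / sqrt n\<close>. A multiple of \<open>E f\<^sup>'\<^sup>'\<^sup>'(S\<^sub>k\<^sub>-\<^sub>1)\<close>
  survives in each step; bounded in absolute value it would cost a factor \<open>log n\<close>, so the
  cancellation in the integral of \<open>f\<^sup>'\<^sup>'\<^sup>'\<close> against the Gaussian law is used instead. Removing the
  smoothing costs \<open>6 * sqrt m / sqrt n\<close>, and for large \<open>m\<close> the induction closes.
\<close>

section \<open>Covariances and Taylor remainders\<close>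

text \<open>The hypothesis charges a test function \<open>F\<close> with the \<open>L^1\<close>
  norms of its value and of its gradient, and admits one past sum and three single variables. A
  derivative in a single variable brings no new power of \<open>1 / L\<close>, so value and gradient
  should have the same order from the start. Taylor remainders in \<open>(S_{e-1}, X_e)\<close> have
  this property, with order \<open>L^-(i+j)\<close>. Moreover \<open>\<phi> p l\<close> is
  controlled only when the gap \<open>p\<close> is at least \<open>r + 1\<close> times the length
  \<open>l\<close> of the block behind it. So three indices are cut at a gap that dominates what
  follows, and a past sum is moved back by \<open>R\<close> times the block length before it is
  decorrelated. Summing over two gaps counts a dominant gap \<open>g\<close> about \<open>g\<close>
  times, which is the weight in the summability hypothesis. In the induction the steps fall into two
  halves: for early \<open>k\<close> the remaining time is at least \<open>n / 2\<close> and trivial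
  bounds suffice; for late \<open>k\<close> the sum \<open>S_{k-1}\<close> has at least
  \<open>n / 2\<close> terms and the inductive bound loses only a constant. The parameter
  \<open>m\<close> stays free until it makes the coefficient of \<open>B\<close> at most
  \<open>1 / 2\<close>.\<close>

definition bddrv :: "'a measure \<Rightarrow> ('a \<Rightarrow> real) \<Rightarrow> bool" where
  "bddrv M f \<longleftrightarrow> f \<in> borel_measurable M \<and> (\<exists>c. AE \<omega> in M. \<bar>f \<omega>\<bar> \<le> c)"

lemma bddrvI: "f \<in> borel_measurable M \<Longrightarrow> AE \<omega> in M. \<bar>f \<omega>\<bar> \<le> c \<Longrightarrow> bddrv M f"
  by (auto simp: bddrv_def)

lemma bddrv_const: "bddrv M (\<lambda>_. k)"
  by (intro bddrvI[where c="\<bar>k\<bar>"]) auto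

lemma bddrv_add: assumes "bddrv M f" "bddrv M g" shows "bddrv M (\<lambda>\<omega>. f \<omega> + g \<omega>)"
proof -
  from assms obtain c d where *: "f \<in> borel_measurable M" "g \<in> borel_measurable M"
    "AE \<omega> in M. \<bar>f \<omega>\<bar> \<le> c" "AE \<omega> in M. \<bar>g \<omega>\<bar> \<le> d" by (auto simp: bddrv_def)
  show ?thesis
    by (rule bddrvI[where c="c + d"]) (use * in \<open>auto\<close>)
qed

lemma bddrv_mult: assumes "bddrv M f" "bddrv M g" shows "bddrv M (\<lambda>\<omega>. f \<omega> * g \<omega>)"
proof -
  from assms obtain c d where *: "f \<in> borel_measurable M" "g \<in> borel_measurable M"
    "AE \<omega> in M. \<bar>f \<omega>\<bar> \<le> c" "AE \<omega> in M. \<bar>g \<omega>\<bar> \<le> d" by (auto simp: bddrv_def)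
  have "AE \<omega> in M. \<bar>f \<omega> * g \<omega>\<bar> \<le> \<bar>c\<bar> * \<bar>d\<bar>"
    using *(3,4) by eventually_elim (auto simp: abs_mult intro!: mult_mono)
  then show ?thesis using * by (intro bddrvI) auto
qed

lemma bddrv_cmult: "bddrv M f \<Longrightarrow> bddrv M (\<lambda>\<omega>. k * f \<omega>)"
  by (intro bddrv_mult bddrv_const)

lemma bddrv_diff: "bddrv M f \<Longrightarrow> bddrv M g \<Longrightarrow> bddrv M (\<lambda>\<omega>. f \<omega> - g \<omega>)"
  using bddrv_add[of M f "\<lambda>\<omega>. (-1) * g \<omega>"] bddrv_cmult[of M g "-1"] by simp

lemma bddrv_divide: "bddrv M f \<Longrightarrow> bddrv M (\<lambda>\<omega>. f \<omega> / k)"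
  using bddrv_cmult[of M f "1/k"] by simp

lemma bddrv_power: "bddrv M f \<Longrightarrow> bddrv M (\<lambda>\<omega>. f \<omega> ^ n)"
  by (induction n) (auto intro: bddrv_const bddrv_mult)

lemma bddrv_sum: "(\<And>i. i \<in> I \<Longrightarrow> bddrv M (f i)) \<Longrightarrow> bddrv M (\<lambda>\<omega>. \<Sum>i\<in>I. f i \<omega>)"
  by (induction I rule: infinite_finite_induct) (auto intro: bddrv_const bddrv_add)

lemmas bddrv_intros = bddrv_const bddrv_add bddrv_mult bddrv_diff bddrv_divide bddrv_power bddrv_sum

lemma bddrv_comp:
  fixes g :: "real \<Rightarrow> real"
  assumes "Z \<in> borel_measurable M" "g \<in> borel_measurable borel" "\<And>y. \<bar>g y\<bar> \<le> c"
  shows "bddrv M (\<lambda>\<omega>. g (Z \<omega>))"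
  using assms by (intro bddrvI[where c=c]) auto

context prob_space
begin

lemma bddrv_integrable: "bddrv M f \<Longrightarrow> integrable M f"
  unfolding bddrv_def using integrable_const_bound[of f] by auto

lemma cov_add_left:
  assumes "bddrv M f" "bddrv M g" "bddrv M h"
  shows "cov M (\<lambda>\<omega>. f \<omega> + g \<omega>) h = cov M f h + cov M g h"
  using assms by (simp add: cov_def distrib_right bddrv_integrable bddrv_mult)

lemma cov_cmult_left:
  "cov M (\<lambda>\<omega>. k * f \<omega>) h = k * cov M f h"
  by (simp add: cov_def mult.assoc right_diff_distrib)

lemma cov_const_left: "cov M (\<lambda>\<omega>. k) h = 0"
  by (simp add: cov_def prob_space)

lemma cov_sum_left:
  assumes "\<And>i. i \<in> I \<Longrightarrow> bddrv M (f i)" "bddrv M h"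
  shows "cov M (\<lambda>\<omega>. \<Sum>i\<in>I. f i \<omega>) h = (\<Sum>i\<in>I. cov M (f i) h)"
  using assms
  by (induction I rule: infinite_finite_induct) (auto simp: cov_const_left cov_add_left bddrv_sum)

end

text \<open>Order \<open>j = 0\<close> is \<open>fd i (s + x)\<close> itself and
  \<open>j = 1\<close> the increment of \<open>fd i\<close>, so one family covers every function of
  a past sum that is fed to the covariance hypothesis.\<close>

definition trem :: "(nat \<Rightarrow> real \<Rightarrow> real) \<Rightarrow> nat \<Rightarrow> nat \<Rightarrow> real \<Rightarrow> real \<Rightarrow> real" where
  "trem fd i j s x = fd i (s + x) - (\<Sum>t<j. fd (i + t) s * x ^ t / fact t)"

lemma Basis_R4: "(Basis :: R4 set) = {(1,0,0,0),(0,1,0,0),(0,0,1,0),(0,0,0,1)}"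
proof -
  have 2: "(Basis :: (real \<times> real) set) = {(1,0),(0,1)}"
    unfolding Basis_prod_def by (simp add: insert_commute)
  have 3: "(Basis :: (real \<times> real \<times> real) set) = {(1,0,0),(0,1,0),(0,0,1)}"
    unfolding Basis_prod_def[where 'b="real \<times> real"] 2 by (simp add: insert_commute zero_prod_def)
  show ?thesis
    unfolding Basis_prod_def[where 'b="real \<times> real \<times> real"] 3 by (simp add: insert_commute zero_prod_def)
qed

text \<open>\<open>fd i\<close> stands for the \<open>i\<close>-th derivative of a function
  \<open>f = fd 0\<close> living at spatial scale \<open>L\<close>. The envelope
  \<open>\<psi>\<close> is log-Lipschitz with constant \<open>1 / L\<close>, so a translation by
  \<open>O(L)\<close> costs a bounded factor. Decay is required from the first derivative on, since
  \<open>f\<close> will be a distribution function.\<close>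

locale test_fun =
  fixes fd :: "nat \<Rightarrow> real \<Rightarrow> real" and \<psi> :: "real \<Rightarrow> real" and c M :: real and L :: nat
  assumes L1: "1 \<le> L" and M1: "1 \<le> M" and c0: "0 \<le> c"
    and psi_nonneg: "0 \<le> \<psi> y" and psi_le1: "\<psi> y \<le> 1"
    and psi_shift: "\<psi> (y + u) \<le> exp (\<bar>u\<bar> / real L) * \<psi> y"
    and psi_meas[measurable]: "\<psi> \<in> borel_measurable borel"
    and fd_deriv: "i < 4 \<Longrightarrow> (fd i has_real_derivative fd (Suc i) y) (at y)"
    and fd_bound: "1 \<le> i \<Longrightarrow> i \<le> 4 \<Longrightarrow> \<bar>fd i y\<bar> \<le> c / real L ^ i * \<psi> y"
    and fd0_bound: "\<bar>fd 0 y\<bar> \<le> c"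
begin

lemma real_L1: "1 \<le> real L" using L1 by simp

lemma psi_shift_le:
  assumes "\<bar>u\<bar> \<le> a" "0 \<le> a" shows "\<psi> (y + u) \<le> exp a * \<psi> y"
proof -
  have "\<bar>u\<bar> / real L \<le> a"
    using assms real_L1 by (metis abs_ge_zero div_by_1 frac_le order_trans zero_less_one)
  then have "exp (\<bar>u\<bar> / real L) * \<psi> y \<le> exp a * \<psi> y"
    using psi_nonneg by (intro mult_right_mono) auto
  with psi_shift[of y u] show ?thesis by linarith
qed

lemma inv_pow_L_mono: "m \<le> n \<Longrightarrow> 1 / real L ^ n \<le> 1 / real L ^ m"
  using real_L1 by (intro divide_left_mono power_increasing) (auto intro!: mult_pos_pos)

text \<open>Differentiation in \<open>x\<close> raises \<open>i\<close> and lowers \<open>j\<close>.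
  Their sum is invariant, which is why the bounds depend on \<open>L\<close> through
  \<open>i + j\<close>; \<open>trem_bound\<close> iterates the relation by the mean value
  theorem.\<close>

lemma trem_deriv_x:
  assumes "i < 4"
  shows "((\<lambda>x. trem fd i (Suc j) s x) has_real_derivative trem fd (Suc i) j s x) (at x)"
proof -
  have e: "(\<Sum>t<Suc j. fd (i + t) s * x ^ t / fact t) = fd i s + (\<Sum>t<j. fd (Suc i + t) s * x ^ Suc t / fact (Suc t))" for x
    by (subst sum.lessThan_Suc_shift) simp
  have d: "((\<lambda>x. fd (Suc i + t) s * x ^ Suc t / fact (Suc t)) has_real_derivative fd (Suc i + t) s * x ^ t / fact t) (at x)" for t
    by (auto intro!: derivative_eq_intros simp: field_simps simp del: of_nat_Suc power_Suc)
  have "((\<lambda>x. fd i (s + x)) has_real_derivative fd (Suc i) (s + x)) (at x)"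
  proof -
    have "((\<lambda>x. s + x) has_real_derivative 1) (at x)" by (auto intro!: derivative_eq_intros)
    from DERIV_chain2[OF fd_deriv[OF assms] this] show ?thesis by simp
  qed
  then have "((\<lambda>x. fd i (s + x) - (fd i s + (\<Sum>t<j. fd (Suc i + t) s * x ^ Suc t / fact (Suc t)))) has_real_derivative
     fd (Suc i) (s + x) - (0 + (\<Sum>t<j. fd (Suc i + t) s * x ^ t / fact t))) (at x)"
    by (intro DERIV_diff DERIV_add DERIV_const DERIV_sum d)
  then show ?thesis unfolding trem_def e by simp
qed

lemma trem_0: "trem fd i (Suc j) s 0 = 0"
  unfolding trem_def by (subst sum.lessThan_Suc_shift) simp

text \<open>The range \<open>2 * M\<close> is forced by the covariance hypothesis, whose supremum
  shifts a variable of size at most \<open>M\<close> by another \<open>M\<close>.\<close>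

lemma trem_bound:
  assumes "1 \<le> i + j" "i + j \<le> 4" "\<bar>x\<bar> \<le> 2 * M"
  shows "\<bar>trem fd i j s x\<bar> \<le> c * exp (2 * M) * (2 * M) ^ j / real L ^ (i + j) * \<psi> s"
  using assms
proof (induction j arbitrary: i x)
  case 0
  have "\<bar>fd i (s + x)\<bar> \<le> c / real L ^ i * \<psi> (s + x)" using 0 by (intro fd_bound) auto
  also have "\<dots> \<le> c / real L ^ i * (exp (2 * M) * \<psi> s)"
    using 0 c0 M1 by (intro mult_left_mono psi_shift_le) auto
  finally show ?case by (simp add: trem_def mult_ac)
next
  case (Suc j)
  let ?B = "c * exp (2 * M) * (2 * M) ^ j / real L ^ (i + Suc j) * \<psi> s"
  have B: "\<bar>trem fd (Suc i) j s t\<bar> \<le> ?B" if "t \<in> {-\<bar>x\<bar>..\<bar>x\<bar>}" for t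
    using Suc.IH[of "Suc i" t] that Suc.prems by auto
  have "norm (trem fd i (Suc j) s x - trem fd i (Suc j) s 0) \<le> ?B * norm (x - 0)"
  proof (rule field_differentiable_bound[where S="{-\<bar>x\<bar>..\<bar>x\<bar>}" and f'="trem fd (Suc i) j s"])
    show "(trem fd i (Suc j) s has_field_derivative trem fd (Suc i) j s z) (at z within {-\<bar>x\<bar>..\<bar>x\<bar>})" for z
      using trem_deriv_x[of i j s z] Suc.prems by (auto intro: has_field_derivative_at_within)
  qed (use B in auto)
  also have "\<dots> \<le> ?B * (2 * M)"
    using Suc.prems c0 M1 psi_nonneg by (intro mult_left_mono) auto
  finally show ?case by (simp add: trem_0 mult_ac)
qed

lemma trem_bound':
  assumes "1 \<le> i + j" "i + j \<le> 4" "\<bar>x\<bar> \<le> 2 * M" "n \<le> i + j" "m \<le> 4" "j \<le> m"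
  shows "\<bar>trem fd i j s x\<bar> \<le> c * exp (2 * M) * (2 * M) ^ m / real L ^ n * \<psi> s"
proof -
  have "c * exp (2 * M) * (2 * M) ^ j / real L ^ (i + j) * \<psi> s \<le> c * exp (2 * M) * (2 * M) ^ m / real L ^ n * \<psi> s"
    using assms M1 c0 psi_nonneg real_L1
    by (intro mult_right_mono frac_le mult_left_mono power_increasing) auto
  with trem_bound[OF assms(1-3)] show ?thesis by (rule order_trans)
qed

text \<open>The partial derivative of \<open>trem fd i j\<close> in \<open>x\<close>. At
  \<open>j = 0\<close> the Taylor polynomial is empty, so there is no order to lower.\<close>

definition tremx where
  "tremx i j s x = (if j = 0 then trem fd (Suc i) 0 s x else trem fd (Suc i) (j - 1) s x)"

text \<open>The factor \<open>2\<close> covers the two summands that occur at top order in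
  \<open>trem_s_abnd\<close>; the exponent \<open>4\<close> is the largest \<open>j\<close>.\<close>

definition abnd :: "nat \<Rightarrow> real" where
  "abnd n = 2 * c * exp (2 * M) * (2 * M) ^ 4 / real L ^ n"

lemma abnd_nonneg: "0 \<le> abnd n"
  using c0 M1 by (simp add: abnd_def)

lemma trem_abnd:
  assumes "1 \<le> i + j" "i + j \<le> 4" "\<bar>x\<bar> \<le> 2 * M"
  shows "\<bar>trem fd i j s x\<bar> \<le> abnd (i + j) * \<psi> s"
proof -
  have "c * exp (2 * M) * (2 * M) ^ 4 / real L ^ (i + j) * \<psi> s \<le> abnd (i + j) * \<psi> s"
    unfolding abnd_def using c0 M1 psi_nonneg by (intro mult_right_mono divide_right_mono) auto
  moreover have "\<bar>trem fd i j s x\<bar> \<le> c * exp (2 * M) * (2 * M) ^ 4 / real L ^ (i + j) * \<psi> s"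
    using assms by (intro trem_bound') auto
  ultimately show ?thesis by linarith
qed

lemma trem_s_abnd:
  assumes "1 \<le> i + j" "i + j \<le> 4" "i \<le> 3" "\<bar>x\<bar> \<le> 2 * M"
  shows "\<bar>trem fd (Suc i) j s x\<bar> \<le> abnd (i + j) * \<psi> s"
proof (cases "i + j = 4")
  case False
  have "c * exp (2 * M) * (2 * M) ^ 4 / real L ^ (i + j) * \<psi> s \<le> abnd (i + j) * \<psi> s"
    unfolding abnd_def using c0 M1 psi_nonneg by (intro mult_right_mono divide_right_mono) auto
  moreover have "\<bar>trem fd (Suc i) j s x\<bar> \<le> c * exp (2 * M) * (2 * M) ^ 4 / real L ^ (i + j) * \<psi> s"
    using assms False by (intro trem_bound') auto
  ultimately show ?thesis by linarith
next
  case True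
  with assms obtain j' where j': "j = Suc j'" by (cases j) auto
  \<comment> \<open>At order \<open>4\<close> no further derivative is available. The
    \<open>s\<close>-derivative is a remainder with \<open>j\<close> lowered by one, minus its next
    Taylor term; both have order \<open>L^-4\<close>.\<close>
  have e: "trem fd (Suc i) j s x = trem fd (Suc i) j' s x - fd (i + j) s * x ^ j' / fact j'"
    by (simp add: trem_def j')
  let ?b = "c * exp (2 * M) * (2 * M) ^ 4 / real L ^ (i + j) * \<psi> s"
  have "\<bar>trem fd (Suc i) j' s x\<bar> \<le> ?b"
    using assms j' True by (intro trem_bound') auto
  moreover have "\<bar>fd (i + j) s * x ^ j' / fact j'\<bar> \<le> ?b"
  proof -
    have "\<bar>fd (i + j) s * x ^ j' / fact j'\<bar> \<le> \<bar>fd (i + j) s\<bar> * \<bar>x\<bar> ^ j'"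
      using frac_le[of "\<bar>fd (i + j) s\<bar> * \<bar>x\<bar> ^ j'" "\<bar>fd (i + j) s\<bar> * \<bar>x\<bar> ^ j'" 1 "fact j'"]
      by (simp add: abs_mult power_abs fact_ge_1)
    also have "\<dots> \<le> (c / real L ^ (i + j) * \<psi> s) * (2 * M) ^ j'"
      using assms c0 psi_nonneg by (intro mult_mono fd_bound power_mono) auto
    also have "\<dots> \<le> (c / real L ^ (i + j) * \<psi> s) * (2 * M) ^ 4"
      using assms c0 psi_nonneg M1 j' True by (intro mult_left_mono power_increasing) auto
    also have "\<dots> \<le> (c / real L ^ (i + j) * \<psi> s) * (2 * M) ^ 4 * exp (2 * M)"
      using c0 psi_nonneg[of s] M1 mult_left_mono[of 1 "exp (2 * M)" "(c / real L ^ (i + j) * \<psi> s) * (2 * M) ^ 4"] by simp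
    finally show ?thesis by (simp add: mult_ac)
  qed
  ultimately have "\<bar>trem fd (Suc i) j s x\<bar> \<le> ?b + ?b"
    unfolding e by (intro order_trans[OF abs_triangle_ineq4] add_mono)
  also have "?b + ?b = abnd (i + j) * \<psi> s" by (simp add: abnd_def field_simps)
  finally show ?thesis .
qed

lemma tremx_abnd:
  assumes "1 \<le> i + j" "i + j \<le> 4" "i \<le> 3" "\<bar>x\<bar> \<le> 2 * M"
  shows "\<bar>tremx i j s x\<bar> \<le> abnd (i + j) * \<psi> s"
proof (cases "j = 0")
  case True then show ?thesis using trem_s_abnd[of i 0 x s] assms by (simp add: tremx_def)
next
  case False then show ?thesis using trem_abnd[of "Suc i" "j - 1" x s] assms by (simp add: tremx_def)
qed

lemma trem_has_derivative:
  fixes P :: R4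
  assumes "i + j \<le> 4" "i \<le> 3"
  shows "((\<lambda>P::R4. trem fd i j (fst P) (fst (snd P))) has_derivative
     (\<lambda>h. trem fd (Suc i) j (fst P) (fst (snd P)) * fst h + tremx i j (fst P) (fst (snd P)) * fst (snd h))) (at P)"
proof -
  let ?s = "fst P" and ?x = "fst (snd P)"
  have A: "((\<lambda>P::R4. fd i (fst P + fst (snd P))) has_derivative
     (\<lambda>h. (fst h + fst (snd h)) * fd (Suc i) (?s + ?x))) (at P)"
    using assms by (intro DERIV_compose_FDERIV[where g="\<lambda>P::R4. fst P + fst (snd P)"] fd_deriv)
      (auto intro!: derivative_eq_intros)
  have B: "((\<lambda>P::R4. \<Sum>t<j. fd (i + t) (fst P) * fst (snd P) ^ t / fact t) has_derivative
     (\<lambda>h. \<Sum>t<j. (fd (Suc i + t) ?s * fst h * ?x ^ t + fd (i + t) ?s * (of_nat t * fst (snd h) * ?x ^ (t - 1))) / fact t)) (at P)"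
  proof (intro has_derivative_sum)
    fix t assume "t \<in> {..<j}"
    then have "((\<lambda>P::R4. fd (i + t) (fst P)) has_derivative (\<lambda>h. fst h * fd (Suc i + t) ?s)) (at P)"
      using assms fd_deriv[of "i + t" ?s]
      by (intro DERIV_compose_FDERIV[where g="\<lambda>P::R4. fst P"]) (auto intro!: derivative_eq_intros)
    then show "((\<lambda>P::R4. fd (i + t) (fst P) * fst (snd P) ^ t / fact t) has_derivative
      (\<lambda>h. (fd (Suc i + t) ?s * fst h * ?x ^ t + fd (i + t) ?s * (of_nat t * fst (snd h) * ?x ^ (t - 1))) / fact t)) (at P)"
      by (auto intro!: derivative_eq_intros simp: mult_ac)
  qed
  have *: "(\<Sum>t<j. (fd (Suc i + t) ?s * h1 * ?x ^ t + fd (i + t) ?s * (of_nat t * h2 * ?x ^ (t - 1))) / fact t)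
     = (\<Sum>t<j. fd (Suc i + t) ?s * ?x ^ t / fact t) * h1 + (\<Sum>t<j-1. fd (Suc i + t) ?s * ?x ^ t / fact t) * h2" for h1 h2
  proof -
    have "(\<Sum>t<j. fd (i + t) ?s * (of_nat t * h2 * ?x ^ (t - 1)) / fact t) = (\<Sum>t<j-1. fd (Suc i + t) ?s * ?x ^ t / fact t) * h2"
    proof (cases j)
      case (Suc j')
      show ?thesis unfolding Suc
        by (subst sum.lessThan_Suc_shift) (auto simp: sum_distrib_right sum_distrib_left field_simps simp del: of_nat_Suc intro!: sum.cong)
    qed simp
    moreover have "(\<Sum>t<j. fd (Suc i + t) ?s * h1 * ?x ^ t / fact t) = (\<Sum>t<j. fd (Suc i + t) ?s * ?x ^ t / fact t) * h1"
      by (auto simp: sum_distrib_right intro!: sum.cong)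
    ultimately show ?thesis by (simp only: add_divide_distrib sum.distrib)
  qed
  show ?thesis
    unfolding trem_def
    by (rule has_derivative_eq_rhs[OF has_derivative_diff[OF A B[unfolded *]]])
      (auto simp: fun_eq_iff tremx_def trem_def left_diff_distrib distrib_right)
qed

text \<open>The two extra factors occur with power at most \<open>1\<close>, so differentiating in
  them leaves the remainder untouched, and all four partial derivatives share its order.\<close>

lemma max_partial_trem:
  fixes F :: "R4 \<Rightarrow> real"
  assumes ij: "1 \<le> i + j" "i + j \<le> 4" "i \<le> 3" and al: "al \<le> 1" "be \<le> 1"
  defines "F \<equiv> \<lambda>P. trem fd i j (fst P) (fst (snd P)) * fst (snd (snd P)) ^ al * snd (snd (snd P)) ^ be"
  shows "F differentiable (at P)"
    and "\<bar>fst (snd P)\<bar> \<le> 2 * M \<Longrightarrow> \<bar>fst (snd (snd P))\<bar> \<le> 2 * M \<Longrightarrow> \<bar>snd (snd (snd P))\<bar> \<le> 2 * M \<Longrightarrow>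
      max_partial F P \<le> 4 * M\<^sup>2 * (abnd (i + j) * \<psi> (fst P))"
proof -
  obtain s x y z where P: "P = (s, x, y, z)" by (cases P)
  let ?d = "\<lambda>n (h::real). if n = (0::nat) then 0 else h"
  have pw1: "((\<lambda>P::R4. fst (snd (snd P)) ^ al) has_derivative (\<lambda>h. ?d al (fst (snd (snd h))))) (at P)"
    using al(1) by (cases al) (auto intro!: derivative_eq_intros)
  have pw2: "((\<lambda>P::R4. snd (snd (snd P)) ^ be) has_derivative (\<lambda>h. ?d be (snd (snd (snd h))))) (at P)"
    using al(2) by (cases be) (auto intro!: derivative_eq_intros)
  define F' where "F' = (\<lambda>h::R4. ((trem fd (Suc i) j s x * fst h + tremx i j s x * fst (snd h)) * y ^ al
      + trem fd i j s x * ?d al (fst (snd (snd h)))) * z ^ be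
      + trem fd i j s x * y ^ al * ?d be (snd (snd (snd h))))"
  have F': "(F has_derivative F') (at P)"
    unfolding F_def F'_def
    by (rule has_derivative_eq_rhs[OF has_derivative_mult[OF has_derivative_mult[OF trem_has_derivative[OF ij(2,3)] pw1] pw2]])
      (auto simp: P fun_eq_iff algebra_simps)
  then show "F differentiable (at P)" by (auto simp: differentiable_def)
  assume b: "\<bar>fst (snd P)\<bar> \<le> 2 * M" "\<bar>fst (snd (snd P))\<bar> \<le> 2 * M" "\<bar>snd (snd (snd P))\<bar> \<le> 2 * M"
  have b': "\<bar>x\<bar> \<le> 2 * M" "\<bar>y\<bar> \<le> 2 * M" "\<bar>z\<bar> \<le> 2 * M" using b by (auto simp: P)
  let ?a = "abnd (i + j) * \<psi> s"
  have a0: "0 \<le> ?a" using abnd_nonneg psi_nonneg by simp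
  have g: "\<bar>trem fd i j s x\<bar> \<le> ?a" "\<bar>trem fd (Suc i) j s x\<bar> \<le> ?a" "\<bar>tremx i j s x\<bar> \<le> ?a"
    using trem_abnd trem_s_abnd tremx_abnd ij b' by auto
  have py: "\<bar>y ^ al\<bar> \<le> 2 * M" "\<bar>z ^ be\<bar> \<le> 2 * M"
    using al b' M1 by (cases al; cases be; auto)+
  have pp: "\<bar>u * v * w\<bar> \<le> 4 * M\<^sup>2 * ?a" if "\<bar>u\<bar> \<le> ?a" "\<bar>v\<bar> \<le> 2 * M" "\<bar>w\<bar> \<le> 2 * M" for u v w
  proof -
    have "\<bar>u * v * w\<bar> \<le> ?a * (2 * M) * (2 * M)"
      unfolding abs_mult using that a0 M1 by (intro mult_mono) auto
    then show ?thesis by (simp add: power2_eq_square mult_ac)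
  qed
  have one: "\<bar>?d n (1::real)\<bar> \<le> 2 * M" for n using M1 by auto
  have "\<bar>F' h\<bar> \<le> 4 * M\<^sup>2 * ?a" if "h \<in> Basis" for h
  proof -
    from that consider "h = (1,0,0,0)" | "h = (0,1,0,0)" | "h = (0,0,1,0)" | "h = (0,0,0,1)"
      unfolding Basis_R4 by blast
    then show ?thesis
    proof cases
      case 1
      then have "F' h = trem fd (Suc i) j s x * y ^ al * z ^ be" by (simp add: F'_def cong: if_cong split del: if_split)
      then show ?thesis using pp[OF g(2) py] by simp
    next
      case 2
      then have "F' h = tremx i j s x * y ^ al * z ^ be" by (simp add: F'_def cong: if_cong split del: if_split)
      then show ?thesis using pp[OF g(3) py] by simp
    next
      case 3
      then have "F' h = trem fd i j s x * ?d al 1 * z ^ be" by (simp add: F'_def cong: if_cong split del: if_split)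
      then show ?thesis using pp[OF g(1) one[of al] py(2)] by simp
    next
      case 4
      then have "F' h = trem fd i j s x * y ^ al * ?d be 1" by (simp add: F'_def cong: if_cong split del: if_split)
      then show ?thesis using pp[OF g(1) py(1) one[of be]] by simp
    qed
  qed
  moreover have "frechet_derivative F (at P) = F'" using frechet_derivative_at[OF F'] by simp
  ultimately show "max_partial F P \<le> 4 * M\<^sup>2 * (abnd (i + j) * \<psi> (fst P))"
    unfolding max_partial_def by (intro Max.boundedI) (auto simp: P)
qed

end

lemma (in prob_space) expectation_mono_bddrv:
  assumes "bddrv M f" "bddrv M g" "AE \<omega> in M. f \<omega> \<le> g \<omega>"
  shows "expectation f \<le> expectation g"
  using assms by (intro integral_mono_AE bddrv_integrable)

section \<open>Covariance bounds for weighted test functions\<close>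

locale weak_dep = prob_space \<nu> for \<nu> :: "'a measure" +
  fixes X :: "nat \<Rightarrow> 'a \<Rightarrow> real" and C M :: real and \<phi> :: "nat \<Rightarrow> nat \<Rightarrow> real"
  assumes X_meas[measurable]: "\<And>k. X k \<in> borel_measurable \<nu>"
    and X_bound: "AE \<omega> in \<nu>. \<forall>k. \<bar>X k \<omega>\<bar> \<le> M"
    and X_mean: "\<And>k. (\<integral>\<omega>. X k \<omega> \<partial>\<nu>) = 0"
    and X_corr: "\<And>k p. (\<integral>\<omega>. X k \<omega> * X (k + p) \<omega> \<partial>\<nu>) = (\<integral>\<omega>. X 0 \<omega> * X p \<omega> \<partial>\<nu>)"
    and C_ge1: "1 \<le> C" and M_ge1: "1 \<le> M"
    and cov_bd: "cov_bound \<nu> X C M \<phi>"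
begin

lemma S_meas[measurable]: "S X n \<in> borel_measurable \<nu>"
proof -
  have "S X n = (\<lambda>\<omega>. \<Sum>k=1..n. X k \<omega>)" by (auto simp: S_def)
  then show ?thesis by simp
qed

lemma S_0 [simp]: "S X 0 \<omega> = 0" by (simp add: S_def)

lemma S_step: "1 \<le> e \<Longrightarrow> S X e \<omega> = S X (e - 1) \<omega> + X e \<omega>"
  by (cases e) (simp_all add: S_def)

lemma bddrv_X: "bddrv \<nu> (X k)"
  using X_bound by (intro bddrvI[where c=M]) auto

lemma S_diff_bound:
  assumes "\<forall>k. \<bar>X k \<omega>\<bar> \<le> M" "i \<le> j"
  shows "\<bar>S X j \<omega> - S X i \<omega>\<bar> \<le> M * real (j - i)"
proof -
  have "S X j \<omega> - S X i \<omega> = (\<Sum>k\<in>{i<..j}. X k \<omega>)"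
    unfolding S_def using assms(2)
    by (subst sum_diff[symmetric]) (auto intro!: sum.cong)
  also have "\<bar>\<dots>\<bar> \<le> (\<Sum>k\<in>{i<..j}. \<bar>X k \<omega>\<bar>)" by (rule sum_abs)
  also have "\<dots> \<le> (\<Sum>k\<in>{i<..j}. M)" using assms(1) by (intro sum_mono) auto
  finally show ?thesis by (simp add: mult.commute)
qed

lemma bddrv_S: "bddrv \<nu> (S X n)"
proof -
  have "S X n = (\<lambda>\<omega>. \<Sum>k=1..n. X k \<omega>)" by (auto simp: S_def)
  then show ?thesis by (auto intro: bddrv_sum bddrv_X)
qed

text \<open>The weight \<open>w\<close> localizes the hypothesis: both norms are dominated by
  multiples of \<open>E w(S_{e-1})\<close>, the gradient norm after paying \<open>\<kappa>\<close>
  for the shift of the past sum. The gradient has to be bounded on \<open>2 * M\<close> because the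
  supremum shifts each variable once more.\<close>

lemma cov_gen:
  fixes F :: "R4 \<Rightarrow> real" and w :: "real \<Rightarrow> real"
  assumes diff: "\<And>P. F differentiable (at P)"
    and Fb: "\<And>s x y z. \<bar>x\<bar> \<le> M \<Longrightarrow> \<bar>y\<bar> \<le> M \<Longrightarrow> \<bar>z\<bar> \<le> M \<Longrightarrow> \<bar>F (s,x,y,z)\<bar> \<le> a * w s"
    and Db: "\<And>s x y z. \<bar>x\<bar> \<le> 2 * M \<Longrightarrow> \<bar>y\<bar> \<le> 2 * M \<Longrightarrow> \<bar>z\<bar> \<le> 2 * M \<Longrightarrow> max_partial F (s,x,y,z) \<le> a' * w s"
    and w: "\<And>s. 0 \<le> w s" "\<And>s. w s \<le> 1" "w \<in> borel_measurable borel"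
    and shift: "\<And>s u. \<bar>u\<bar> \<le> M \<Longrightarrow> w (s + u) \<le> \<kappa> * w s"
    and nn: "0 \<le> a" "0 \<le> a'" "0 \<le> \<kappa>"
    and ind: "1 \<le> e" "e \<le> b" "b \<le> d" "d \<le> l1" "l1 \<le> l2" "l2 \<le> l3" "a1 + a2 + a3 \<le> 3"
  shows "\<bar>cov \<nu> (\<lambda>\<omega>. F (S X (e - 1) \<omega>, X e \<omega>, X b \<omega>, X d \<omega>)) (\<lambda>\<omega>. X l1 \<omega> ^ a1 * X l2 \<omega> ^ a2 * X l3 \<omega> ^ a3)\<bar>
     \<le> C * ((a + a' * \<kappa>) * expectation (\<lambda>\<omega>. w (S X (e - 1) \<omega>))) * \<phi> (l1 - d) (l3 - l1)"
    and "0 \<le> \<phi> (l1 - d) (l3 - l1)"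
proof -
  define Y where "Y = (\<lambda>\<omega>. (S X (e - 1) \<omega>, X e \<omega>, X b \<omega>, X d \<omega>))"
  define W where "W = expectation (\<lambda>\<omega>. w (S X (e - 1) \<omega>))"
  have Fc: "continuous_on UNIV F"
    using diff by (intro differentiable_imp_continuous_on) (auto simp: differentiable_on_def intro: differentiable_at_withinI)
  have Ym: "Y \<in> \<nu> \<rightarrow>\<^sub>M borel" unfolding Y_def by (intro borel_measurable_Pair) measurable
  have FY: "(\<lambda>\<omega>. F (Y \<omega>)) \<in> borel_measurable \<nu>"
    using measurable_compose[OF Ym borel_measurable_continuous_onI[OF Fc]] by simp
  have wb: "bddrv \<nu> (\<lambda>\<omega>. w (S X (e - 1) \<omega>))"
    by (rule bddrv_comp[where c=1]) (use w in \<open>auto\<close>)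
  have AEF: "AE \<omega> in \<nu>. \<bar>F (Y \<omega>)\<bar> \<le> a * w (S X (e - 1) \<omega>)"
    using X_bound by eventually_elim (auto simp: Y_def intro!: Fb)
  have "AE \<omega> in \<nu>. \<bar>F (Y \<omega>)\<bar> \<le> a"
    using AEF by eventually_elim (use w nn in \<open>meson mult_left_le order_trans\<close>)
  then have bF: "bddrv \<nu> (\<lambda>\<omega>. F (Y \<omega>))" using FY by (intro bddrvI)
  have bF': "bddrv \<nu> (\<lambda>\<omega>. \<bar>F (Y \<omega>)\<bar>)"
    using bF by (auto simp: bddrv_def)
  have n1: "(\<integral>\<omega>. \<bar>F (Y \<omega>)\<bar> \<partial>\<nu>) \<le> a * W"
    unfolding W_def using expectation_mono_bddrv[OF bF' bddrv_cmult[OF wb] AEF] by simp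
  define D where "D = (\<integral>\<^sup>+\<omega>. sup_partial M F (Y \<omega>) \<partial>\<nu>)"
  \<comment> \<open>\<open>sup_partial\<close> need not be measurable. Almost-everywhere comparison
    of nonnegative integrals asks for no measurability, and the dominating function is an ordinary
    random variable.\<close>
  have "D \<le> (\<integral>\<^sup>+\<omega>. ennreal (a' * \<kappa> * w (S X (e - 1) \<omega>)) \<partial>\<nu>)"
    unfolding D_def
  proof (rule nn_integral_mono_AE)
    show "AE \<omega> in \<nu>. sup_partial M F (Y \<omega>) \<le> ennreal (a' * \<kappa> * w (S X (e - 1) \<omega>))"
      using X_bound
    proof eventually_elim
      case (elim \<omega>)
      show ?case unfolding sup_partial_def
      proof (rule SUP_least, clarify, rule ennreal_leI)
        fix u v x y :: real assume t: "\<bar>u\<bar> \<le> M" "\<bar>v\<bar> \<le> M" "\<bar>x\<bar> \<le> M" "\<bar>y\<bar> \<le> M"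
        have bnd: "\<bar>X i \<omega> + r\<bar> \<le> 2 * M" if "\<bar>r\<bar> \<le> M" for i r
          using elim[rule_format, of i] that by linarith
        have "max_partial F (Y \<omega> + (u, v, x, y)) \<le> a' * w (S X (e - 1) \<omega> + u)"
          unfolding Y_def by (simp, intro Db bnd t)
        also have "\<dots> \<le> a' * (\<kappa> * w (S X (e - 1) \<omega>))"
          using nn t by (intro mult_left_mono shift)
        finally show "max_partial F (Y \<omega> + (u, v, x, y)) \<le> a' * \<kappa> * w (S X (e - 1) \<omega>)"
          by (simp add: mult_ac)
      qed
    qed
  qed
  also have "\<dots> = ennreal (a' * \<kappa> * W)"
    unfolding W_def using bddrv_integrable[OF bddrv_cmult[OF wb, of "a' * \<kappa>"]] nn w(1)
    by (subst nn_integral_eq_integral) (auto simp del: integrable_mult_left_iff integrable_mult_right_iff)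
  finally have Dle: "D \<le> ennreal (a' * \<kappa> * W)" .
  have W0: "0 \<le> W" unfolding W_def using w by (intro integral_nonneg_AE) auto
  have Dfin: "D < \<infinity>" using Dle by (rule le_less_trans) simp
  have Dreal: "enn2real D \<le> a' * \<kappa> * W"
    using Dle nn W0 by (intro enn2real_leI) auto
  have main: "\<bar>cov \<nu> (\<lambda>\<omega>. G (Y \<omega>)) (\<lambda>\<omega>. X l1 \<omega> ^ a1 * X l2 \<omega> ^ a2 * X l3 \<omega> ^ a3)\<bar>
       \<le> C * ((\<integral>\<omega>. \<bar>G (Y \<omega>)\<bar> \<partial>\<nu>) + enn2real (\<integral>\<^sup>+\<omega>. sup_partial M G (Y \<omega>) \<partial>\<nu>)) * \<phi> (l1 - d) (l3 - l1)"
    if G: "\<And>P. G differentiable (at P)" "integrable \<nu> (\<lambda>\<omega>. G (Y \<omega>))"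
      "(\<integral>\<^sup>+\<omega>. sup_partial M G (Y \<omega>) \<partial>\<nu>) < \<infinity>" for G
    using cov_bd[unfolded cov_bound_def Let_def, rule_format, of a1 a2 a3 e b d "l1 - d" "l2 - d" "l3 - d" G] ind G
    unfolding Y_def by simp
  have sp0: "sup_partial M (\<lambda>_. 1) P = 0" for P
    by (simp add: sup_partial_def max_partial_def bot_ennreal SUP_eq_const image_constant_conv)
  \<comment> \<open>For \<open>F = 1\<close> the covariance and the gradient vanish, so the
    hypothesis reads \<open>0 \<le> C * \<phi> (l1 - d) (l3 - l1)\<close>.\<close>
  show p0: "0 \<le> \<phi> (l1 - d) (l3 - l1)"
  proof -
    have "0 \<le> C * \<phi> (l1 - d) (l3 - l1)"
      using main[of "\<lambda>_. 1"] prob_space by (simp add: sp0)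
    then show ?thesis using C_ge1 by (simp add: zero_le_mult_iff)
  qed
  have "C * ((\<integral>\<omega>. \<bar>F (Y \<omega>)\<bar> \<partial>\<nu>) + enn2real D) * \<phi> (l1 - d) (l3 - l1) \<le> C * ((a + a' * \<kappa>) * W) * \<phi> (l1 - d) (l3 - l1)"
    using n1 Dreal C_ge1 p0 by (intro mult_right_mono mult_left_mono) (auto simp: distrib_right)
  with main[OF diff bddrv_integrable[OF bF]] Dfin
  show "\<bar>cov \<nu> (\<lambda>\<omega>. F (S X (e - 1) \<omega>, X e \<omega>, X b \<omega>, X d \<omega>)) (\<lambda>\<omega>. X l1 \<omega> ^ a1 * X l2 \<omega> ^ a2 * X l3 \<omega> ^ a3)\<bar>
     \<le> C * ((a + a' * \<kappa>) * expectation (\<lambda>\<omega>. w (S X (e - 1) \<omega>))) * \<phi> (l1 - d) (l3 - l1)"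
    unfolding D_def W_def Y_def by linarith
qed

lemma max_partial_const: "max_partial (\<lambda>_. k) P = 0"
  by (simp add: max_partial_def image_constant_conv)

lemma phi_nonneg: "0 \<le> \<phi> p l"
  using cov_gen(2)[of "\<lambda>_. 1" 1 "\<lambda>_. 1" 0 1 1 1 1 "Suc p" "Suc p" "Suc p + l" 0 0 0]
  by (simp add: max_partial_const)

lemma max_partial_xy:
  assumes "be \<le> 1"
  shows "(\<lambda>P::R4. fst (snd P) * fst (snd (snd P)) ^ be) differentiable (at P)"
    and "\<bar>fst (snd P)\<bar> \<le> 2 * M \<Longrightarrow> \<bar>fst (snd (snd P))\<bar> \<le> 2 * M \<Longrightarrow>
      max_partial (\<lambda>P::R4. fst (snd P) * fst (snd (snd P)) ^ be) P \<le> 2 * M"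
proof -
  let ?d = "\<lambda>n (h::real). if n = (0::nat) then 0 else h"
  let ?F = "\<lambda>P::R4. fst (snd P) * fst (snd (snd P)) ^ be"
  define F' where "F' = (\<lambda>h::R4. fst (snd h) * fst (snd (snd P)) ^ be + fst (snd P) * ?d be (fst (snd (snd h))))"
  have F': "(?F has_derivative F') (at P)"
    unfolding F'_def using assms(1) by (cases be) (auto intro!: derivative_eq_intros simp: fun_eq_iff mult_ac)
  then show "?F differentiable (at P)" by (auto simp: differentiable_def)
  assume P: "\<bar>fst (snd P)\<bar> \<le> 2 * M" "\<bar>fst (snd (snd P))\<bar> \<le> 2 * M"
  have "be = 0 \<or> be = 1" using assms by auto
  then have "\<bar>F' h\<bar> \<le> 2 * M" if "h \<in> Basis" for h
  proof -
    from that consider "h = (1,0,0,0)" | "h = (0,1,0,0)" | "h = (0,0,1,0)" | "h = (0,0,0,1)"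
      unfolding Basis_R4 by blast
    then show ?thesis using \<open>be = 0 \<or> be = 1\<close> P M_ge1 by cases (auto simp: F'_def)
  qed
  moreover have "frechet_derivative ?F (at P) = F'" using frechet_derivative_at[OF F'] by simp
  ultimately show "max_partial ?F P \<le> 2 * M"
    unfolding max_partial_def by (intro Max.boundedI) auto
qed

text \<open>The case without a past sum: weight \<open>1\<close>, value at most
  \<open>M\<^sup>2\<close>, gradient at most \<open>2 * M\<close>, and
  \<open>M\<^sup>2 + 2 * M \<le> 3 * M\<^sup>2\<close>.\<close>

lemma cov_X_bound:
  assumes "be \<le> 1" "1 \<le> e" "e \<le> b" "b \<le> l1" "l1 \<le> l2" "a1 + a2 \<le> 3"
  shows "\<bar>cov \<nu> (\<lambda>\<omega>. X e \<omega> * X b \<omega> ^ be) (\<lambda>\<omega>. X l1 \<omega> ^ a1 * X l2 \<omega> ^ a2)\<bar> \<le> 3 * C * M\<^sup>2 * \<phi> (l1 - b) (l2 - l1)"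
proof -
  have "\<bar>cov \<nu> (\<lambda>\<omega>. X e \<omega> * X b \<omega> ^ be) (\<lambda>\<omega>. X l1 \<omega> ^ a1 * X l2 \<omega> ^ a2 * X l2 \<omega> ^ 0)\<bar> \<le>
     C * ((M\<^sup>2 + 2 * M * 1) * expectation (\<lambda>\<omega>. 1)) * \<phi> (l1 - b) (l2 - l1)"
  proof (rule cov_gen(1)[of "\<lambda>P. fst (snd P) * fst (snd (snd P)) ^ be" "M\<^sup>2" "\<lambda>_. 1" "2 * M" 1 e b b l1 l2 l2 a1 a2 0, simplified fst_conv snd_conv])
    show "\<bar>x * y ^ be\<bar> \<le> M\<^sup>2 * 1" if "\<bar>x\<bar> \<le> M" "\<bar>y\<bar> \<le> M" for x y
    proof -
      have "\<bar>y ^ be\<bar> \<le> M" using assms(1) that M_ge1 by (cases be) auto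
      then have "\<bar>x * y ^ be\<bar> \<le> M * M" unfolding abs_mult using that M_ge1 by (intro mult_mono) auto
      then show ?thesis by (simp add: power2_eq_square)
    qed
  qed (use assms max_partial_xy M_ge1 in \<open>auto\<close>)
  also have "\<dots> \<le> C * (3 * M\<^sup>2) * \<phi> (l1 - b) (l2 - l1)"
    using phi_nonneg C_ge1 M_ge1 by (intro mult_right_mono mult_left_mono) (auto simp: power2_eq_square prob_space)
  finally show ?thesis by (simp add: mult_ac)
qed

lemma corr_bound: "\<bar>expectation (\<lambda>\<omega>. X 0 \<omega> * X p \<omega>)\<bar> \<le> 3 * C * M\<^sup>2 * \<phi> p 0"
proof -
  \<comment> \<open>Indices in \<open>cov_bound\<close> start at \<open>1\<close>, hence the
    translation of the pair \<open>(0, p)\<close> to \<open>(1, 1 + p)\<close>.\<close>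
  have "expectation (\<lambda>\<omega>. X 0 \<omega> * X p \<omega>) = cov \<nu> (\<lambda>\<omega>. X 1 \<omega> * X 1 \<omega> ^ 0) (\<lambda>\<omega>. X (1 + p) \<omega> ^ 1 * X (1 + p) \<omega> ^ 0)"
    using X_corr[of 1 p] by (simp add: cov_def X_mean)
  also have "\<bar>\<dots>\<bar> \<le> 3 * C * M\<^sup>2 * \<phi> (1 + p - 1) (1 + p - (1 + p))"
    by (intro cov_X_bound) auto
  finally show ?thesis by simp
qed

end

section \<open>Decorrelation\<close>

locale dep_test = weak_dep \<nu> X C M \<phi> + test_fun fd \<psi> c M L
  for \<nu> :: "'a measure" and X C M \<phi> fd \<psi> c L +
  fixes R k :: nat and \<theta> :: "nat \<Rightarrow> real" and Th :: real
  assumes R1: "1 \<le> R" and k1: "1 \<le> k"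
    and theta: "\<And>p l. R * l \<le> p \<Longrightarrow> \<phi> p l \<le> \<theta> p"
    and Th: "\<And>n. (\<Sum>g=1..n. real g * \<theta> g) \<le> Th"
begin

text \<open>All indices that occur stay within \<open>c1 * L\<close> of \<open>k\<close>; over such a distance \<open>\<psi>\<close> changes
  by a bounded factor only, which makes \<open>Q\<close> a common scale for all error terms.\<close>

definition c1 :: nat where "c1 = (R + 2)\<^sup>2"
definition \<Lambda> :: nat where "\<Lambda> = R * (R + 1) * L"
definition Q :: real where "Q = expectation (\<lambda>\<omega>. \<psi> (S X (k - 1) \<omega>))"
text \<open>From left to right: the constants of \<open>cov_gen\<close> for value and gradient of a
  remainder times two variables, the constant of \<open>abnd\<close>, and the cost of
  \<open>shift_Q\<close>.\<close>

definition K0 :: real where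
  "K0 = C * (M\<^sup>2 + 4 * M\<^sup>2 * exp M) * (2 * c * exp (2 * M) * (2 * M) ^ 4) * exp (M * c1)"

lemma theta_nonneg: "0 \<le> \<theta> p"
  using theta[of 0 p] phi_nonneg[of p 0] by linarith

lemma Q_nonneg: "0 \<le> Q"
  unfolding Q_def using psi_nonneg by (intro integral_nonneg_AE) auto

lemma K0_nonneg: "0 \<le> K0"
  unfolding K0_def using C_ge1 M_ge1 c0 by auto

lemma bddrv_psi: "bddrv \<nu> (\<lambda>\<omega>. \<psi> (S X e \<omega>))"
  by (rule bddrv_comp[where c=1]) (use psi_nonneg psi_le1 in \<open>auto\<close>)

text \<open>Between the two indices the sum moves by at most \<open>M * c1 * L\<close>, over which
  the envelope changes by a factor of at most \<open>exp (M * c1)\<close>. Hence the single number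
  \<open>Q\<close> measures the weight at every index of the window.\<close>

lemma shift_Q:
  assumes "1 \<le> e" "e \<le> k" "k - e \<le> c1 * L"
  shows "expectation (\<lambda>\<omega>. \<psi> (S X (e - 1) \<omega>)) \<le> exp (M * c1) * Q"
proof -
  have "expectation (\<lambda>\<omega>. \<psi> (S X (e - 1) \<omega>)) \<le> expectation (\<lambda>\<omega>. exp (M * c1) * \<psi> (S X (k - 1) \<omega>))"
  proof (intro expectation_mono_bddrv bddrv_cmult bddrv_psi)
    show "AE \<omega> in \<nu>. \<psi> (S X (e - 1) \<omega>) \<le> exp (M * c1) * \<psi> (S X (k - 1) \<omega>)"
      using X_bound
    proof eventually_elim
      case (elim \<omega>)
      let ?u = "S X (e - 1) \<omega> - S X (k - 1) \<omega>"
      have "k - 1 - (e - 1) = k - e" using assms by simp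
      then have "\<bar>?u\<bar> \<le> M * real (k - e)"
        using S_diff_bound[OF elim, of "e - 1" "k - 1"] assms by (simp add: abs_minus_commute)
      also have "\<dots> \<le> M * real (c1 * L)" using assms M_ge1 by (intro mult_left_mono) (auto simp only: of_nat_le_iff)
      finally have "\<bar>?u\<bar> / real L \<le> M * real c1" using real_L1 by (simp add: divide_le_eq mult_ac)
      then have "exp (\<bar>?u\<bar> / real L) * \<psi> (S X (k - 1) \<omega>) \<le> exp (M * c1) * \<psi> (S X (k - 1) \<omega>)"
        using psi_nonneg by (intro mult_right_mono) auto
      with psi_shift[of "S X (k - 1) \<omega>" ?u] show ?case by simp
    qed
  qed
  then show ?thesis by (simp add: Q_def)
qed

lemma fd_meas: "i \<le> 3 \<Longrightarrow> fd i \<in> borel_measurable borel"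
  using fd_deriv[of i] by (intro borel_measurable_continuous_onI continuous_at_imp_continuous_on ballI DERIV_isCont) auto

lemma fd_abs_le: assumes "i \<le> 4" shows "\<bar>fd i y\<bar> \<le> c"
proof (cases "i = 0")
  case False
  have "c / real L ^ i * \<psi> y \<le> c * 1"
    using c0 psi_nonneg psi_le1 real_L1
    by (intro mult_mono) (auto simp: divide_le_eq mult_le_cancel_left1)
  with fd_bound[of i y] False assms show ?thesis by auto
qed (use fd0_bound in auto)

lemma bddrv_fd: "i \<le> 3 \<Longrightarrow> bddrv \<nu> (\<lambda>\<omega>. fd i (S X e \<omega>))"
  using fd_abs_le by (intro bddrv_comp[where c=c] fd_meas) auto

lemma trem_meas: "i \<le> 3 \<Longrightarrow> i + j \<le> 4 \<Longrightarrow> f \<in> borel_measurable \<nu> \<Longrightarrow> g \<in> borel_measurable \<nu> \<Longrightarrow>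
   (\<lambda>\<omega>. trem fd i j (f \<omega>) (g \<omega>)) \<in> borel_measurable \<nu>"
  unfolding trem_def
  by (intro borel_measurable_diff borel_measurable_sum borel_measurable_divide borel_measurable_times borel_measurable_power
      measurable_compose[OF _ fd_meas] borel_measurable_add) auto

lemma bddrv_trem: assumes "i \<le> 3" "1 \<le> i + j" "i + j \<le> 4"
  shows "bddrv \<nu> (\<lambda>\<omega>. trem fd i j (S X e' \<omega>) (X e \<omega>))"
proof (rule bddrvI)
  show "AE \<omega> in \<nu>. \<bar>trem fd i j (S X e' \<omega>) (X e \<omega>)\<bar> \<le> abnd (i + j)"
    using X_bound
  proof eventually_elim
    case (elim \<omega>)
    have "\<bar>X e \<omega>\<bar> \<le> 2 * M" using elim[rule_format, of e] M_ge1 by linarith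
    from trem_abnd[OF assms(2,3) this, of "S X e' \<omega>"] psi_le1[of "S X e' \<omega>"] abnd_nonneg[of "i + j"]
    show ?case by (meson mult_left_le order_trans)
  qed
qed (use assms in \<open>auto intro: trem_meas\<close>)

lemmas bddrv_all = bddrv_intros bddrv_X bddrv_fd bddrv_trem

text \<open>The working form of the hypothesis. The order \<open>L^-(i+j)\<close> of the remainder
  and its gradient becomes the order of the covariance, the envelope becomes \<open>Q\<close>, and
  up to two single variables may be multiplied to the left factor.\<close>

lemma cov_trem:
  assumes ij: "i \<le> 3" "1 \<le> i + j" "i + j \<le> 4" and al: "al \<le> 1" "be \<le> 1"
    and e: "1 \<le> e" "e \<le> k" "k - e \<le> c1 * L"
    and ind: "e \<le> b" "b \<le> d" "d \<le> l1" "l1 \<le> l2" "l2 \<le> l3" "a1 + a2 + a3 \<le> 3"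
  shows "\<bar>cov \<nu> (\<lambda>\<omega>. trem fd i j (S X (e - 1) \<omega>) (X e \<omega>) * X b \<omega> ^ al * X d \<omega> ^ be)
     (\<lambda>\<omega>. X l1 \<omega> ^ a1 * X l2 \<omega> ^ a2 * X l3 \<omega> ^ a3)\<bar> \<le> K0 * Q / real L ^ (i + j) * \<phi> (l1 - d) (l3 - l1)"
proof -
  let ?F = "\<lambda>P::R4. trem fd i j (fst P) (fst (snd P)) * fst (snd (snd P)) ^ al * snd (snd (snd P)) ^ be"
  let ?a = "abnd (i + j)"
  have "\<bar>cov \<nu> (\<lambda>\<omega>. ?F (S X (e - 1) \<omega>, X e \<omega>, X b \<omega>, X d \<omega>)) (\<lambda>\<omega>. X l1 \<omega> ^ a1 * X l2 \<omega> ^ a2 * X l3 \<omega> ^ a3)\<bar>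
     \<le> C * ((M\<^sup>2 * ?a + 4 * M\<^sup>2 * ?a * exp M) * expectation (\<lambda>\<omega>. \<psi> (S X (e - 1) \<omega>))) * \<phi> (l1 - d) (l3 - l1)"
  proof (rule cov_gen(1))
    fix s x y z :: real
    assume b: "\<bar>x\<bar> \<le> M" "\<bar>y\<bar> \<le> M" "\<bar>z\<bar> \<le> M"
    have py: "\<bar>y ^ al\<bar> \<le> M" "\<bar>z ^ be\<bar> \<le> M"
      using al b M1 by (cases al; cases be; auto)+
    have t: "\<bar>trem fd i j s x\<bar> \<le> ?a * \<psi> s" using b M1 by (intro trem_abnd ij) auto
    have "\<bar>?F (s, x, y, z)\<bar> \<le> (?a * \<psi> s) * M * M"
      unfolding abs_mult fst_conv snd_conv using py t M1 psi_nonneg abnd_nonneg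
      by (intro mult_mono) auto
    then show "\<bar>?F (s, x, y, z)\<bar> \<le> M\<^sup>2 * ?a * \<psi> s" by (simp add: power2_eq_square mult_ac)
  next
    fix s x y z :: real
    assume b: "\<bar>x\<bar> \<le> 2 * M" "\<bar>y\<bar> \<le> 2 * M" "\<bar>z\<bar> \<le> 2 * M"
    show "max_partial ?F (s, x, y, z) \<le> 4 * M\<^sup>2 * ?a * \<psi> s"
      using max_partial_trem(2)[OF ij(2,3,1) al, of "(s,x,y,z)"] b by (simp add: mult.assoc)
  qed (use ind e M1 psi_nonneg psi_le1 abnd_nonneg max_partial_trem(1)[OF ij(2,3,1) al] psi_shift_le in auto)
  also have "\<dots> \<le> C * ((M\<^sup>2 * ?a + 4 * M\<^sup>2 * ?a * exp M) * (exp (M * c1) * Q)) * \<phi> (l1 - d) (l3 - l1)"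
    using C_ge1 phi_nonneg abnd_nonneg
    by (intro mult_right_mono mult_left_mono shift_Q e) auto
  also have "C * ((M\<^sup>2 * ?a + 4 * M\<^sup>2 * ?a * exp M) * (exp (M * c1) * Q)) = K0 * Q / real L ^ (i + j)"
    unfolding K0_def abnd_def using real_L1 by (simp add: field_simps)
  finally show ?thesis by simp
qed

lemma E_trem:
  assumes ij: "i \<le> 3" "1 \<le> i + j" "i + j \<le> 4" and e: "1 \<le> e" "e \<le> k" "k - e \<le> c1 * L"
  shows "\<bar>expectation (\<lambda>\<omega>. trem fd i j (S X (e - 1) \<omega>) (X e \<omega>))\<bar> \<le> K0 * Q / real L ^ (i + j)"
proof -
  let ?a = "abnd (i + j)"
  have "\<bar>expectation (\<lambda>\<omega>. trem fd i j (S X (e - 1) \<omega>) (X e \<omega>))\<bar> \<le> expectation (\<lambda>\<omega>. \<bar>trem fd i j (S X (e - 1) \<omega>) (X e \<omega>)\<bar>)"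
    by (rule integral_abs_bound)
  also have "\<dots> \<le> expectation (\<lambda>\<omega>. ?a * \<psi> (S X (e - 1) \<omega>))"
  proof (rule expectation_mono_bddrv)
    show "bddrv \<nu> (\<lambda>\<omega>. \<bar>trem fd i j (S X (e - 1) \<omega>) (X e \<omega>)\<bar>)"
      using bddrv_trem[OF ij, of "e - 1" e] by (auto simp: bddrv_def)
    show "AE \<omega> in \<nu>. \<bar>trem fd i j (S X (e - 1) \<omega>) (X e \<omega>)\<bar> \<le> ?a * \<psi> (S X (e - 1) \<omega>)"
      using X_bound
    proof eventually_elim
      case (elim \<omega>)
      have "\<bar>X e \<omega>\<bar> \<le> 2 * M" using elim[rule_format, of e] M_ge1 by linarith
      then show ?case by (intro trem_abnd ij)
    qed
  qed (intro bddrv_cmult bddrv_psi)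
  also have "\<dots> \<le> ?a * (exp (M * c1) * Q)"
    using abnd_nonneg shift_Q[OF e] by (simp add: mult_left_mono)
  \<comment> \<open>The inserted factor is at least \<open>1\<close>; with it the same constant
    \<open>K0\<close> serves for expectations.\<close>
  also have "\<dots> \<le> C * (M\<^sup>2 + 4 * M\<^sup>2 * exp M) * (?a * (exp (M * c1) * Q))"
  proof -
    have "1 * (1 + 0) \<le> C * (M\<^sup>2 + 4 * M\<^sup>2 * exp M)"
      using C_ge1 M_ge1 by (intro mult_mono add_mono one_le_power) auto
    moreover have "0 \<le> ?a * (exp (M * c1) * Q)" using abnd_nonneg Q_nonneg by simp
    ultimately show ?thesis using mult_right_mono by fastforce
  qed
  also have "\<dots> = K0 * Q / real L ^ (i + j)"
    unfolding K0_def abnd_def using real_L1 by (simp add: field_simps)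
  finally show ?thesis .
qed

text \<open>For \<open>e = 0\<close> the truncated subtraction makes the increment vanish, so that lags may run
  past the time origin without a case distinction.\<close>

definition inc :: "nat \<Rightarrow> nat \<Rightarrow> 'a \<Rightarrow> real" where
  "inc i e \<omega> = fd i (S X e \<omega>) - fd i (S X (e - 1) \<omega>)"

lemma inc_0 [simp]: "inc i 0 = (\<lambda>_. 0)" by (simp add: inc_def[abs_def])

lemma bddrv_inc: "i \<le> 3 \<Longrightarrow> bddrv \<nu> (inc i e)"
  unfolding inc_def[abs_def] by (intro bddrv_diff bddrv_fd)

lemma inc_trem: "1 \<le> e \<Longrightarrow> inc i e \<omega> = trem fd i 1 (S X (e - 1) \<omega>) (X e \<omega>)"
  by (simp add: inc_def trem_def S_step)

lemma fd_trem: "1 \<le> e \<Longrightarrow> fd i (S X e \<omega>) = trem fd i 0 (S X (e - 1) \<omega>) (X e \<omega>)"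
  by (simp add: trem_def S_step)

lemma cov_inc:
  assumes "i \<le> 3" "al \<le> 1" "be \<le> 1" "e \<le> k" "k - e \<le> c1 * L"
    "e \<le> b" "b \<le> d" "d \<le> l1" "l1 \<le> l2" "l2 \<le> l3" "a1 + a2 + a3 \<le> 3"
  shows "\<bar>cov \<nu> (\<lambda>\<omega>. inc i e \<omega> * X b \<omega> ^ al * X d \<omega> ^ be)
     (\<lambda>\<omega>. X l1 \<omega> ^ a1 * X l2 \<omega> ^ a2 * X l3 \<omega> ^ a3)\<bar> \<le> K0 * Q / real L ^ (i + 1) * \<phi> (l1 - d) (l3 - l1)"
proof (cases "e = 0")
  case True
  then show ?thesis using K0_nonneg Q_nonneg phi_nonneg by (simp add: cov_const_left)
next
  case False
  then show ?thesis using cov_trem[of i 1 al be e b d l1 l2 l3 a1 a2 a3] assms by (simp add: inc_trem)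
qed

lemma cov_fd:
  assumes "1 \<le> i" "i \<le> 3" "e \<le> k" "k - e \<le> c1 * L" "e \<le> l1" "l1 \<le> l2" "l2 \<le> l3" "a1 + a2 + a3 \<le> 3"
  shows "\<bar>cov \<nu> (\<lambda>\<omega>. fd i (S X e \<omega>)) (\<lambda>\<omega>. X l1 \<omega> ^ a1 * X l2 \<omega> ^ a2 * X l3 \<omega> ^ a3)\<bar>
     \<le> K0 * Q / real L ^ i * \<phi> (l1 - e) (l3 - l1)"
proof (cases "e = 0")
  case True
  then show ?thesis using K0_nonneg Q_nonneg phi_nonneg by (simp add: cov_const_left)
next
  case False
  then show ?thesis using cov_trem[of i 0 0 0 e e e l1 l2 l3 a1 a2 a3] assms by (simp add: fd_trem)
qed

lemma E_inc: assumes "i \<le> 3" "e \<le> k" "k - e \<le> c1 * L"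
  shows "\<bar>expectation (inc i e)\<bar> \<le> K0 * Q / real L ^ (i + 1)"
proof (cases "e = 0")
  case True
  then show ?thesis using K0_nonneg Q_nonneg by simp
next
  case False
  then have "expectation (inc i e) = expectation (\<lambda>\<omega>. trem fd i 1 (S X (e - 1) \<omega>) (X e \<omega>))"
    by (intro Bochner_Integration.integral_cong) (simp_all add: inc_trem)
  then show ?thesis using E_trem[of i 1 e] assms False by simp
qed

text \<open>Indexed by the gap: increment \<open>q\<close> ends at time \<open>l - q\<close>, so it
  meets a product starting at \<open>l\<close> across exactly \<open>q\<close> steps.\<close>

lemma telescope:
  assumes "h \<le> T"
  shows "fd i (S X (l - 1 - h) \<omega>) = (\<Sum>q=Suc h..T. inc i (l - q) \<omega>) + fd i (S X (l - (T + 1)) \<omega>)"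
proof -
  have "(\<Sum>q=Suc h..T. inc i (l - q) \<omega>) = - (\<Sum>q=Suc h..T. fd i (S X (l - Suc q) \<omega>) - fd i (S X (l - q) \<omega>))"
    unfolding inc_def sum_negf[symmetric] by (intro sum.cong) auto
  also have "\<dots> = - (fd i (S X (l - Suc T) \<omega>) - fd i (S X (l - Suc h) \<omega>))"
    using assms by (subst sum_Suc_diff) auto
  finally show ?thesis by simp
qed

text \<open>The past is moved back increment by increment. Every lag \<open>q > h\<close> is at
  least \<open>R\<close> times the block length \<open>l3 - l1\<close>, so \<open>\<theta> q\<close>
  applies. An increment carries one power of \<open>1 / L\<close> more than the function that is
  left over at lag \<open>T + 1\<close>.\<close>

lemma past_decorrelation:
  assumes i: "1 \<le> i" "i \<le> 3" and l: "l1 \<le> l2" "l2 \<le> l3" "a1 + a2 + a3 \<le> 3" "l1 \<le> k"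
    and h: "R * (l3 - l1) \<le> h" "h \<le> T" and T: "k - l1 + T + 1 \<le> c1 * L"
  shows "\<bar>cov \<nu> (\<lambda>\<omega>. fd i (S X (l1 - 1 - h) \<omega>)) (\<lambda>\<omega>. X l1 \<omega> ^ a1 * X l2 \<omega> ^ a2 * X l3 \<omega> ^ a3)\<bar>
     \<le> K0 * Q * ((\<Sum>q=Suc h..T. \<theta> q) / real L ^ (i + 1) + \<theta> (T + 1) / real L ^ i)"
proof -
  let ?D = "\<lambda>\<omega>. X l1 \<omega> ^ a1 * X l2 \<omega> ^ a2 * X l3 \<omega> ^ a3"
  have D: "bddrv \<nu> ?D" by (intro bddrv_all)
  have KQ: "0 \<le> K0 * Q" using K0_nonneg Q_nonneg by simp
  have "cov \<nu> (\<lambda>\<omega>. fd i (S X (l1 - 1 - h) \<omega>)) ?D =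
     cov \<nu> (\<lambda>\<omega>. (\<Sum>q=Suc h..T. inc i (l1 - q) \<omega>) + fd i (S X (l1 - (T + 1)) \<omega>)) ?D"
    using telescope[OF h(2), of i l1] by presburger
  also have "\<dots> = (\<Sum>q=Suc h..T. cov \<nu> (inc i (l1 - q)) ?D) + cov \<nu> (\<lambda>\<omega>. fd i (S X (l1 - (T + 1)) \<omega>)) ?D"
    using i D by (simp add: cov_add_left cov_sum_left bddrv_inc bddrv_sum bddrv_fd)
  finally have e: "cov \<nu> (\<lambda>\<omega>. fd i (S X (l1 - 1 - h) \<omega>)) ?D = \<dots>" .
  have inc: "\<bar>cov \<nu> (inc i (l1 - q)) ?D\<bar> \<le> K0 * Q / real L ^ (i + 1) * \<theta> q" if q: "q \<in> {Suc h..T}" for q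
  proof (cases "q < l1")
    case True
    have "\<bar>cov \<nu> (\<lambda>\<omega>. inc i (l1 - q) \<omega> * X (l1 - q) \<omega> ^ 0 * X (l1 - q) \<omega> ^ 0) ?D\<bar>
        \<le> K0 * Q / real L ^ (i + 1) * \<phi> (l1 - (l1 - q)) (l3 - l1)"
      using i l h T q True by (intro cov_inc) auto
    then have "\<bar>cov \<nu> (inc i (l1 - q)) ?D\<bar> \<le> K0 * Q / real L ^ (i + 1) * \<phi> (l1 - (l1 - q)) (l3 - l1)"
      by simp
    also have "\<dots> \<le> K0 * Q / real L ^ (i + 1) * \<theta> q"
      using theta[of "l3 - l1" q] h q True KQ by (intro mult_left_mono) auto
    finally show ?thesis .
  next
    case False
    then show ?thesis using KQ theta_nonneg by (simp add: cov_const_left)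
  qed
  have ter: "\<bar>cov \<nu> (\<lambda>\<omega>. fd i (S X (l1 - (T + 1)) \<omega>)) ?D\<bar> \<le> K0 * Q / real L ^ i * \<theta> (T + 1)"
  proof (cases "T + 1 < l1")
    case True
    have "\<bar>cov \<nu> (\<lambda>\<omega>. fd i (S X (l1 - (T + 1)) \<omega>)) ?D\<bar> \<le> K0 * Q / real L ^ i * \<phi> (l1 - (l1 - (T + 1))) (l3 - l1)"
      using i l h T by (intro cov_fd) auto
    also have "\<dots> \<le> K0 * Q / real L ^ i * \<theta> (T + 1)"
      using theta[of "l3 - l1" "T + 1"] h True KQ by (intro mult_left_mono) auto
    finally show ?thesis .
  next
    case False
    then show ?thesis using KQ theta_nonneg by (simp add: cov_const_left)
  qed
  have "\<bar>cov \<nu> (\<lambda>\<omega>. fd i (S X (l1 - 1 - h) \<omega>)) ?D\<bar>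
     \<le> (\<Sum>q=Suc h..T. K0 * Q / real L ^ (i + 1) * \<theta> q) + K0 * Q / real L ^ i * \<theta> (T + 1)"
    unfolding e by (intro order_trans[OF abs_triangle_ineq] add_mono ter order_trans[OF sum_abs] sum_mono inc)
  then show ?thesis by (simp add: sum_distrib_left sum_divide_distrib distrib_left)
qed

end

section \<open>Third-order covariances\<close>

lemma (in prob_space) abs_expectation_le:
  assumes "bddrv M f" "AE \<omega> in M. \<bar>f \<omega>\<bar> \<le> a" shows "\<bar>expectation f\<bar> \<le> a"
proof -
  have "bddrv M (\<lambda>\<omega>. \<bar>f \<omega>\<bar>)" using assms(1) by (auto simp: bddrv_def)
  then have "expectation (\<lambda>\<omega>. \<bar>f \<omega>\<bar>) \<le> expectation (\<lambda>_. a)"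
    using assms(2) by (intro expectation_mono_bddrv bddrv_const)
  then have "expectation (\<lambda>\<omega>. \<bar>f \<omega>\<bar>) \<le> a" using prob_space by simp
  with integral_abs_bound[of M f] show ?thesis by (rule order_trans)
qed

context dep_test begin

definition Z :: real where "Z = expectation (\<lambda>\<omega>. fd 3 (S X (k - 1) \<omega>))"

text \<open>The error, up to the factor \<open>Q\<close>, of one third-order covariance whose largest gap is \<open>g\<close>.\<close>

definition gap_err :: "nat \<Rightarrow> real" where
  "gap_err g = (real g * \<theta> g + (\<Sum>q=Suc g..\<Lambda>. \<theta> q)) / real L ^ 4 + \<theta> (\<Lambda> + 1) / real L ^ 3"

text \<open>Only the size of the coefficient of \<open>Z\<close> is recorded. The coefficients add
  up to a bounded quantity, and \<open>Z\<close> itself is estimated once per step, through its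
  cancellation.\<close>

definition near_Z :: "real \<Rightarrow> real \<Rightarrow> real \<Rightarrow> bool" where
  "near_Z v a e \<longleftrightarrow> (\<exists>\<kappa>. \<bar>\<kappa>\<bar> \<le> a \<and> \<bar>v - \<kappa> * Z\<bar> \<le> e)"

lemma near_ZI: "\<bar>\<kappa>\<bar> \<le> a \<Longrightarrow> \<bar>v - \<kappa> * Z\<bar> \<le> e \<Longrightarrow> near_Z v a e"
  by (auto simp: near_Z_def)

lemma near_Z_mono: "near_Z v a e \<Longrightarrow> a \<le> a' \<Longrightarrow> e \<le> e' \<Longrightarrow> near_Z v a' e'"
  unfolding near_Z_def by (meson order_trans)

lemma near_Z_add: assumes "near_Z v a e" "near_Z v' a' e'" shows "near_Z (v + v') (a + a') (e + e')"
proof -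
  from assms obtain \<kappa> \<kappa>' where *: "\<bar>\<kappa>\<bar> \<le> a" "\<bar>v - \<kappa> * Z\<bar> \<le> e" "\<bar>\<kappa>'\<bar> \<le> a'" "\<bar>v' - \<kappa>' * Z\<bar> \<le> e'"
    unfolding near_Z_def by auto
  show ?thesis
  proof (rule near_ZI[of "\<kappa> + \<kappa>'"])
    show "\<bar>v + v' - (\<kappa> + \<kappa>') * Z\<bar> \<le> e + e'" using *(2,4) unfolding distrib_right by linarith
  qed (use * in linarith)
qed

lemma near_Z_sum: "(\<And>i. i \<in> I \<Longrightarrow> near_Z (v i) (a i) (e i)) \<Longrightarrow> near_Z (\<Sum>i\<in>I. v i) (\<Sum>i\<in>I. a i) (\<Sum>i\<in>I. e i)"
proof (induction I rule: infinite_finite_induct)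
  case (insert x F)
  then show ?case by (simp add: near_Z_add)
qed (auto intro!: near_ZI[of 0])

lemma near_Z_scale: assumes "near_Z v a e" "0 \<le> s" shows "near_Z (s * v) (s * a) (s * e)"
proof -
  from assms obtain \<kappa> where *: "\<bar>\<kappa>\<bar> \<le> a" "\<bar>v - \<kappa> * Z\<bar> \<le> e" unfolding near_Z_def by auto
  have "\<bar>s * v - s * \<kappa> * Z\<bar> = s * \<bar>v - \<kappa> * Z\<bar>"
    using assms(2) by (simp add: abs_mult[symmetric] abs_of_nonneg right_diff_distrib mult.assoc) (metis abs_mult abs_of_nonneg right_diff_distrib)
  then show ?thesis using * assms(2) by (intro near_ZI[of "s * \<kappa>"]) (auto simp: abs_mult intro!: mult_left_mono)
qed

lemma near_Z_err: "\<bar>v\<bar> \<le> e \<Longrightarrow> near_Z v 0 e"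
  by (rule near_ZI[of 0]) auto

text \<open>The farthest reach into the past: a gap \<open>p \<le> L\<close>, a gap
  \<open>q \<le> R * L\<close>, then \<open>\<Lambda>\<close> further lags and the terminal one. The
  value of \<open>c1\<close> is chosen for this.\<close>

lemma index_bound: "L + R * L + \<Lambda> + 1 \<le> c1 * L"
proof -
  have "L + R * L + \<Lambda> + 1 \<le> L + R * L + R * (R + 1) * L + L" using L1 by (simp add: \<Lambda>_def)
  also have "\<dots> = (R\<^sup>2 + 2 * R + 2) * L" by (simp add: power2_eq_square algebra_simps)
  also have "\<dots> \<le> c1 * L" unfolding c1_def by (intro mult_right_mono) (auto simp: power2_eq_square)
  finally show ?thesis .
qed

lemma telescope_back: "fd i (S X m \<omega>) = (\<Sum>q<s. inc i (m - q) \<omega>) + fd i (S X (m - s) \<omega>)"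
proof (induction s)
  case (Suc s)
  then show ?case by (simp add: inc_def)
qed simp

lemma E_shift:
  assumes "i \<le> 3" "s \<le> c1 * L"
  shows "\<bar>expectation (\<lambda>\<omega>. fd i (S X (k - 1) \<omega>)) - expectation (\<lambda>\<omega>. fd i (S X (k - 1 - s) \<omega>))\<bar>
    \<le> real s * (K0 * Q / real L ^ (i + 1))"
proof -
  have "expectation (\<lambda>\<omega>. fd i (S X (k - 1) \<omega>)) =
     expectation (\<lambda>\<omega>. (\<Sum>q<s. inc i (k - 1 - q) \<omega>) + fd i (S X (k - 1 - s) \<omega>))"
    by (intro Bochner_Integration.integral_cong refl telescope_back)
  also have "\<dots> = (\<Sum>q<s. expectation (inc i (k - 1 - q))) + expectation (\<lambda>\<omega>. fd i (S X (k - 1 - s) \<omega>))"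
    using assms by (subst Bochner_Integration.integral_add)
      (auto intro!: bddrv_integrable bddrv_sum bddrv_inc bddrv_fd Bochner_Integration.integral_sum)
  also have "\<bar>(\<Sum>q<s. expectation (inc i (k - 1 - q)))\<bar> \<le> (\<Sum>q<s. K0 * Q / real L ^ (i + 1))"
    using assms by (intro order_trans[OF sum_abs] sum_mono E_inc) auto
  ultimately show ?thesis by simp
qed

text \<open>Once \<open>fd 3 (S X m)\<close> is moved \<open>h\<close> steps into the past it decorrelates from both \<open>A\<close> and \<open>A * B\<close>.\<close>

lemma third_order_split:
  assumes A: "bddrv \<nu> A" and B: "bddrv \<nu> B" and EB: "\<bar>expectation B\<bar> \<le> M\<^sup>2"
    and inc: "\<And>q. q < h \<Longrightarrow> \<bar>cov \<nu> (\<lambda>\<omega>. inc 3 (m - q) \<omega> * A \<omega>) B\<bar> \<le> \<epsilon>"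
    and t1: "\<bar>cov \<nu> (\<lambda>\<omega>. fd 3 (S X (m - h) \<omega>)) (\<lambda>\<omega>. A \<omega> * B \<omega>)\<bar> \<le> \<tau>"
    and t2: "\<bar>cov \<nu> (\<lambda>\<omega>. fd 3 (S X (m - h) \<omega>)) A\<bar> \<le> \<tau>"
    and r: "\<bar>cov \<nu> A B\<bar> \<le> \<rho>"
    and d: "\<bar>Z - expectation (\<lambda>\<omega>. fd 3 (S X (m - h) \<omega>))\<bar> \<le> \<delta>"
  shows "\<bar>cov \<nu> (\<lambda>\<omega>. fd 3 (S X m \<omega>) * A \<omega>) B - cov \<nu> A B * Z\<bar> \<le> real h * \<epsilon> + \<tau> + M\<^sup>2 * \<tau> + \<rho> * \<delta>"
proof -
  let ?Y = "\<lambda>\<omega>. fd 3 (S X (m - h) \<omega>)"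
  have Y: "bddrv \<nu> ?Y" by (simp add: bddrv_fd)
  have "cov \<nu> (\<lambda>\<omega>. fd 3 (S X m \<omega>) * A \<omega>) B = cov \<nu> (\<lambda>\<omega>. (\<Sum>q<h. inc 3 (m - q) \<omega> * A \<omega>) + ?Y \<omega> * A \<omega>) B"
    by (subst telescope_back[of _ m _ h]) (simp add: distrib_right sum_distrib_right)
  also have "\<dots> = (\<Sum>q<h. cov \<nu> (\<lambda>\<omega>. inc 3 (m - q) \<omega> * A \<omega>) B) + cov \<nu> (\<lambda>\<omega>. ?Y \<omega> * A \<omega>) B"
    using A B Y by (simp add: cov_add_left cov_sum_left bddrv_inc bddrv_sum bddrv_mult)
  finally have 1: "cov \<nu> (\<lambda>\<omega>. fd 3 (S X m \<omega>) * A \<omega>) B = \<dots>" .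
  \<comment> \<open>Three-factor identity. The first two covariances are small because
    \<open>?Y\<close> lies far in the past of \<open>A\<close> and \<open>B\<close>; the last
    summand is the multiple of \<open>Z\<close>, once \<open>expectation ?Y\<close> is replaced by
    \<open>Z\<close>.\<close>
  have 2: "cov \<nu> (\<lambda>\<omega>. ?Y \<omega> * A \<omega>) B = cov \<nu> ?Y (\<lambda>\<omega>. A \<omega> * B \<omega>) - cov \<nu> ?Y A * expectation B
     + expectation ?Y * cov \<nu> A B"
    by (simp add: cov_def algebra_simps)
  have b1: "\<bar>\<Sum>q<h. cov \<nu> (\<lambda>\<omega>. inc 3 (m - q) \<omega> * A \<omega>) B\<bar> \<le> (\<Sum>q<h. \<epsilon>)"
    by (intro order_trans[OF sum_abs] sum_mono inc) auto
  have b2: "\<bar>cov \<nu> ?Y A * expectation B\<bar> \<le> \<tau> * M\<^sup>2"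
    unfolding abs_mult using t2 EB by (intro mult_mono) auto
  have b3: "\<bar>cov \<nu> A B * (Z - expectation ?Y)\<bar> \<le> \<rho> * \<delta>"
    unfolding abs_mult using r d by (intro mult_mono) auto
  have e3: "expectation ?Y * cov \<nu> A B = cov \<nu> A B * Z - cov \<nu> A B * (Z - expectation ?Y)"
    by (simp add: algebra_simps)
  show ?thesis unfolding 1 2 e3 using b1 b2 b3 t1 by (simp add: mult.commute[of "M\<^sup>2"]) linarith
qed

text \<open>The summands pay for the number \<open>h\<close> of increments, for the terms
  \<open>\<tau>\<close> and \<open>M\<^sup>2 * \<tau>\<close>, and for
  \<open>3 * C * M\<^sup>2\<close> times the shift bound \<open>4 * (R + 1)\<^sup>2\<close>.\<close>

definition K1 :: real where
  "K1 = K0 * (2 * R * (R + 1) + 1 + M\<^sup>2 + 12 * C * M\<^sup>2 * (R + 1)\<^sup>2)"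

lemma K1_nonneg: "0 \<le> K1"
  unfolding K1_def using K0_nonneg C_ge1 by (intro mult_nonneg_nonneg add_nonneg_nonneg) auto

lemma gap_err_nonneg: "0 \<le> gap_err g"
  unfolding gap_err_def using theta_nonneg by (intro add_nonneg_nonneg divide_nonneg_nonneg sum_nonneg) auto

text \<open>All four contributions of \<open>third_order_split\<close> fit into one
  \<open>gap_err g\<close>, because the number \<open>h\<close> of increments and the number
  \<open>s\<close> of shifted steps are at most constant multiples of the gap
  \<open>g\<close>.\<close>

lemma third_order_error:
  assumes h: "h \<le> 2 * R * (R + 1) * g" "s \<le> 4 * (R + 1)\<^sup>2 * g" "g \<le> h"
  shows "real h * (K0 * Q / real L ^ 4 * \<theta> g)
      + K0 * Q * ((\<Sum>q=Suc h..\<Lambda>. \<theta> q) / real L ^ 4 + \<theta> (\<Lambda> + 1) / real L ^ 3)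
      + M\<^sup>2 * (K0 * Q * ((\<Sum>q=Suc h..\<Lambda>. \<theta> q) / real L ^ 4 + \<theta> (\<Lambda> + 1) / real L ^ 3))
      + (3 * C * M\<^sup>2 * \<theta> g) * (real s * (K0 * Q / real L ^ 4)) \<le> K1 * Q * gap_err g"
proof -
  define w where "w = K0 * Q"
  define u where "u = real g * \<theta> g / real L ^ 4"
  define v where "v = (\<Sum>q=Suc g..\<Lambda>. \<theta> q) / real L ^ 4 + \<theta> (\<Lambda> + 1) / real L ^ 3"
  define v' where "v' = (\<Sum>q=Suc h..\<Lambda>. \<theta> q) / real L ^ 4 + \<theta> (\<Lambda> + 1) / real L ^ 3"
  have w: "0 \<le> w" unfolding w_def using K0_nonneg Q_nonneg by simp
  have u: "0 \<le> u" unfolding u_def using theta_nonneg by simp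
  have v: "0 \<le> v" unfolding v_def using theta_nonneg by (intro add_nonneg_nonneg divide_nonneg_nonneg sum_nonneg) auto
  have vv: "v' \<le> v" unfolding v_def v'_def using h theta_nonneg
    by (intro add_mono divide_right_mono sum_mono2) auto
  have hr: "real h \<le> 2 * R * (R + 1) * real g" using h(1) by (metis of_nat_le_iff of_nat_mult of_nat_numeral)
  have sr: "real s \<le> 4 * (R + 1)\<^sup>2 * real g" using h(2) by (metis of_nat_le_iff of_nat_mult of_nat_numeral of_nat_power)
  have "real h * (w / real L ^ 4 * \<theta> g) = real h * (w * \<theta> g / real L ^ 4)" by simp
  also have "\<dots> \<le> (2 * R * (R + 1) * real g) * (w * \<theta> g / real L ^ 4)"
    using hr w theta_nonneg by (intro mult_right_mono) auto
  also have "\<dots> = 2 * R * (R + 1) * (w * u)" by (simp add: u_def)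
  finally have 1: "real h * (w / real L ^ 4 * \<theta> g) \<le> 2 * R * (R + 1) * (w * u)" .
  have "(3 * C * M\<^sup>2 * \<theta> g) * (real s * (w / real L ^ 4)) \<le> (3 * C * M\<^sup>2 * \<theta> g) * ((4 * (R + 1)\<^sup>2 * real g) * (w / real L ^ 4))"
    using sr w theta_nonneg C_ge1 by (intro mult_left_mono mult_right_mono) auto
  also have "\<dots> = 12 * C * M\<^sup>2 * (R + 1)\<^sup>2 * (w * u)" by (simp add: u_def)
  finally have 2: "(3 * C * M\<^sup>2 * \<theta> g) * (real s * (w / real L ^ 4)) \<le> 12 * C * M\<^sup>2 * (R + 1)\<^sup>2 * (w * u)" .
  have 3: "w * v' \<le> w * v" "M\<^sup>2 * (w * v') \<le> M\<^sup>2 * (w * v)" using vv w by (auto intro!: mult_left_mono)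
  have "real h * (w / real L ^ 4 * \<theta> g) + w * v' + M\<^sup>2 * (w * v') + (3 * C * M\<^sup>2 * \<theta> g) * (real s * (w / real L ^ 4))
    \<le> 2 * R * (R + 1) * (w * u) + w * v + M\<^sup>2 * (w * v) + 12 * C * M\<^sup>2 * (R + 1)\<^sup>2 * (w * u)"
    using 1 2 3 by linarith
  also have "\<dots> = (2 * R * (R + 1) + 12 * C * M\<^sup>2 * (R + 1)\<^sup>2) * (w * u) + (1 + M\<^sup>2) * (w * v)"
    by (simp add: algebra_simps)
  also have "\<dots> \<le> (2 * R * (R + 1) + 1 + M\<^sup>2 + 12 * C * M\<^sup>2 * (R + 1)\<^sup>2) * (w * u)
      + (2 * R * (R + 1) + 1 + M\<^sup>2 + 12 * C * M\<^sup>2 * (R + 1)\<^sup>2) * (w * v)"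
    by (rule add_mono; rule mult_right_mono) (use w u v C_ge1 in auto)
  also have "\<dots> = K1 * Q * (u + v)" unfolding K1_def w_def by (simp add: algebra_simps)
  also have "u + v = gap_err g" unfolding gap_err_def u_def v_def by (simp add: add_divide_distrib)
  finally show ?thesis unfolding w_def v'_def .
qed

lemma E_X_prod: "\<bar>expectation (\<lambda>\<omega>. X i \<omega> * X j \<omega>)\<bar> \<le> M\<^sup>2"
proof (rule abs_expectation_le)
  show "AE \<omega> in \<nu>. \<bar>X i \<omega> * X j \<omega>\<bar> \<le> M\<^sup>2"
    using X_bound by eventually_elim (use M_ge1 in \<open>auto simp: abs_mult power2_eq_square intro!: mult_mono\<close>)
qed (intro bddrv_all)

text \<open>Here the first gap \<open>q\<close> dominates the block behind it, so the triple is cut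
  after its first index. The offset \<open>h = R * (p + q)\<close> is \<open>R\<close> times the
  whole length, which permits decorrelating the past from all three variables.\<close>

lemma third_order_split_first:
  assumes pq: "p \<le> L" "q \<le> R * L" "p + q < k" "1 \<le> q" "R * p \<le> q"
  shows "\<bar>cov \<nu> (\<lambda>\<omega>. fd 3 (S X (k - p - q - 1) \<omega>) * X (k - p - q) \<omega>) (\<lambda>\<omega>. X (k - p) \<omega> * X k \<omega>)
     - cov \<nu> (X (k - p - q)) (\<lambda>\<omega>. X (k - p) \<omega> * X k \<omega>) * Z\<bar> \<le> K1 * Q * gap_err q"
    and "\<bar>cov \<nu> (X (k - p - q)) (\<lambda>\<omega>. X (k - p) \<omega> * X k \<omega>)\<bar> \<le> 3 * C * M\<^sup>2 * \<theta> q"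
proof -
  define a b h where "a = k - p - q" and "b = k - p" and "h = R * (p + q)"
  have p: "p \<le> q" using pq mult_le_mono1[OF R1, of p] by linarith
  have hL: "h \<le> \<Lambda>"
  proof -
    have "h \<le> R * (L + R * L)" unfolding h_def using pq by (intro mult_le_mono2 add_mono)
    then show ?thesis by (simp add: \<Lambda>_def algebra_simps)
  qed
  have gh: "q \<le> h" unfolding h_def by (rule order_trans[OF _ mult_le_mono1[OF R1]]) simp
  have ib: "p + q + \<Lambda> + 1 \<le> c1 * L" using index_bound pq by linarith
  have ab: "1 \<le> a" "a \<le> b" "b \<le> k" "k - a = p + q" "k - b = p" "b - a = q" unfolding a_def b_def using pq by auto
  have th: "\<phi> q p \<le> \<theta> q" using theta pq by simp
  have KQ: "0 \<le> K0 * Q" using K0_nonneg Q_nonneg by simp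
  show r: "\<bar>cov \<nu> (X (k - p - q)) (\<lambda>\<omega>. X (k - p) \<omega> * X k \<omega>)\<bar> \<le> 3 * C * M\<^sup>2 * \<theta> q"
  proof -
    have "\<bar>cov \<nu> (\<lambda>\<omega>. X a \<omega> * X a \<omega> ^ 0) (\<lambda>\<omega>. X b \<omega> ^ 1 * X k \<omega> ^ 1)\<bar> \<le> 3 * C * M\<^sup>2 * \<phi> (b - a) (k - b)"
      using ab by (intro cov_X_bound) auto
    also have "\<dots> \<le> 3 * C * M\<^sup>2 * \<theta> q" using th C_ge1 ab by (intro mult_left_mono) auto
    finally show ?thesis by (simp add: a_def b_def)
  qed
  let ?\<tau> = "K0 * Q * ((\<Sum>q=Suc h..\<Lambda>. \<theta> q) / real L ^ 4 + \<theta> (\<Lambda> + 1) / real L ^ 3)"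
  have "\<bar>cov \<nu> (\<lambda>\<omega>. fd 3 (S X (a - 1) \<omega>) * X a \<omega>) (\<lambda>\<omega>. X b \<omega> * X k \<omega>)
     - cov \<nu> (X a) (\<lambda>\<omega>. X b \<omega> * X k \<omega>) * Z\<bar> \<le> real h * (K0 * Q / real L ^ 4 * \<theta> q) + ?\<tau> + M\<^sup>2 * ?\<tau>
       + (3 * C * M\<^sup>2 * \<theta> q) * (real (p + q + h) * (K0 * Q / real L ^ 4))"
  proof (rule third_order_split)
    show "\<bar>cov \<nu> (\<lambda>\<omega>. inc 3 (a - 1 - q') \<omega> * X a \<omega>) (\<lambda>\<omega>. X b \<omega> * X k \<omega>)\<bar> \<le> K0 * Q / real L ^ 4 * \<theta> q" if "q' < h" for q'
    proof -
      have "\<bar>cov \<nu> (\<lambda>\<omega>. inc 3 (a - 1 - q') \<omega> * X a \<omega> ^ 1 * X a \<omega> ^ 0) (\<lambda>\<omega>. X b \<omega> ^ 1 * X k \<omega> ^ 1 * X k \<omega> ^ 0)\<bar>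
        \<le> K0 * Q / real L ^ (3 + 1) * \<phi> (b - a) (k - b)"
        using ab ib hL that by (intro cov_inc) auto
      also have "\<dots> \<le> K0 * Q / real L ^ (3 + 1) * \<theta> q" using th KQ ab by (intro mult_left_mono) auto
      finally show ?thesis by simp
    qed
    show "\<bar>cov \<nu> (\<lambda>\<omega>. fd 3 (S X (a - 1 - h) \<omega>)) (\<lambda>\<omega>. X a \<omega> * (X b \<omega> * X k \<omega>))\<bar> \<le> ?\<tau>"
      using past_decorrelation[of 3 a b k 1 1 1 h \<Lambda>] ab ib hL by (simp add: h_def mult.assoc)
    show "\<bar>cov \<nu> (\<lambda>\<omega>. fd 3 (S X (a - 1 - h) \<omega>)) (X a)\<bar> \<le> ?\<tau>"
      using past_decorrelation[of 3 a a a 1 0 0 h \<Lambda>] ab ib hL by simp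
    have "k - 1 - (p + q + h) = a - 1 - h" unfolding a_def by simp
    then show "\<bar>Z - expectation (\<lambda>\<omega>. fd 3 (S X (a - 1 - h) \<omega>))\<bar> \<le> real (p + q + h) * (K0 * Q / real L ^ 4)"
      using E_shift[of 3 "p + q + h"] ib hL unfolding Z_def by simp
  qed (use r E_X_prod in \<open>auto intro!: bddrv_all simp: a_def b_def\<close>)
  also have "\<dots> \<le> K1 * Q * gap_err q"
  proof (rule third_order_error)
    have h: "h \<le> R * (2 * q)" unfolding h_def using p by (intro mult_le_mono2) auto
    note h
    also have "R * (2 * q) \<le> 2 * R * (R + 1) * q" by (simp add: algebra_simps)
    finally show "h \<le> 2 * R * (R + 1) * q" .
    have "p + q + h \<le> 2 * q + R * (2 * q)" using p h by linarith
    also have "\<dots> \<le> 4 * (R + 1)\<^sup>2 * q" by (simp add: power2_eq_square algebra_simps)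
    finally show "p + q + h \<le> 4 * (R + 1)\<^sup>2 * q" .
  qed (rule gh)
  finally show "\<bar>cov \<nu> (\<lambda>\<omega>. fd 3 (S X (k - p - q - 1) \<omega>) * X (k - p - q) \<omega>) (\<lambda>\<omega>. X (k - p) \<omega> * X k \<omega>)
     - cov \<nu> (X (k - p - q)) (\<lambda>\<omega>. X (k - p) \<omega> * X k \<omega>) * Z\<bar> \<le> K1 * Q * gap_err q" by (simp add: a_def b_def)
qed

text \<open>Here the cut is at the second gap \<open>p\<close>. A single variable lies behind it, so
  the block length is \<open>0\<close> and \<open>\<theta> p\<close> is always available;
  \<open>q \<le> R * p\<close> keeps the offset \<open>h\<close> proportional to
  \<open>p\<close>.\<close>

lemma third_order_split_last:
  assumes pq: "p \<le> L" "q \<le> R * L" "p + q < k" "1 \<le> p" "q \<le> R * p"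
  shows "\<bar>cov \<nu> (\<lambda>\<omega>. fd 3 (S X (k - p - q - 1) \<omega>) * (X (k - p - q) \<omega> * X (k - p) \<omega>)) (X k)
     - cov \<nu> (\<lambda>\<omega>. X (k - p - q) \<omega> * X (k - p) \<omega>) (X k) * Z\<bar> \<le> K1 * Q * gap_err p"
    and "\<bar>cov \<nu> (\<lambda>\<omega>. X (k - p - q) \<omega> * X (k - p) \<omega>) (X k)\<bar> \<le> 3 * C * M\<^sup>2 * \<theta> p"
proof -
  define a b h where "a = k - p - q" and "b = k - p" and "h = R * (p + q)"
  have hL: "h \<le> \<Lambda>"
  proof -
    have "h \<le> R * (L + R * L)" unfolding h_def using pq by (intro mult_le_mono2 add_mono)
    then show ?thesis by (simp add: \<Lambda>_def algebra_simps)
  qed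
  have gh: "p \<le> h" unfolding h_def by (rule order_trans[OF _ mult_le_mono1[OF R1]]) simp
  have ib: "p + q + \<Lambda> + 1 \<le> c1 * L" using index_bound pq by linarith
  have ab: "1 \<le> a" "a \<le> b" "b \<le> k" "k - a = p + q" "k - b = p" "b - a = q" unfolding a_def b_def using pq by auto
  have th: "\<phi> p 0 \<le> \<theta> p" using theta pq by simp
  have KQ: "0 \<le> K0 * Q" using K0_nonneg Q_nonneg by simp
  show r: "\<bar>cov \<nu> (\<lambda>\<omega>. X (k - p - q) \<omega> * X (k - p) \<omega>) (X k)\<bar> \<le> 3 * C * M\<^sup>2 * \<theta> p"
  proof -
    have "\<bar>cov \<nu> (\<lambda>\<omega>. X a \<omega> * X b \<omega> ^ 1) (\<lambda>\<omega>. X k \<omega> ^ 1 * X k \<omega> ^ 0)\<bar> \<le> 3 * C * M\<^sup>2 * \<phi> (k - b) (k - k)"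
      using ab by (intro cov_X_bound) auto
    also have "\<dots> \<le> 3 * C * M\<^sup>2 * \<theta> p" using th C_ge1 ab by (intro mult_left_mono) auto
    finally show ?thesis by (simp add: a_def b_def)
  qed
  let ?\<tau> = "K0 * Q * ((\<Sum>q=Suc h..\<Lambda>. \<theta> q) / real L ^ 4 + \<theta> (\<Lambda> + 1) / real L ^ 3)"
  have "\<bar>cov \<nu> (\<lambda>\<omega>. fd 3 (S X (a - 1) \<omega>) * (X a \<omega> * X b \<omega>)) (X k)
     - cov \<nu> (\<lambda>\<omega>. X a \<omega> * X b \<omega>) (X k) * Z\<bar> \<le> real h * (K0 * Q / real L ^ 4 * \<theta> p) + ?\<tau> + M\<^sup>2 * ?\<tau>
       + (3 * C * M\<^sup>2 * \<theta> p) * (real (p + q + h) * (K0 * Q / real L ^ 4))"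
  proof (rule third_order_split)
    show "\<bar>cov \<nu> (\<lambda>\<omega>. inc 3 (a - 1 - q') \<omega> * (X a \<omega> * X b \<omega>)) (X k)\<bar> \<le> K0 * Q / real L ^ 4 * \<theta> p" if "q' < h" for q'
    proof -
      have "\<bar>cov \<nu> (\<lambda>\<omega>. inc 3 (a - 1 - q') \<omega> * X a \<omega> ^ 1 * X b \<omega> ^ 1) (\<lambda>\<omega>. X k \<omega> ^ 1 * X k \<omega> ^ 0 * X k \<omega> ^ 0)\<bar>
        \<le> K0 * Q / real L ^ (3 + 1) * \<phi> (k - b) (k - k)"
        using ab ib hL that by (intro cov_inc) auto
      also have "\<dots> \<le> K0 * Q / real L ^ (3 + 1) * \<theta> p" using th KQ ab by (intro mult_left_mono) auto
      finally show ?thesis by (simp add: mult.assoc)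
    qed
    show "\<bar>cov \<nu> (\<lambda>\<omega>. fd 3 (S X (a - 1 - h) \<omega>)) (\<lambda>\<omega>. X a \<omega> * X b \<omega> * X k \<omega>)\<bar> \<le> ?\<tau>"
      using past_decorrelation[of 3 a b k 1 1 1 h \<Lambda>] ab ib hL by (simp add: h_def)
    show "\<bar>cov \<nu> (\<lambda>\<omega>. fd 3 (S X (a - 1 - h) \<omega>)) (\<lambda>\<omega>. X a \<omega> * X b \<omega>)\<bar> \<le> ?\<tau>"
      using past_decorrelation[of 3 a b b 1 1 0 h \<Lambda>] ab ib hL by (simp add: h_def)
    have "k - 1 - (p + q + h) = a - 1 - h" unfolding a_def by simp
    then show "\<bar>Z - expectation (\<lambda>\<omega>. fd 3 (S X (a - 1 - h) \<omega>))\<bar> \<le> real (p + q + h) * (K0 * Q / real L ^ 4)"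
      using E_shift[of 3 "p + q + h"] ib hL unfolding Z_def by simp
  qed (use r X_mean in \<open>auto intro!: bddrv_all simp: a_def b_def\<close>)
  also have "\<dots> \<le> K1 * Q * gap_err p"
  proof (rule third_order_error)
    have h: "h \<le> R * (R + 1) * p" 
    proof -
      have "p + q \<le> (R + 1) * p" using pq(5) by simp
      from mult_le_mono2[OF this, of R] show ?thesis unfolding h_def by (simp only: mult.assoc)
    qed
    also have "R * (R + 1) * p \<le> 2 * R * (R + 1) * p" by (simp add: algebra_simps)
    finally show "h \<le> 2 * R * (R + 1) * p" .
    have "p + q + h \<le> (R + 1) * p + R * (R + 1) * p" using pq(5) h by simp
    also have "\<dots> \<le> 4 * (R + 1)\<^sup>2 * p" by (simp add: power2_eq_square algebra_simps)
    finally show "p + q + h \<le> 4 * (R + 1)\<^sup>2 * p" .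
  qed (rule gh)
  finally show "\<bar>cov \<nu> (\<lambda>\<omega>. fd 3 (S X (k - p - q - 1) \<omega>) * (X (k - p - q) \<omega> * X (k - p) \<omega>)) (X k)
     - cov \<nu> (\<lambda>\<omega>. X (k - p - q) \<omega> * X (k - p) \<omega>) (X k) * Z\<bar> \<le> K1 * Q * gap_err p" by (simp add: a_def b_def)
qed

end

section \<open>Expansion of one Lindeberg step\<close>

context dep_test begin

text \<open>A covariance over \<open>k - p - q \<le> k - p \<le> k\<close> is split at its second gap \<open>p\<close> unless the first gap
  \<open>q\<close> dominates \<open>p\<close> so much that \<open>\<phi> q p \<le> \<theta> q\<close>.\<close>

definition split_gap :: "nat \<Rightarrow> nat \<Rightarrow> nat" where "split_gap p q = (if R * p \<le> q then q else p)"

definition K2 :: real where "K2 = K1 + K0 + 3 * C * M\<^sup>2 * K0 * (1 + Th)"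

definition cp :: "nat \<Rightarrow> real" where "cp p = expectation (\<lambda>\<omega>. X 0 \<omega> * X p \<omega>)"

lemma Th_nonneg: "0 \<le> Th" using Th[of 0] by simp

lemma theta_mult_le: "real g * \<theta> g \<le> Th"
proof (cases "g = 0")
  case False
  then have "real g * \<theta> g \<le> (\<Sum>g=1..g. real g * \<theta> g)"
    using theta_nonneg by (intro member_le_sum) auto
  with Th[of g] show ?thesis by linarith
qed (simp add: Th_nonneg)

lemma theta_le_mult: "1 \<le> g \<Longrightarrow> \<theta> g \<le> real g * \<theta> g"
  using theta_nonneg[of g] mult_right_mono[of 1 "real g" "\<theta> g"] by simp

lemma sum_theta_le: "(\<Sum>q=Suc h..n. \<theta> q) \<le> Th"
proof -
  have "(\<Sum>q=Suc h..n. \<theta> q) \<le> (\<Sum>q=1..n. real q * \<theta> q)"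
    using theta_nonneg theta_le_mult
    by (intro order_trans[OF sum_mono[OF theta_le_mult] sum_mono2]) auto
  with Th[of n] show ?thesis by linarith
qed

lemma KQ_nonneg: "0 \<le> K0 * Q" using K0_nonneg Q_nonneg by simp

lemma gap_err_ge: "real g * \<theta> g / real L ^ 4 \<le> gap_err g"
  unfolding gap_err_def add_divide_distrib using theta_nonneg by (simp add: sum_nonneg)

lemma gap_err_ge1: "1 \<le> g \<Longrightarrow> \<theta> g / real L ^ 4 \<le> gap_err g"
  by (rule order_trans[OF divide_right_mono[OF theta_le_mult] gap_err_ge]) auto

lemma gap_err_ge2: "real g * \<theta> g * ((1 + Th) / real L ^ 4 + \<theta> (\<Lambda> + 1) / real L ^ 3) \<le> (1 + Th) * gap_err g"
proof -
  have "real g * \<theta> g * (\<theta> (\<Lambda> + 1) / real L ^ 3) \<le> Th * (\<theta> (\<Lambda> + 1) / real L ^ 3)"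
    using theta_nonneg by (intro mult_right_mono theta_mult_le) auto
  also have "\<dots> \<le> (1 + Th) * (\<theta> (\<Lambda> + 1) / real L ^ 3)"
    using theta_nonneg by (intro mult_right_mono) auto
  finally have "real g * \<theta> g * ((1 + Th) / real L ^ 4 + \<theta> (\<Lambda> + 1) / real L ^ 3)
    \<le> (1 + Th) * (real g * \<theta> g / real L ^ 4 + \<theta> (\<Lambda> + 1) / real L ^ 3)"
    by (simp add: distrib_left mult_ac)
  also have "\<dots> \<le> (1 + Th) * gap_err g"
    unfolding gap_err_def add_divide_distrib using theta_nonneg Th_nonneg by (intro mult_left_mono) (auto simp: sum_nonneg)
  finally show ?thesis .
qed

lemma gap_err_ge3: "1 \<le> g \<Longrightarrow> \<theta> g * ((1 + Th) / real L ^ 4 + \<theta> (\<Lambda> + 1) / real L ^ 3) \<le> (1 + Th) * gap_err g"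
  using theta_nonneg Th_nonneg theta_le_mult[of g] gap_err_ge2[of g]
  by (intro order_trans[OF mult_right_mono[OF theta_le_mult] gap_err_ge2]) auto

text \<open>This and the next two expansions treat the increments of \<open>f''\<close>,
  \<open>f'\<close> and \<open>f\<close>. Each stops where the remainder has
  \<open>i + j = 4\<close>, the order at which a crude bound is affordable.\<close>

lemma inc2_eq: "1 \<le> e \<Longrightarrow> inc 2 e = (\<lambda>\<omega>. fd 3 (S X (e - 1) \<omega>) * X e \<omega> + trem fd 2 2 (S X (e - 1) \<omega>) (X e \<omega>))"
  by (auto simp: inc_def trem_def S_step fun_eq_iff numeral_2_eq_2 numeral_3_eq_3)

lemma inc1_eq: "1 \<le> e \<Longrightarrow> inc 1 e = (\<lambda>\<omega>. fd 2 (S X (e - 1) \<omega>) * X e \<omega> + (1/2) * (fd 3 (S X (e - 1) \<omega>) * (X e \<omega> * X e \<omega>))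
   + trem fd 1 3 (S X (e - 1) \<omega>) (X e \<omega>))"
  by (auto simp: inc_def trem_def S_step fun_eq_iff numeral_2_eq_2 numeral_3_eq_3)

lemma inc0_eq: "1 \<le> e \<Longrightarrow> inc 0 e = (\<lambda>\<omega>. fd 1 (S X (e - 1) \<omega>) * X e \<omega> + (1/2) * (fd 2 (S X (e - 1) \<omega>) * (X e \<omega> * X e \<omega>))
   + (1/6) * (fd 3 (S X (e - 1) \<omega>) * X e \<omega> ^ 3) + trem fd 0 4 (S X (e - 1) \<omega>) (X e \<omega>))"
  by (auto simp: inc_def trem_def S_step fun_eq_iff eval_nat_numeral)

text \<open>Since \<open>X e\<close> is centered, the leading term is a covariance. Apart from the
  terminal term this gains a power of \<open>1 / L\<close> over the order \<open>L^-3\<close> that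
  \<open>E_inc\<close> gives.\<close>

lemma E_inc2:
  assumes "e \<le> k" "k - e + \<Lambda> + 1 \<le> c1 * L"
  shows "\<bar>expectation (inc 2 e)\<bar> \<le> K0 * Q * ((1 + Th) / real L ^ 4 + \<theta> (\<Lambda> + 1) / real L ^ 3)"
proof (cases "e = 0")
  case True
  then show ?thesis using KQ_nonneg theta_nonneg Th_nonneg by simp
next
  case False
  have "expectation (inc 2 e) = expectation (\<lambda>\<omega>. fd 3 (S X (e - 1) \<omega>) * X e \<omega>) + expectation (\<lambda>\<omega>. trem fd 2 2 (S X (e - 1) \<omega>) (X e \<omega>))"
    using False by (subst inc2_eq) (auto intro!: Bochner_Integration.integral_add bddrv_integrable bddrv_all)
  also have "expectation (\<lambda>\<omega>. fd 3 (S X (e - 1) \<omega>) * X e \<omega>) = cov \<nu> (\<lambda>\<omega>. fd 3 (S X (e - 1) \<omega>)) (X e)"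
    using X_mean by (simp add: cov_def)
  finally have e: "expectation (inc 2 e) = cov \<nu> (\<lambda>\<omega>. fd 3 (S X (e - 1) \<omega>)) (X e)
     + expectation (\<lambda>\<omega>. trem fd 2 2 (S X (e - 1) \<omega>) (X e \<omega>))" .
  have "\<bar>cov \<nu> (\<lambda>\<omega>. fd 3 (S X (e - 1) \<omega>)) (X e)\<bar> \<le> K0 * Q * ((\<Sum>q=Suc 0..\<Lambda>. \<theta> q) / real L ^ 4 + \<theta> (\<Lambda> + 1) / real L ^ 3)"
    using past_decorrelation[of 3 e e e 1 0 0 0 \<Lambda>] assms False by simp
  also have "\<dots> \<le> K0 * Q * (Th / real L ^ 4 + \<theta> (\<Lambda> + 1) / real L ^ 3)"
    using KQ_nonneg sum_theta_le by (intro mult_left_mono add_mono divide_right_mono) auto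
  finally have 1: "\<bar>cov \<nu> (\<lambda>\<omega>. fd 3 (S X (e - 1) \<omega>)) (X e)\<bar> \<le> \<dots>" .
  have 2: "\<bar>expectation (\<lambda>\<omega>. trem fd 2 2 (S X (e - 1) \<omega>) (X e \<omega>))\<bar> \<le> K0 * Q / real L ^ 4"
    using E_trem[of 2 2 e] assms False by simp
  have "\<bar>expectation (inc 2 e)\<bar> \<le> K0 * Q * (Th / real L ^ 4 + \<theta> (\<Lambda> + 1) / real L ^ 3) + K0 * Q / real L ^ 4"
    unfolding e using 1 2 by linarith
  also have "\<dots> = K0 * Q * ((1 + Th) / real L ^ 4 + \<theta> (\<Lambda> + 1) / real L ^ 3)"
    by (simp add: add_divide_distrib distrib_left)
  finally show ?thesis .
qed

lemma cp_eq: "p \<le> k \<Longrightarrow> expectation (\<lambda>\<omega>. X (k - p) \<omega> * X k \<omega>) = cp p"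
  using X_corr[of "k - p" p] by (simp add: cp_def)

lemma cp_bound: "\<bar>cp p\<bar> \<le> 3 * C * M\<^sup>2 * \<theta> p"
proof -
  have "cp p = cov \<nu> (\<lambda>\<omega>. X 1 \<omega> * X 1 \<omega> ^ 0) (\<lambda>\<omega>. X (1 + p) \<omega> ^ 1 * X (1 + p) \<omega> ^ 0)"
    using X_corr[of 1 p] by (simp add: cov_def X_mean cp_def)
  also have "\<bar>\<dots>\<bar> \<le> 3 * C * M\<^sup>2 * \<phi> (1 + p - 1) (1 + p - (1 + p))"
    by (intro cov_X_bound) auto
  also have "\<dots> \<le> 3 * C * M\<^sup>2 * \<theta> p" using C_ge1 theta[of 0 p] by (intro mult_left_mono) auto
  finally show ?thesis .
qed

lemma K2_ge: "K1 + K0 \<le> K2" "K1 + 3 * C * M\<^sup>2 * K0 * (1 + Th) \<le> K2" "0 \<le> K2"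
  unfolding K2_def using K0_nonneg K1_nonneg C_ge1 Th_nonneg by auto

lemma second_order_increment:
  assumes pq: "p \<le> L" "1 \<le> q" "q \<le> R * L" "p < k"
  shows "near_Z (cov \<nu> (inc 2 (k - p - q)) (\<lambda>\<omega>. X (k - p) \<omega> * X k \<omega>)) (3 * C * M\<^sup>2 * \<theta> (split_gap p q)) (K2 * Q * gap_err (split_gap p q))"
proof (cases "p + q < k")
  case False
  then have "k - p - q = 0" by simp
  then show ?thesis using C_ge1 theta_nonneg K2_ge(3) Q_nonneg gap_err_nonneg by (intro near_ZI[of 0]) (auto simp: cov_const_left)
next
  case True
  define e b where "e = k - p - q" and "b = k - p"
  have eb: "1 \<le> e" "e \<le> b" "b \<le> k" "k - e = p + q" "k - b = p" "b - e = q" "e \<le> k" unfolding e_def b_def using pq True by auto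
  have ib: "p + q + \<Lambda> + 1 \<le> c1 * L" using index_bound pq by linarith
  have bB: "bddrv \<nu> (\<lambda>\<omega>. X b \<omega> * X k \<omega>)" "bddrv \<nu> (\<lambda>\<omega>. fd 3 (S X (e - 1) \<omega>) * X e \<omega>)"
     "bddrv \<nu> (\<lambda>\<omega>. trem fd 2 2 (S X (e - 1) \<omega>) (X e \<omega>))"  by (intro bddrv_all; simp)+
  show ?thesis
  proof (cases "R * p \<le> q")
    case T: True
    let ?B = "\<lambda>\<omega>. X b \<omega> * X k \<omega>"
    have v: "cov \<nu> (inc 2 e) ?B = cov \<nu> (\<lambda>\<omega>. fd 3 (S X (e - 1) \<omega>) * X e \<omega>) ?B + cov \<nu> (\<lambda>\<omega>. trem fd 2 2 (S X (e - 1) \<omega>) (X e \<omega>)) ?B"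
      using bB by (subst inc2_eq[OF eb(1)]) (rule cov_add_left)
    have "\<bar>cov \<nu> (\<lambda>\<omega>. trem fd 2 2 (S X (e - 1) \<omega>) (X e \<omega>) * X e \<omega> ^ 0 * X e \<omega> ^ 0) (\<lambda>\<omega>. X b \<omega> ^ 1 * X k \<omega> ^ 1 * X k \<omega> ^ 0)\<bar>
       \<le> K0 * Q / real L ^ (2 + 2) * \<phi> (b - e) (k - b)"
      using eb ib by (intro cov_trem) auto
    also have "\<dots> \<le> K0 * Q / real L ^ (2 + 2) * \<theta> q"
      using KQ_nonneg eb theta[of p q] T by (intro mult_left_mono) auto
    also have "\<dots> = K0 * Q * (\<theta> q / real L ^ 4)" by simp
    also have "\<dots> \<le> K0 * Q * gap_err q" using KQ_nonneg pq by (intro mult_left_mono gap_err_ge1)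
    finally have 1: "\<bar>cov \<nu> (\<lambda>\<omega>. trem fd 2 2 (S X (e - 1) \<omega>) (X e \<omega>)) ?B\<bar> \<le> K0 * Q * gap_err q" by simp
    have 2: "\<bar>cov \<nu> (\<lambda>\<omega>. fd 3 (S X (e - 1) \<omega>) * X e \<omega>) ?B - cov \<nu> (X e) ?B * Z\<bar> \<le> K1 * Q * gap_err q"
      "\<bar>cov \<nu> (X e) ?B\<bar> \<le> 3 * C * M\<^sup>2 * \<theta> q"
      using third_order_split_first[OF pq(1,3) True pq(2) T] by (simp_all add: e_def b_def)
    have "(K1 + K0) * (Q * gap_err q) \<le> K2 * (Q * gap_err q)" using Q_nonneg gap_err_nonneg K2_ge by (intro mult_right_mono) auto
    then have "K1 * Q * gap_err q + K0 * Q * gap_err q \<le> K2 * Q * gap_err q" by (simp add: algebra_simps)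
    then have "near_Z (cov \<nu> (inc 2 e) ?B) (3 * C * M\<^sup>2 * \<theta> q) (K2 * Q * gap_err q)"
      using 1 2 unfolding v by (intro near_ZI[of "cov \<nu> (X e) ?B"]) linarith+
    then show ?thesis using T by (simp add: split_gap_def e_def b_def)
  next
    case F: False
    then have p1: "1 \<le> p" "q \<le> R * p" by (cases p, auto)
    have bI: "bddrv \<nu> (inc 2 e)" by (simp add: bddrv_inc)
    \<comment> \<open>As \<open>X k\<close> is centered, \<open>X b\<close> can be moved into the
      left factor. The price is a product of two small expectations, an increment of
      \<open>f''\<close> and a correlation.\<close>
    have v1: "cov \<nu> (inc 2 e) (\<lambda>\<omega>. X b \<omega> * X k \<omega>) = cov \<nu> (\<lambda>\<omega>. inc 2 e \<omega> * X b \<omega>) (X k) - expectation (inc 2 e) * cp p"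
      using X_mean cp_eq[of p] pq(4) by (simp add: cov_def b_def mult.assoc)
    have "cov \<nu> (\<lambda>\<omega>. inc 2 e \<omega> * X b \<omega>) (X k) = cov \<nu> (\<lambda>\<omega>. fd 3 (S X (e - 1) \<omega>) * (X e \<omega> * X b \<omega>) + trem fd 2 2 (S X (e - 1) \<omega>) (X e \<omega>) * X b \<omega>) (X k)"
      by (subst inc2_eq[OF eb(1)]) (simp add: distrib_right mult.assoc)
    also have "\<dots> = cov \<nu> (\<lambda>\<omega>. fd 3 (S X (e - 1) \<omega>) * (X e \<omega> * X b \<omega>)) (X k) + cov \<nu> (\<lambda>\<omega>. trem fd 2 2 (S X (e - 1) \<omega>) (X e \<omega>) * X b \<omega>) (X k)"
      by (rule cov_add_left; intro bddrv_all; simp)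
    finally have v2: "cov \<nu> (\<lambda>\<omega>. inc 2 e \<omega> * X b \<omega>) (X k) = \<dots>" .
    have "\<bar>cov \<nu> (\<lambda>\<omega>. trem fd 2 2 (S X (e - 1) \<omega>) (X e \<omega>) * X b \<omega> ^ 1 * X b \<omega> ^ 0) (\<lambda>\<omega>. X k \<omega> ^ 1 * X k \<omega> ^ 0 * X k \<omega> ^ 0)\<bar>
       \<le> K0 * Q / real L ^ (2 + 2) * \<phi> (k - b) (k - k)"
      using eb ib by (intro cov_trem) auto
    also have "\<dots> \<le> K0 * Q / real L ^ (2 + 2) * \<theta> p"
      using KQ_nonneg eb theta[of 0 p] by (intro mult_left_mono) auto
    also have "\<dots> = K0 * Q * (\<theta> p / real L ^ 4)" by simp
    also have "\<dots> \<le> K0 * Q * gap_err p" using KQ_nonneg p1 by (intro mult_left_mono gap_err_ge1)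
    finally have 1: "\<bar>cov \<nu> (\<lambda>\<omega>. trem fd 2 2 (S X (e - 1) \<omega>) (X e \<omega>) * X b \<omega>) (X k)\<bar> \<le> K0 * Q * gap_err p" by simp
    have 2: "\<bar>cov \<nu> (\<lambda>\<omega>. fd 3 (S X (e - 1) \<omega>) * (X e \<omega> * X b \<omega>)) (X k) - cov \<nu> (\<lambda>\<omega>. X e \<omega> * X b \<omega>) (X k) * Z\<bar> \<le> K1 * Q * gap_err p"
      "\<bar>cov \<nu> (\<lambda>\<omega>. X e \<omega> * X b \<omega>) (X k)\<bar> \<le> 3 * C * M\<^sup>2 * \<theta> p"
      using third_order_split_last[OF pq(1,3) True p1] by (simp_all add: e_def b_def)
    let ?w = "(1 + Th) / real L ^ 4 + \<theta> (\<Lambda> + 1) / real L ^ 3"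
    have "\<bar>expectation (inc 2 e) * cp p\<bar> \<le> (K0 * Q * ?w) * (3 * C * M\<^sup>2 * \<theta> p)"
      unfolding abs_mult using eb ib by (intro mult_mono E_inc2 cp_bound) (use KQ_nonneg Th_nonneg theta_nonneg in auto)
    also have "\<dots> = (3 * C * M\<^sup>2 * (K0 * Q)) * (\<theta> p * ?w)" by (simp only: mult_ac)
    also have "\<dots> \<le> (3 * C * M\<^sup>2 * (K0 * Q)) * ((1 + Th) * gap_err p)"
      using KQ_nonneg C_ge1 p1 by (intro mult_left_mono gap_err_ge3) auto
    finally have 3: "\<bar>expectation (inc 2 e) * cp p\<bar> \<le> (3 * C * M\<^sup>2 * (K0 * Q)) * ((1 + Th) * gap_err p)" .
    have "K1 * Q * gap_err p + K0 * Q * gap_err p + (3 * C * M\<^sup>2 * (K0 * Q)) * ((1 + Th) * gap_err p) = K2 * Q * gap_err p"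
      by (simp add: K2_def algebra_simps)
    then have "near_Z (cov \<nu> (inc 2 e) (\<lambda>\<omega>. X b \<omega> * X k \<omega>)) (3 * C * M\<^sup>2 * \<theta> p) (K2 * Q * gap_err p)"
      using 1 2 3 unfolding v1 v2 by (intro near_ZI[of "cov \<nu> (\<lambda>\<omega>. X e \<omega> * X b \<omega>) (X k)"]) linarith+
    then show ?thesis using F by (simp add: split_gap_def e_def b_def)
  qed
qed

text \<open>The lag runs up to \<open>R * L\<close> because the block has length
  \<open>p \<le> L\<close>: beyond that lag \<open>\<theta>\<close> is available for the whole
  block, and the second-order covariance is bounded directly.\<close>

lemma second_order_expansion:
  assumes p: "p \<le> L" "p < k"
  shows "near_Z (cov \<nu> (\<lambda>\<omega>. fd 2 (S X (k - p - 1) \<omega>)) (\<lambda>\<omega>. X (k - p) \<omega> * X k \<omega>))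
     (\<Sum>q=1..R * L. 3 * C * M\<^sup>2 * \<theta> (split_gap p q))
     ((\<Sum>q=1..R * L. K2 * Q * gap_err (split_gap p q)) + K0 * Q * \<theta> (R * L + 1) / real L ^ 2)"
proof -
  let ?B = "\<lambda>\<omega>. X (k - p) \<omega> * X k \<omega>"
  have B: "bddrv \<nu> ?B" by (intro bddrv_all)
  have "cov \<nu> (\<lambda>\<omega>. fd 2 (S X (k - p - 1) \<omega>)) ?B =
     cov \<nu> (\<lambda>\<omega>. (\<Sum>q=Suc 0..R * L. inc 2 (k - p - q) \<omega>) + fd 2 (S X (k - p - 1 - R * L) \<omega>)) ?B"
    using telescope[of 0 "R * L" 2 "k - p"] by simp
  also have "\<dots> = (\<Sum>q=1..R * L. cov \<nu> (inc 2 (k - p - q)) ?B) + cov \<nu> (\<lambda>\<omega>. fd 2 (S X (k - p - 1 - R * L) \<omega>)) ?B"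
    using B by (simp add: cov_add_left cov_sum_left bddrv_inc bddrv_sum bddrv_fd)
  finally have v: "cov \<nu> (\<lambda>\<omega>. fd 2 (S X (k - p - 1) \<omega>)) ?B = \<dots>" .
  have "\<bar>cov \<nu> (\<lambda>\<omega>. fd 2 (S X (k - p - 1 - R * L) \<omega>)) ?B\<bar> \<le> K0 * Q * \<theta> (R * L + 1) / real L ^ 2"
    using past_decorrelation[of 2 "k - p" k k 1 1 0 "R * L" "R * L"] p index_bound by simp
  from near_Z_add[OF near_Z_sum[of "{1..R * L}"] near_Z_err[OF this], OF second_order_increment] show ?thesis
    unfolding v using p by simp
qed


text \<open>Unlike \<open>E_shift\<close>, this uses the cancellation in \<open>E_inc2\<close>: a
  shift by \<open>p\<close> steps will be multiplied by a correlation of order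
  \<open>\<theta> p\<close>, and the result has to be of order \<open>L^-4\<close> up to terminal
  terms.\<close>

lemma E_f2_shift:
  assumes "s + \<Lambda> + 1 \<le> c1 * L" "s \<le> k"
  shows "\<bar>expectation (\<lambda>\<omega>. fd 2 (S X (k - 1) \<omega>)) - expectation (\<lambda>\<omega>. fd 2 (S X (k - 1 - s) \<omega>))\<bar>
    \<le> real s * (K0 * Q * ((1 + Th) / real L ^ 4 + \<theta> (\<Lambda> + 1) / real L ^ 3))"
proof -
  have "expectation (\<lambda>\<omega>. fd 2 (S X (k - 1) \<omega>)) =
     expectation (\<lambda>\<omega>. (\<Sum>q<s. inc 2 (k - 1 - q) \<omega>) + fd 2 (S X (k - 1 - s) \<omega>))"
    by (intro Bochner_Integration.integral_cong refl telescope_back)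
  also have "\<dots> = (\<Sum>q<s. expectation (inc 2 (k - 1 - q))) + expectation (\<lambda>\<omega>. fd 2 (S X (k - 1 - s) \<omega>))"
    by (subst Bochner_Integration.integral_add)
      (auto intro!: bddrv_integrable bddrv_sum bddrv_inc bddrv_fd Bochner_Integration.integral_sum)
  also have "\<bar>(\<Sum>q<s. expectation (inc 2 (k - 1 - q)))\<bar> \<le> (\<Sum>q<s. K0 * Q * ((1 + Th) / real L ^ 4 + \<theta> (\<Lambda> + 1) / real L ^ 3))"
    using assms by (intro order_trans[OF sum_abs] sum_mono E_inc2) auto
  ultimately show ?thesis by simp
qed

lemma first_order_increment:
  assumes p: "1 \<le> p" "p \<le> L" "p < k"
  shows "near_Z (cov \<nu> (inc 1 (k - p)) (X k) - cp p * expectation (\<lambda>\<omega>. fd 2 (S X (k - 1) \<omega>)))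
     ((\<Sum>q=1..R * L. 3 * C * M\<^sup>2 * \<theta> (split_gap p q)) + 3 * C * M\<^sup>2 * \<theta> p)
     ((\<Sum>q=1..R * L. K2 * Q * gap_err (split_gap p q)) + K0 * Q * \<theta> (R * L + 1) / real L ^ 2 + K2 * Q * gap_err p)"
proof -
  define e where "e = k - p"
  have e: "1 \<le> e" "e \<le> k" "k - e = p" "e - 1 = k - 1 - p" using p by (auto simp: e_def)
  have ib: "p + \<Lambda> + 1 \<le> c1 * L" using index_bound p by linarith
  let ?E1 = "expectation (\<lambda>\<omega>. fd 2 (S X (e - 1) \<omega>))" and ?E0 = "expectation (\<lambda>\<omega>. fd 2 (S X (k - 1) \<omega>))"
  let ?f3 = "cov \<nu> (\<lambda>\<omega>. fd 3 (S X (e - 1) \<omega>) * (X e \<omega> * X e \<omega>)) (X k)"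
  let ?r = "cov \<nu> (\<lambda>\<omega>. trem fd 1 3 (S X (e - 1) \<omega>) (X e \<omega>)) (X k)"
  have "cov \<nu> (inc 1 e) (X k) = cov \<nu> (\<lambda>\<omega>. fd 2 (S X (e - 1) \<omega>) * X e \<omega> + (1/2) * (fd 3 (S X (e - 1) \<omega>) * (X e \<omega> * X e \<omega>))) (X k) + ?r"
    by (subst inc1_eq[OF e(1)], rule cov_add_left; intro bddrv_all; simp)
  also have "cov \<nu> (\<lambda>\<omega>. fd 2 (S X (e - 1) \<omega>) * X e \<omega> + (1/2) * (fd 3 (S X (e - 1) \<omega>) * (X e \<omega> * X e \<omega>))) (X k)
     = cov \<nu> (\<lambda>\<omega>. fd 2 (S X (e - 1) \<omega>) * X e \<omega>) (X k) + (1/2) * ?f3"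
    by (subst cov_add_left; (subst cov_cmult_left)?; (intro bddrv_all)?; simp)
  \<comment> \<open>The main term splits off: \<open>?E1\<close> times the correlation at lag
    \<open>p\<close>. It is then moved from \<open>e - 1\<close> to \<open>k - 1\<close>, so that
    all lags share the factor \<open>?E0\<close>.\<close>
  also have "cov \<nu> (\<lambda>\<omega>. fd 2 (S X (e - 1) \<omega>) * X e \<omega>) (X k) = cov \<nu> (\<lambda>\<omega>. fd 2 (S X (e - 1) \<omega>)) (\<lambda>\<omega>. X e \<omega> * X k \<omega>) + ?E1 * cp p"
    using X_mean cp_eq[of p] p by (simp add: cov_def e_def mult.assoc)
  finally have v: "cov \<nu> (inc 1 e) (X k) - cp p * ?E0 =
     cov \<nu> (\<lambda>\<omega>. fd 2 (S X (e - 1) \<omega>)) (\<lambda>\<omega>. X e \<omega> * X k \<omega>) + ((1/2) * ?f3 + (?r - cp p * (?E0 - ?E1)))"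
    by (simp add: algebra_simps)
  let ?w = "(1 + Th) / real L ^ 4 + \<theta> (\<Lambda> + 1) / real L ^ 3"
  have "\<bar>cov \<nu> (\<lambda>\<omega>. trem fd 1 3 (S X (e - 1) \<omega>) (X e \<omega>) * X e \<omega> ^ 0 * X e \<omega> ^ 0) (\<lambda>\<omega>. X k \<omega> ^ 1 * X k \<omega> ^ 0 * X k \<omega> ^ 0)\<bar>
       \<le> K0 * Q / real L ^ (1 + 3) * \<phi> (k - e) (k - k)"
    using e ib by (intro cov_trem) auto
  also have "\<dots> \<le> K0 * Q / real L ^ (1 + 3) * \<theta> p"
    using KQ_nonneg e theta[of 0 p] by (intro mult_left_mono) auto
  also have "\<dots> = K0 * Q * (\<theta> p / real L ^ 4)" by simp
  also have "\<dots> \<le> K0 * Q * gap_err p" using KQ_nonneg p by (intro mult_left_mono gap_err_ge1)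
  finally have 1: "\<bar>?r\<bar> \<le> K0 * Q * gap_err p" by simp
  have "\<bar>cp p * (?E0 - ?E1)\<bar> \<le> (3 * C * M\<^sup>2 * \<theta> p) * (real p * (K0 * Q * ?w))"
    unfolding abs_mult e(4) using e ib p C_ge1 theta_nonneg by (intro mult_mono E_f2_shift cp_bound) auto
  also have "\<dots> = (3 * C * M\<^sup>2 * (K0 * Q)) * (real p * \<theta> p * ?w)" by (simp only: mult_ac)
  also have "\<dots> \<le> (3 * C * M\<^sup>2 * (K0 * Q)) * ((1 + Th) * gap_err p)"
    using KQ_nonneg C_ge1 p by (intro mult_left_mono gap_err_ge2) auto
  finally have 3: "\<bar>cp p * (?E0 - ?E1)\<bar> \<le> (3 * C * M\<^sup>2 * (K0 * Q)) * ((1 + Th) * gap_err p)" .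
  \<comment> \<open>The square of \<open>X e\<close> is the configuration with first gap
    \<open>0\<close>, cut at \<open>p\<close>.\<close>
  have 2: "\<bar>?f3 - cov \<nu> (\<lambda>\<omega>. X e \<omega> * X e \<omega>) (X k) * Z\<bar> \<le> K1 * Q * gap_err p"
      "\<bar>cov \<nu> (\<lambda>\<omega>. X e \<omega> * X e \<omega>) (X k)\<bar> \<le> 3 * C * M\<^sup>2 * \<theta> p"
    using third_order_split_last[of p 0] p by (simp_all add: e_def)
  have a2: "near_Z ((1/2) * ?f3) ((1/2) * (3 * C * M\<^sup>2 * \<theta> p)) ((1/2) * (K1 * Q * gap_err p))"
    by (intro near_Z_scale near_ZI[of "cov \<nu> (\<lambda>\<omega>. X e \<omega> * X e \<omega>) (X k)"] 2) auto
  have a3: "near_Z (?r - cp p * (?E0 - ?E1)) 0 (K0 * Q * gap_err p + (3 * C * M\<^sup>2 * (K0 * Q)) * ((1 + Th) * gap_err p))"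
    using 1 3 by (intro near_Z_err) linarith
  have K: "K1 * Q * gap_err p + K0 * Q * gap_err p + (3 * C * M\<^sup>2 * (K0 * Q)) * ((1 + Th) * gap_err p) = K2 * Q * gap_err p"
      by (simp add: K2_def algebra_simps)
  have nn: "0 \<le> K1 * Q * gap_err p" "0 \<le> 3 * C * M\<^sup>2 * \<theta> p" using K1_nonneg Q_nonneg gap_err_nonneg C_ge1 theta_nonneg by auto
  have "near_Z (cov \<nu> (\<lambda>\<omega>. fd 2 (S X (e - 1) \<omega>)) (\<lambda>\<omega>. X e \<omega> * X k \<omega>) + ((1/2) * ?f3 + (?r - cp p * (?E0 - ?E1))))
    ((\<Sum>q=1..R * L. 3 * C * M\<^sup>2 * \<theta> (split_gap p q)) + ((1/2) * (3 * C * M\<^sup>2 * \<theta> p) + 0))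
    (((\<Sum>q=1..R * L. K2 * Q * gap_err (split_gap p q)) + K0 * Q * \<theta> (R * L + 1) / real L ^ 2) +
      ((1/2) * (K1 * Q * gap_err p) + (K0 * Q * gap_err p + (3 * C * M\<^sup>2 * (K0 * Q)) * ((1 + Th) * gap_err p))))"
    using second_order_expansion[OF p(2,3)] by (intro near_Z_add a2 a3) (simp add: e_def)
  then show ?thesis unfolding v[unfolded e_def] e_def
    by (rule near_Z_mono) (use K nn in linarith)+
qed

section \<open>Counting of gaps and assembly of the step\<close>

definition Gsum :: "(nat \<Rightarrow> real) \<Rightarrow> real" where
  "Gsum f = (\<Sum>p=0..L. \<Sum>q=1..R * L. f (split_gap p q))"

text \<open>Pairs are counted by their split gap \<open>g\<close>. If \<open>g = q\<close> there are
  at most \<open>q + 1 \<le> 2 * q\<close> values of \<open>p\<close>; if \<open>g = p\<close> there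
  are at most \<open>R * p\<close> values of \<open>q\<close>. So the double sum costs one factor
  \<open>g\<close>.\<close>

lemma Gsum_bound:
  assumes f: "\<And>g. 0 \<le> f g"
  shows "Gsum f \<le> (real R + 2) * (\<Sum>g=1..R * L. real g * f g)"
proof -
  have "f (split_gap p q) \<le> (if p \<le> q then f q else 0) + (if q < R * p then f p else 0)" for p q
  proof -
    have "R * p \<le> q \<Longrightarrow> p \<le> q" using R1 by (auto intro: order_trans[of p "R * p" q])
    then show ?thesis using f[of p] f[of q] unfolding split_gap_def by (cases "R * p \<le> q") auto
  qed
  then have "Gsum f \<le> (\<Sum>p=0..L. \<Sum>q=1..R * L. (if p \<le> q then f q else 0) + (if q < R * p then f p else 0))"
    unfolding Gsum_def by (intro sum_mono)
  also have "\<dots> = (\<Sum>q=1..R * L. \<Sum>p=0..L. if p \<le> q then f q else 0) + (\<Sum>p=0..L. \<Sum>q=1..R * L. if q < R * p then f p else 0)"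
    by (simp only: sum.distrib) (subst sum.swap, rule refl)
  also have "(\<Sum>q=1..R * L. \<Sum>p=0..L. if p \<le> q then f q else 0) \<le> (\<Sum>q=1..R * L. 2 * (real q * f q))"
  proof (rule sum_mono)
    fix q assume q: "q \<in> {1..R * L}"
    have "(\<Sum>p=0..L. if p \<le> q then f q else 0) = (\<Sum>p\<in>{0..L} \<inter> {p. p \<le> q}. f q)"
      by (subst sum.inter_restrict) auto
    also have "\<dots> \<le> (\<Sum>p\<in>{0..q}. f q)" using f by (intro sum_mono2) auto
    also have "\<dots> = (real q + 1) * f q" by simp
    also have "\<dots> \<le> (2 * real q) * f q" using q f by (intro mult_right_mono) auto
    finally show "(\<Sum>p=0..L. if p \<le> q then f q else 0) \<le> 2 * (real q * f q)" by simp
  qed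
  also have "(\<Sum>p=0..L. \<Sum>q=1..R * L. if q < R * p then f p else 0) \<le> (\<Sum>p=0..L. real R * (real p * f p))"
  proof (rule sum_mono)
    fix p assume p: "p \<in> {0..L}"
    have "(\<Sum>q=1..R * L. if q < R * p then f p else 0) = (\<Sum>q\<in>{1..R * L} \<inter> {q. q < R * p}. f p)"
      by (subst sum.inter_restrict) auto
    also have "\<dots> \<le> (\<Sum>q\<in>{0..<R * p}. f p)" using f by (intro sum_mono2) auto
    finally show "(\<Sum>q=1..R * L. if q < R * p then f p else 0) \<le> real R * (real p * f p)" by simp
  qed
  also have "(\<Sum>p=0..L. real R * (real p * f p)) = (\<Sum>p=1..L. real R * (real p * f p))"
    by (rule sum.mono_neutral_right) auto
  also have "\<dots> \<le> (\<Sum>p=1..R * L. real R * (real p * f p))"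
  proof -
    have "L \<le> R * L" using R1 by simp
    then show ?thesis using f by (intro sum_mono2) auto
  qed
  finally have "Gsum f \<le> 2 * (\<Sum>g=1..R * L. real g * f g) + real R * (\<Sum>g=1..R * L. real g * f g)"
    by (simp only: sum_distrib_left[symmetric]) 
  then show ?thesis by (simp add: distrib_right)
qed

text \<open>A truncated second moment of \<open>\<theta>\<close>, in general unbounded in
  \<open>L\<close>. It enters with the factor \<open>L^-4\<close>, and the summation over scales in
  \<open>sum_Wf\<close> reduces it to the first moment.\<close>

definition W :: real where "W = (\<Sum>g=1..\<Lambda>. (real g)\<^sup>2 * \<theta> g)"

lemma RL_Lam: "R * L \<le> \<Lambda>"
  unfolding \<Lambda>_def by (simp add: algebra_simps)

lemma sum_gap_err: "(\<Sum>g=1..R * L. real g * gap_err g) \<le> 2 * W / real L ^ 4 + (real R)\<^sup>2 * \<theta> (\<Lambda> + 1) / real L"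
proof -
  let ?N = "R * L"
  have 1: "(\<Sum>g=1..?N. real g * (real g * \<theta> g)) \<le> W"
    unfolding W_def using theta_nonneg RL_Lam
    by (intro order_trans[OF _ sum_mono2[of "{1..\<Lambda>}" "{1..?N}"]]) (auto simp: power2_eq_square mult.assoc)
  \<comment> \<open>After exchanging the sums, each \<open>q\<close> is met by at most
    \<open>q\<close> values of \<open>g\<close>, each below \<open>q\<close>. The tails of
    \<open>\<theta>\<close> thus cost the same truncated second moment.\<close>
  have "(\<Sum>g=1..?N. real g * (\<Sum>q=Suc g..\<Lambda>. \<theta> q)) = (\<Sum>g=1..?N. \<Sum>q=1..\<Lambda>. if g < q then real g * \<theta> q else 0)"
  proof (rule sum.cong[OF refl])
    fix g
    have "{Suc g..\<Lambda>} = {1..\<Lambda>} \<inter> {q. g < q}" by auto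
    then show "real g * (\<Sum>q=Suc g..\<Lambda>. \<theta> q) = (\<Sum>q=1..\<Lambda>. if g < q then real g * \<theta> q else 0)"
      by (simp add: sum.inter_restrict sum_distrib_left if_distrib cong: if_cong)
  qed
  also have "\<dots> = (\<Sum>q=1..\<Lambda>. \<Sum>g=1..?N. if g < q then real g * \<theta> q else 0)" by (rule sum.swap)
  also have "\<dots> \<le> (\<Sum>q=1..\<Lambda>. (real q)\<^sup>2 * \<theta> q)"
  proof (rule sum_mono)
    fix q assume "q \<in> {1..\<Lambda>}"
    have "(\<Sum>g=1..?N. if g < q then real g * \<theta> q else 0) = (\<Sum>g\<in>{1..?N} \<inter> {g. g < q}. real g * \<theta> q)"
      by (subst sum.inter_restrict) auto
    also have "\<dots> \<le> (\<Sum>g\<in>{1..?N} \<inter> {g. g < q}. real q * \<theta> q)"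
      using theta_nonneg by (intro sum_mono mult_right_mono) auto
    also have "\<dots> \<le> (\<Sum>g\<in>{0..<q}. real q * \<theta> q)" using theta_nonneg by (intro sum_mono2) auto
    finally show "(\<Sum>g=1..?N. if g < q then real g * \<theta> q else 0) \<le> (real q)\<^sup>2 * \<theta> q" by (simp add: power2_eq_square)
  qed
  finally have 2: "(\<Sum>g=1..?N. real g * (\<Sum>q=Suc g..\<Lambda>. \<theta> q)) \<le> W" unfolding W_def .
  have "(\<Sum>g=1..?N. real g) \<le> (\<Sum>g=1..?N. real ?N)" by (intro sum_mono) (auto simp del: of_nat_mult)
  then have 3: "(\<Sum>g=1..?N. real g) \<le> (real R)\<^sup>2 * (real L)\<^sup>2" by (simp add: power2_eq_square mult_ac)
  have "(\<Sum>g=1..?N. real g * gap_err g) = ((\<Sum>g=1..?N. real g * (real g * \<theta> g)) + (\<Sum>g=1..?N. real g * (\<Sum>q=Suc g..\<Lambda>. \<theta> q))) / real L ^ 4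
     + (\<Sum>g=1..?N. real g) * (\<theta> (\<Lambda> + 1) / real L ^ 3)"
    unfolding gap_err_def distrib_left times_divide_eq_right
    by (simp only: sum.distrib sum_divide_distrib[symmetric] sum_distrib_right times_divide_eq_right)
  also have "\<dots> \<le> (W + W) / real L ^ 4 + ((real R)\<^sup>2 * (real L)\<^sup>2) * (\<theta> (\<Lambda> + 1) / real L ^ 3)"
    using 1 2 3 theta_nonneg by (intro add_mono divide_right_mono mult_right_mono) auto
  also have "\<dots> = 2 * W / real L ^ 4 + (real R)\<^sup>2 * \<theta> (\<Lambda> + 1) / real L"
    using real_L1 by (simp add: power2_eq_square power3_eq_cube)
  finally show ?thesis .
qed

lemma W_nonneg: "0 \<le> W" unfolding W_def using theta_nonneg by (intro sum_nonneg) auto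

end

lemma step_expansion_arith:
  fixes s1 s0 r w t A B l tot :: real
  assumes "s1 + s0 + r \<le> A + B" "A + (B + 2 * t) + (w + l) \<le> tot" "0 \<le> s0" "0 \<le> r" "0 \<le> w" "0 \<le> t"
  shows "s1 + t + ((1/2) * (s0 + r) + ((1/6) * w + l)) \<le> tot"
  using assms by (simp add: field_simps)

context dep_test begin

text \<open>The series for the limit variance, truncated at the window \<open>L\<close> and at the
  time origin.\<close>

definition s2 :: real where "s2 = cp 0 + 2 * (\<Sum>p=1..L. if p < k then cp p else 0)"
definition KZ :: real where "KZ = 3 * C * M\<^sup>2 * ((R + 3) * Th) + M ^ 3"
definition K3 :: real where "K3 = K2 * ((R + 3) * (2 + (real R)\<^sup>2)) + 2 * K0 + K0 * (Th + 1)"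

lemma E_f0_step:
  "expectation (\<lambda>\<omega>. fd 0 (S X k \<omega>)) - expectation (\<lambda>\<omega>. fd 0 (S X (k - 1) \<omega>)) =
     expectation (\<lambda>\<omega>. fd 1 (S X (k - 1) \<omega>) * X k \<omega>) + (1/2) * expectation (\<lambda>\<omega>. fd 2 (S X (k - 1) \<omega>) * (X k \<omega> * X k \<omega>))
     + (1/6) * expectation (\<lambda>\<omega>. fd 3 (S X (k - 1) \<omega>) * X k \<omega> ^ 3) + expectation (\<lambda>\<omega>. trem fd 0 4 (S X (k - 1) \<omega>) (X k \<omega>))"
proof -
  have "expectation (\<lambda>\<omega>. fd 0 (S X k \<omega>)) - expectation (\<lambda>\<omega>. fd 0 (S X (k - 1) \<omega>)) = expectation (inc 0 k)"
    unfolding inc_def[abs_def]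
    by (rule Bochner_Integration.integral_diff[symmetric]; intro bddrv_integrable bddrv_fd; simp)
  also have "\<dots> = expectation (\<lambda>\<omega>. fd 1 (S X (k - 1) \<omega>) * X k \<omega>) + expectation (\<lambda>\<omega>. (1/2) * (fd 2 (S X (k - 1) \<omega>) * (X k \<omega> * X k \<omega>)))
     + expectation (\<lambda>\<omega>. (1/6) * (fd 3 (S X (k - 1) \<omega>) * X k \<omega> ^ 3)) + expectation (\<lambda>\<omega>. trem fd 0 4 (S X (k - 1) \<omega>) (X k \<omega>))"
    unfolding inc0_eq[OF k1]
    by (subst Bochner_Integration.integral_add; (intro bddrv_integrable bddrv_all; simp)?)+ simp
  finally show ?thesis by simp
qed

text \<open>Centering turns \<open>E[f' X]\<close> into a covariance, which is developed up to lag
  \<open>L\<close>. Lags \<open>p \<ge> k\<close> have a vanishing increment, so their correlations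
  must be absent from the main term too.\<close>

lemma first_order_expansion:
  "near_Z (expectation (\<lambda>\<omega>. fd 1 (S X (k - 1) \<omega>) * X k \<omega>) - (\<Sum>p=1..L. if p < k then cp p else 0) * expectation (\<lambda>\<omega>. fd 2 (S X (k - 1) \<omega>)))
     (\<Sum>p=1..L. (\<Sum>q=1..R * L. 3 * C * M\<^sup>2 * \<theta> (split_gap p q)) + 3 * C * M\<^sup>2 * \<theta> p)
     ((\<Sum>p=1..L. (\<Sum>q=1..R * L. K2 * Q * gap_err (split_gap p q)) + K0 * Q * \<theta> (R * L + 1) / real L ^ 2 + K2 * Q * gap_err p)
       + K0 * Q * \<theta> (L + 1) / real L)"
proof -
  let ?E = "expectation (\<lambda>\<omega>. fd 2 (S X (k - 1) \<omega>))"
  let ?c = "\<lambda>p. if p < k then cp p else 0"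
  have "expectation (\<lambda>\<omega>. fd 1 (S X (k - 1) \<omega>) * X k \<omega>) = cov \<nu> (\<lambda>\<omega>. fd 1 (S X (k - 1) \<omega>)) (X k)"
    using X_mean by (simp add: cov_def)
  also have "\<dots> = cov \<nu> (\<lambda>\<omega>. (\<Sum>q=Suc 0..L. inc 1 (k - q) \<omega>) + fd 1 (S X (k - 1 - L) \<omega>)) (X k)"
    using telescope[of 0 "L" 1 "k"] by simp
  also have "\<dots> = (\<Sum>q=1..L. cov \<nu> (inc 1 (k - q)) (X k)) + cov \<nu> (\<lambda>\<omega>. fd 1 (S X (k - 1 - L) \<omega>)) (X k)"
    by (simp add: cov_add_left cov_sum_left bddrv_inc bddrv_sum bddrv_fd bddrv_X)
  finally have v: "expectation (\<lambda>\<omega>. fd 1 (S X (k - 1) \<omega>) * X k \<omega>) - (\<Sum>p=1..L. ?c p) * ?E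
    = (\<Sum>p=1..L. cov \<nu> (inc 1 (k - p)) (X k) - ?c p * ?E) + cov \<nu> (\<lambda>\<omega>. fd 1 (S X (k - 1 - L) \<omega>)) (X k)"
    by (simp add: sum_subtractf sum_distrib_right)
  have "\<bar>cov \<nu> (\<lambda>\<omega>. fd 1 (S X (k - 1 - L) \<omega>)) (X k)\<bar> \<le> K0 * Q * \<theta> (L + 1) / real L"
    using past_decorrelation[of 1 k k k 1 0 0 L L] index_bound by simp
  note t = near_Z_err[OF this]
  have st: "near_Z (cov \<nu> (inc 1 (k - p)) (X k) - ?c p * ?E) ((\<Sum>q=1..R * L. 3 * C * M\<^sup>2 * \<theta> (split_gap p q)) + 3 * C * M\<^sup>2 * \<theta> p)
     ((\<Sum>q=1..R * L. K2 * Q * gap_err (split_gap p q)) + K0 * Q * \<theta> (R * L + 1) / real L ^ 2 + K2 * Q * gap_err p)"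
    if "p \<in> {1..L}" for p
  proof (cases "p < k")
    case True then show ?thesis using first_order_increment[of p] that by simp
  next
    case False
    then show ?thesis using C_ge1 theta_nonneg K2_ge(3) Q_nonneg gap_err_nonneg K0_nonneg
      by (intro near_ZI[of 0]) (auto simp: cov_const_left intro!: add_nonneg_nonneg sum_nonneg)
  qed
  show ?thesis unfolding v using near_Z_add[OF near_Z_sum[where I="{1..L}", OF st] t] by simp
qed

lemma third_order_product: "near_Z (expectation (\<lambda>\<omega>. fd 3 (S X (k - 1) \<omega>) * X k \<omega> ^ 3)) (M ^ 3) (K0 * Q * (Th / real L ^ 4 + \<theta> (\<Lambda> + 1) / real L))"
\<comment> \<open>The coefficient of \<open>Z\<close> is the third moment of one variable; what
  remains is a covariance of \<open>f'''\<close> with its cube.\<close>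
proof (rule near_ZI[of "expectation (\<lambda>\<omega>. X k \<omega> ^ 3)"])
  show "\<bar>expectation (\<lambda>\<omega>. X k \<omega> ^ 3)\<bar> \<le> M ^ 3"
  proof (rule abs_expectation_le)
    show "AE \<omega> in \<nu>. \<bar>X k \<omega> ^ 3\<bar> \<le> M ^ 3"
      using X_bound by eventually_elim (auto simp: power_abs intro!: power_mono)
  qed (intro bddrv_all)
  have "\<bar>cov \<nu> (\<lambda>\<omega>. fd 3 (S X (k - 1) \<omega>)) (\<lambda>\<omega>. X k \<omega> ^ 3)\<bar> \<le> K0 * Q * ((\<Sum>q=Suc 0..\<Lambda>. \<theta> q) / real L ^ 4 + \<theta> (\<Lambda> + 1) / real L ^ 3)"
    using past_decorrelation[of 3 k k k 3 0 0 0 \<Lambda>] index_bound by simp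
  also have "\<dots> \<le> K0 * Q * (Th / real L ^ 4 + \<theta> (\<Lambda> + 1) / real L)"
    using KQ_nonneg sum_theta_le theta_nonneg inv_pow_L_mono[of 1 3] mult_left_mono[of _ _ "\<theta> (\<Lambda> + 1)"]
    by (intro mult_left_mono add_mono divide_right_mono) fastforce+
  finally show "\<bar>expectation (\<lambda>\<omega>. fd 3 (S X (k - 1) \<omega>) * X k \<omega> ^ 3) - expectation (\<lambda>\<omega>. X k \<omega> ^ 3) * Z\<bar>
    \<le> K0 * Q * (Th / real L ^ 4 + \<theta> (\<Lambda> + 1) / real L)"
    by (simp add: cov_def Z_def mult.commute)
qed

text \<open>The three terminal terms stem from developing \<open>f'\<close> up to lag
  \<open>L\<close>, \<open>f''\<close> up to \<open>R * L\<close> and \<open>f'''\<close> up to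
  \<open>\<Lambda>\<close>. They have orders \<open>1 / L\<close>, \<open>L^-2\<close> and
  \<open>L^-3\<close> and occur once, of order \<open>L\<close> times and of order
  \<open>L^2\<close> times, so each amounts to a value of \<open>\<theta>\<close> divided by
  \<open>L\<close>.\<close>

theorem step_expansion:
  "near_Z (expectation (\<lambda>\<omega>. fd 0 (S X k \<omega>)) - expectation (\<lambda>\<omega>. fd 0 (S X (k - 1) \<omega>))
       - s2 / 2 * expectation (\<lambda>\<omega>. fd 2 (S X (k - 1) \<omega>))) KZ
     (K3 * Q * ((1 + W) / real L ^ 4 + (\<theta> (L + 1) + \<theta> (R * L + 1) + \<theta> (\<Lambda> + 1)) / real L))"
proof -
  let ?E = "expectation (\<lambda>\<omega>. fd 2 (S X (k - 1) \<omega>))"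
  let ?cXX = "cov \<nu> (\<lambda>\<omega>. fd 2 (S X (k - 1) \<omega>)) (\<lambda>\<omega>. X k \<omega> * X k \<omega>)"
  have x2: "expectation (\<lambda>\<omega>. fd 2 (S X (k - 1) \<omega>) * (X k \<omega> * X k \<omega>)) = ?cXX + cp 0 * ?E"
    using cp_eq[of 0] by (simp add: cov_def)
  have v: "expectation (\<lambda>\<omega>. fd 0 (S X k \<omega>)) - expectation (\<lambda>\<omega>. fd 0 (S X (k - 1) \<omega>)) - s2 / 2 * ?E
    = (expectation (\<lambda>\<omega>. fd 1 (S X (k - 1) \<omega>) * X k \<omega>) - (\<Sum>p=1..L. if p < k then cp p else 0) * ?E)
     + ((1/2) * ?cXX + ((1/6) * expectation (\<lambda>\<omega>. fd 3 (S X (k - 1) \<omega>) * X k \<omega> ^ 3) + expectation (\<lambda>\<omega>. trem fd 0 4 (S X (k - 1) \<omega>) (X k \<omega>))))"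
    unfolding E_f0_step x2 s2_def by (simp add: algebra_simps add_divide_distrib)
  have t4: "\<bar>expectation (\<lambda>\<omega>. trem fd 0 4 (S X (k - 1) \<omega>) (X k \<omega>))\<bar> \<le> K0 * Q / real L ^ 4"
    using E_trem[of 0 4 k] k1 by simp
  have t2: "near_Z ?cXX (\<Sum>q=1..R * L. 3 * C * M\<^sup>2 * \<theta> (split_gap 0 q))
     ((\<Sum>q=1..R * L. K2 * Q * gap_err (split_gap 0 q)) + K0 * Q * \<theta> (R * L + 1) / real L ^ 2)"
    using second_order_expansion[of 0] k1 by simp
  have a0: "0 \<le> (\<Sum>q=1..R * L. 3 * C * M\<^sup>2 * \<theta> (split_gap 0 q))" "0 \<le> M ^ 3"
    "0 \<le> (\<Sum>q=1..R * L. K2 * Q * gap_err (split_gap 0 q))" "0 \<le> K0 * Q * \<theta> (R * L + 1) / real L ^ 2" "0 \<le> K0 * Q * (Th / real L ^ 4 + \<theta> (\<Lambda> + 1) / real L)"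
    using C_ge1 M_ge1 theta_nonneg K2_ge(3) Q_nonneg gap_err_nonneg K0_nonneg Th_nonneg by (auto intro!: sum_nonneg mult_nonneg_nonneg add_nonneg_nonneg divide_nonneg_nonneg)
  let ?Sg = "\<lambda>f. \<Sum>p=1..L. \<Sum>q=1..R * L. f (split_gap p q)"
  \<comment> \<open>The covariance with the square of \<open>X k\<close> supplies the row
    \<open>p = 0\<close> of the double sum.\<close>
  have G0: "(\<Sum>q=1..R * L. f (split_gap 0 q)) + ?Sg f = Gsum f" for f
    unfolding Gsum_def by (simp add: sum.atLeast_Suc_atMost)
  have sl: "(\<Sum>p=1..L. f p) \<le> (\<Sum>g=1..R * L. real g * f g)" if "\<And>g. 0 \<le> f g" for f :: "nat \<Rightarrow> real"
  proof -
    have "(\<Sum>p=1..L. f p) \<le> (\<Sum>p=1..L. real p * f p)"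
    proof (rule sum_mono)
      fix p assume "p \<in> {1..L}"
      then show "f p \<le> real p * f p" using that[of p] mult_right_mono[of 1 "real p" "f p"] by simp
    qed
    also have "\<dots> \<le> (\<Sum>g=1..R * L. real g * f g)"
      using R1 that by (intro sum_mono2) (auto intro: order_trans[of _ L])
    finally show ?thesis .
  qed
  have both: "Gsum f + (\<Sum>p=1..L. f p) \<le> (real R + 3) * (\<Sum>g=1..R * L. real g * f g)" if "\<And>g. 0 \<le> f g" for f
    using Gsum_bound[of f] sl[of f] that by (simp add: algebra_simps)
  show ?thesis unfolding v
  proof (rule near_Z_mono[OF near_Z_add[OF first_order_expansion near_Z_add[OF near_Z_scale[OF t2] near_Z_add[OF near_Z_scale[OF third_order_product] near_Z_err[OF t4]]]]])
    have "(\<Sum>p=1..L. (\<Sum>q=1..R * L. 3 * C * M\<^sup>2 * \<theta> (split_gap p q)) + 3 * C * M\<^sup>2 * \<theta> p) + (\<Sum>q=1..R * L. 3 * C * M\<^sup>2 * \<theta> (split_gap 0 q))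
      = 3 * C * M\<^sup>2 * (Gsum \<theta> + (\<Sum>p=1..L. \<theta> p))"
      by (simp add: G0[symmetric] sum.distrib sum_distrib_left[symmetric] distrib_left)
    also have "\<dots> \<le> 3 * C * M\<^sup>2 * ((R + 3) * Th)"
    proof (intro mult_left_mono)
      have "Gsum \<theta> + (\<Sum>p=1..L. \<theta> p) \<le> (real R + 3) * (\<Sum>g=1..R * L. real g * \<theta> g)"
        by (rule both[OF theta_nonneg])
      also have "\<dots> \<le> (real R + 3) * Th" by (rule mult_left_mono[OF Th]) simp
      finally show "Gsum \<theta> + (\<Sum>p=1..L. \<theta> p) \<le> real (R + 3) * Th" by simp
    qed (use C_ge1 in auto)
    finally show "(\<Sum>p=1..L. (\<Sum>q=1..R * L. 3 * C * M\<^sup>2 * \<theta> (split_gap p q)) + 3 * C * M\<^sup>2 * \<theta> p)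
       + ((1/2) * (\<Sum>q=1..R * L. 3 * C * M\<^sup>2 * \<theta> (split_gap 0 q)) + ((1/6) * M ^ 3 + 0)) \<le> KZ"
      unfolding KZ_def using a0 by linarith
    let ?th = "\<theta> (L + 1) + \<theta> (R * L + 1) + \<theta> (\<Lambda> + 1)"
    let ?err = "(1 + W) / real L ^ 4 + ?th / real L"
    have "(\<Sum>p=1..L. (\<Sum>q=1..R * L. K2 * Q * gap_err (split_gap p q)) + K0 * Q * \<theta> (R * L + 1) / real L ^ 2 + K2 * Q * gap_err p)
       + (\<Sum>q=1..R * L. K2 * Q * gap_err (split_gap 0 q)) + K0 * Q * \<theta> (R * L + 1) / real L ^ 2
      = K2 * Q * (Gsum gap_err + (\<Sum>p=1..L. gap_err p)) + (real L + 1) * (K0 * Q * \<theta> (R * L + 1) / real L ^ 2)"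
      by (simp add: G0[symmetric] sum.distrib sum_distrib_left[symmetric] distrib_left distrib_right add_divide_distrib)
    also have "\<dots> \<le> K2 * Q * ((real R + 3) * (2 * W / real L ^ 4 + (real R)\<^sup>2 * \<theta> (\<Lambda> + 1) / real L)) + (2 * real L) * (K0 * Q * \<theta> (R * L + 1) / real L ^ 2)"
    proof (intro add_mono mult_left_mono mult_right_mono)
      show "Gsum gap_err + (\<Sum>p=1..L. gap_err p) \<le> (real R + 3) * (2 * W / real L ^ 4 + (real R)\<^sup>2 * \<theta> (\<Lambda> + 1) / real L)"
        by (rule order_trans[OF both[OF gap_err_nonneg] mult_left_mono[OF sum_gap_err]]) simp
    qed (use real_L1 K2_ge(3) Q_nonneg a0 in auto)
    also have "(2 * real L) * (K0 * Q * \<theta> (R * L + 1) / real L ^ 2) = 2 * K0 * Q * (\<theta> (R * L + 1) / real L)"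
      using real_L1 by (simp add: power2_eq_square)
    also have "K2 * Q * ((real R + 3) * (2 * W / real L ^ 4 + (real R)\<^sup>2 * \<theta> (\<Lambda> + 1) / real L))
       \<le> K2 * Q * ((real R + 3) * ((2 + (real R)\<^sup>2) * (W / real L ^ 4 + \<theta> (\<Lambda> + 1) / real L)))"
    proof (intro mult_left_mono)
      have "0 \<le> (real R)\<^sup>2 * (W / real L ^ 4)" "0 \<le> \<theta> (\<Lambda> + 1) / real L" using W_nonneg theta_nonneg by auto
      then have "2 * (W / real L ^ 4) + (real R)\<^sup>2 * (\<theta> (\<Lambda> + 1) / real L) \<le> (2 + (real R)\<^sup>2) * (W / real L ^ 4 + \<theta> (\<Lambda> + 1) / real L)"
        unfolding distrib_left distrib_right by linarith
      then show "2 * W / real L ^ 4 + (real R)\<^sup>2 * \<theta> (\<Lambda> + 1) / real L \<le> (2 + (real R)\<^sup>2) * (W / real L ^ 4 + \<theta> (\<Lambda> + 1) / real L)"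
        by simp
    qed (use K2_ge(3) Q_nonneg in auto)
    finally have A: "(\<Sum>p=1..L. (\<Sum>q=1..R * L. K2 * Q * gap_err (split_gap p q)) + K0 * Q * \<theta> (R * L + 1) / real L ^ 2 + K2 * Q * gap_err p)
       + (\<Sum>q=1..R * L. K2 * Q * gap_err (split_gap 0 q)) + K0 * Q * \<theta> (R * L + 1) / real L ^ 2
       \<le> K2 * Q * ((real R + 3) * ((2 + (real R)\<^sup>2) * (W / real L ^ 4 + \<theta> (\<Lambda> + 1) / real L))) + 2 * K0 * Q * (\<theta> (R * L + 1) / real L)" by simp
    have e1: "W / real L ^ 4 + \<theta> (\<Lambda> + 1) / real L \<le> ?err"
      using theta_nonneg by (intro add_mono divide_right_mono) (auto intro!: add_nonneg_nonneg)
    have e2: "\<theta> (R * L + 1) / real L + \<theta> (L + 1) / real L \<le> ?err"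
      using theta_nonneg[of "\<Lambda> + 1"] W_nonneg by (simp add: add_divide_distrib)
    have e3: "(Th / real L ^ 4 + \<theta> (\<Lambda> + 1) / real L) + 1 / real L ^ 4 \<le> (Th + 1) * ?err"
    proof -
      have "(Th / real L ^ 4 + \<theta> (\<Lambda> + 1) / real L) + 1 / real L ^ 4 = (Th + 1) * (1 / real L ^ 4) + 1 * (\<theta> (\<Lambda> + 1) / real L)"
        by (simp add: add_divide_distrib)
      also have "\<dots> \<le> (Th + 1) * ((1 + W) / real L ^ 4) + (Th + 1) * (?th / real L)"
        using theta_nonneg W_nonneg Th_nonneg
        by (intro add_mono mult_left_mono mult_mono divide_right_mono) (auto intro!: add_nonneg_nonneg)
      finally show ?thesis by (simp add: distrib_left)
    qed
    have nn: "0 \<le> K2 * Q * ((real R + 3) * (2 + (real R)\<^sup>2))" "0 \<le> 2 * K0 * Q" "0 \<le> K0 * Q" "0 \<le> K0 * Q * (\<theta> (L + 1) / real L)"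
      using K2_ge(3) Q_nonneg K0_nonneg theta_nonneg by auto
    have "K2 * Q * ((real R + 3) * (2 + (real R)\<^sup>2)) * (W / real L ^ 4 + \<theta> (\<Lambda> + 1) / real L)
      + 2 * K0 * Q * (\<theta> (R * L + 1) / real L + \<theta> (L + 1) / real L)
      + K0 * Q * ((Th / real L ^ 4 + \<theta> (\<Lambda> + 1) / real L) + 1 / real L ^ 4)
      \<le> K2 * Q * ((real R + 3) * (2 + (real R)\<^sup>2)) * ?err + 2 * K0 * Q * ?err + K0 * Q * ((Th + 1) * ?err)"
      by (intro add_mono mult_left_mono e1 e2 e3 nn)
    also have "K2 * Q * ((real R + 3) * (2 + (real R)\<^sup>2)) * E + 2 * K0 * Q * E + K0 * Q * ((Th + 1) * E) = K3 * Q * E" for E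
      unfolding K3_def by (simp add: algebra_simps)
    finally have B: "K2 * Q * ((real R + 3) * (2 + (real R)\<^sup>2)) * (W / real L ^ 4 + \<theta> (\<Lambda> + 1) / real L)
      + 2 * K0 * Q * (\<theta> (R * L + 1) / real L + \<theta> (L + 1) / real L)
      + K0 * Q * ((Th / real L ^ 4 + \<theta> (\<Lambda> + 1) / real L) + 1 / real L ^ 4) \<le> K3 * Q * ?err" .
    have B1: "K2 * Q * ((real R + 3) * (2 + (real R)\<^sup>2)) * (W / real L ^ 4 + \<theta> (\<Lambda> + 1) / real L)
       = K2 * Q * ((real R + 3) * ((2 + (real R)\<^sup>2) * (W / real L ^ 4 + \<theta> (\<Lambda> + 1) / real L)))" by (simp only: mult.assoc)
    have B2: "2 * K0 * Q * (\<theta> (R * L + 1) / real L + \<theta> (L + 1) / real L) = 2 * K0 * Q * (\<theta> (R * L + 1) / real L) + 2 * (K0 * Q * \<theta> (L + 1) / real L)"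
      by (simp add: distrib_left mult.assoc)
    have B3: "K0 * Q * ((Th / real L ^ 4 + \<theta> (\<Lambda> + 1) / real L) + 1 / real L ^ 4) = K0 * Q * (Th / real L ^ 4 + \<theta> (\<Lambda> + 1) / real L) + K0 * Q / real L ^ 4"
      by (simp add: distrib_left)
    have n4: "0 \<le> K0 * Q * \<theta> (L + 1) / real L" using nn(4) by simp
    show "(\<Sum>p=1..L. (\<Sum>q=1..R * L. K2 * Q * gap_err (split_gap p q)) + K0 * Q * \<theta> (R * L + 1) / real L ^ 2 + K2 * Q * gap_err p)
       + K0 * Q * \<theta> (L + 1) / real L
      + ((1/2) * ((\<Sum>q=1..R * L. K2 * Q * gap_err (split_gap 0 q)) + K0 * Q * \<theta> (R * L + 1) / real L ^ 2)
        + ((1/6) * (K0 * Q * (Th / real L ^ 4 + \<theta> (\<Lambda> + 1) / real L)) + K0 * Q / real L ^ 4))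
      \<le> K3 * Q * ?err"
      by (rule step_expansion_arith[OF A B[unfolded B1 B2 B3] a0(3,4,5) n4])
  qed auto
qed

end

section \<open>The Gaussian heat flow\<close>

definition Phi :: "real \<Rightarrow> real" where "Phi z = measure (centered_normal 1) {..z}"

lemma space_centered_normal [simp]: "space (centered_normal s) = UNIV"
  by (simp add: centered_normal_def)

lemma sets_centered_normal [simp, measurable_cong]: "sets (centered_normal s) = sets borel"
  by (simp add: centered_normal_def)

lemma prob_space_centered_normal: "0 < s \<Longrightarrow> prob_space (centered_normal s)"
  unfolding centered_normal_def by (rule prob_space_normal_density)

lemma std_normal_density_le1: "std_normal_density z \<le> 1"
proof -
  have "1 \<le> sqrt (2 * pi)" using pi_ge_two by (intro real_le_rsqrt) auto
  then have "1 / sqrt (2 * pi) \<le> 1" by (simp add: divide_le_eq)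
  then show ?thesis unfolding std_normal_density_def by (intro mult_le_one) auto
qed

lemma Phi_diff:
  assumes "a \<le> b" shows "Phi b - Phi a = (LBINT z=a..b. std_normal_density z)"
proof -
  interpret prob_space "centered_normal 1" by (rule prob_space_centered_normal) simp
  have "Phi b - Phi a = measure (centered_normal 1) ({..b} - {..a})"
    unfolding Phi_def using assms by (subst finite_measure_Diff) auto
  also have "{..b} - {..a} = {a<..b}" by auto
  also have "measure (centered_normal 1) {a<..b} = (LINT z|lborel. indicator {a<..b} z * std_normal_density z)"
  proof -
    have "emeasure (centered_normal 1) {a<..b} = (\<integral>\<^sup>+z. ennreal (indicator {a<..b} z * std_normal_density z) \<partial>lborel)"
      unfolding centered_normal_def
      by (subst emeasure_density) (auto intro!: nn_integral_cong simp: indicator_def)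
    also have "\<dots> = ennreal (LINT z|lborel. indicator {a<..b} z * std_normal_density z)"
      using integrable_real_mult_indicator[of "{a<..b}" lborel std_normal_density]
      by (intro nn_integral_eq_integral) (auto simp: mult.commute)
    finally show ?thesis by (simp add: measure_def)
  qed
  also have "\<dots> = (LBINT z=a..b. std_normal_density z)"
    using assms by (simp add: interval_integral_Ioc set_lebesgue_integral_def)
  finally show ?thesis .
qed

lemma Phi_deriv: "(Phi has_real_derivative std_normal_density z) (at z)"
proof -
  have c: "continuous_on {z-1..z+1} std_normal_density"
    unfolding std_normal_density_def by (intro continuous_intros) auto
  have "((\<lambda>u. LBINT y=z-1..u. std_normal_density y) has_vector_derivative std_normal_density z) (at z within {z-1..z+1})"
    by (rule interval_integral_FTC2[OF _ _ c]) auto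
  then have "((\<lambda>u. LBINT y=z-1..u. std_normal_density y) has_real_derivative std_normal_density z) (at z within {z-1..z+1})"
    by (simp add: has_real_derivative_iff_has_vector_derivative)
  then have "((\<lambda>u. Phi (z - 1) + (LBINT y=z-1..u. std_normal_density y)) has_real_derivative std_normal_density z) (at z within {z-1..z+1})"
    by (auto intro!: derivative_eq_intros)
  moreover have "Phi (z - 1) + (LBINT y=z-1..u. std_normal_density y) = Phi u" if "u \<in> {z-1..z+1}" for u
    using Phi_diff[of "z-1" u] that by simp
  ultimately have "(Phi has_real_derivative std_normal_density z) (at z within {z-1..z+1})"
    by (subst (asm) has_field_derivative_cong_eventually) (auto simp: eventually_at_filter)
  moreover have "at z within {z-1..z+1} = at z" by (rule at_within_interior) (simp add: interior_atLeastAtMost_real)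
  ultimately show ?thesis by simp
qed

lemma Phi_bounds: "0 \<le> Phi z" "Phi z \<le> 1"
  using prob_space.prob_le_1[OF prob_space_centered_normal[of 1]] by (simp_all add: Phi_def)

lemma Phi_lipschitz: "\<bar>Phi b - Phi a\<bar> \<le> \<bar>b - a\<bar>"
  using field_differentiable_bound[of UNIV Phi std_normal_density 1 b a] Phi_deriv std_normal_density_le1
  by (auto intro: has_field_derivative_at_within simp: std_normal_density_def)

lemma std_normal_deriv: "(std_normal_density has_real_derivative - z * std_normal_density z) (at z)"
proof -
  have "((\<lambda>z::real. exp (- z\<^sup>2 / 2)) has_real_derivative exp (- z\<^sup>2 / 2) * (- z)) (at z)"
    by (auto intro!: derivative_eq_intros)
  from DERIV_cmult[OF this, of "1 / sqrt (2 * pi)"] show ?thesis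
    unfolding std_normal_density_def by (simp add: mult_ac)
qed

lemma measure_centered_normal:
  assumes "0 < s" shows "measure (centered_normal s) {..t} = Phi (t / s)"
proof -
  have "emeasure (centered_normal s) {..t} = (\<integral>\<^sup>+x. ennreal (normal_density 0 s x) * indicator {..t} x \<partial>lborel)"
    unfolding centered_normal_def by (subst emeasure_density) auto
  also have "\<dots> = ennreal \<bar>s\<bar> * (\<integral>\<^sup>+x. ennreal (normal_density 0 s (0 + s * x)) * indicator {..t} (0 + s * x) \<partial>lborel)"
    using assms by (intro nn_integral_real_affine) auto
  also have "\<dots> = (\<integral>\<^sup>+x. ennreal (std_normal_density x) * indicator {..t / s} x \<partial>lborel)"
  proof (subst nn_integral_cmult[symmetric], simp, intro nn_integral_cong)
    fix x :: real
    have "normal_density 0 s (s * x) * s = std_normal_density x"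
      using assms by (simp add: normal_density_def real_sqrt_mult power_mult_distrib)
    moreover have "s * x \<le> t \<longleftrightarrow> x \<le> t / s" using assms by (simp add: pos_le_divide_eq mult.commute)
    ultimately show "ennreal \<bar>s\<bar> * (ennreal (normal_density 0 s (0 + s * x)) * indicator {..t} (0 + s * x)) =
       ennreal (std_normal_density x) * indicator {..t / s} x"
      using assms by (simp add: ennreal_mult[symmetric] mult.commute[of s] indicator_def)
  qed
  also have "\<dots> = emeasure (centered_normal 1) {..t / s}"
    unfolding centered_normal_def by (subst emeasure_density) auto
  finally show ?thesis by (simp add: measure_def Phi_def)
qed

text \<open>For \<open>1 \<le> i \<le> 4\<close> this is minus the (probabilists') Hermite
  polynomial of degree \<open>i - 1\<close>; the sign comes from differentiating in
  \<open>y\<close>, which enters through \<open>(x - y) / s\<close>.\<close>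

fun gpoly :: "nat \<Rightarrow> real \<Rightarrow> real" where
  "gpoly 0 z = 0"
| "gpoly (Suc 0) z = - 1"
| "gpoly (Suc (Suc 0)) z = - z"
| "gpoly (Suc (Suc (Suc 0))) z = 1 - z\<^sup>2"
| "gpoly (Suc (Suc (Suc (Suc n)))) z = 3 * z - z ^ 3"

lemma gpoly_numeral: "gpoly 1 z = - 1" "gpoly 2 z = - z" "gpoly 3 z = 1 - z\<^sup>2" "gpoly 4 z = 3 * z - z ^ 3"
  by (simp_all add: eval_nat_numeral)

text \<open>The spatial derivatives of the solution \<open>Phi ((x - y) / s)\<close> of the heat equation with
  \<open>s\<^sup>2\<close> as time.\<close>

definition gfd :: "real \<Rightarrow> real \<Rightarrow> nat \<Rightarrow> real \<Rightarrow> real" where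
  "gfd s x i y = (if i = 0 then Phi ((x - y) / s) else gpoly i ((x - y) / s) * std_normal_density ((x - y) / s) / s ^ i)"

lemma gfd_deriv:
  assumes "i < 4" "0 < s"
  shows "(gfd s x i has_real_derivative gfd s x (Suc i) y) (at y)"
proof -
  have z: "((\<lambda>y. (x - y) / s) has_real_derivative - 1 / s) (at y)"
    using assms by (auto intro!: derivative_eq_intros)
  let ?z = "(x - y) / s"
  show ?thesis
  proof (cases "i = 0")
    case True
    have "((\<lambda>y. Phi ((x - y) / s)) has_real_derivative std_normal_density ?z * (- 1 / s)) (at y)"
      using DERIV_chain2[OF Phi_deriv z] .
    then show ?thesis by (simp add: True gfd_def[abs_def])
  next
    case False
    then consider "i = 1" | "i = 2" | "i = 3" using assms by linarith
    \<comment> \<open>The Hermite recursion: the next polynomial is \<open>z\<close> times the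
      current one minus its derivative, exactly what the product rule produces below.\<close>
    then obtain h' where h': "(gpoly i has_real_derivative h') (at ?z)" "gpoly (Suc i) ?z = ?z * gpoly i ?z - h'"
    proof cases
      case 1
      have "(gpoly i has_real_derivative 0) (at ?z)" unfolding 1 One_nat_def gpoly.simps[abs_def] by (auto intro!: derivative_eq_intros)
      then show ?thesis by (rule that) (simp add: 1)
    next
      case 2
      have "(gpoly i has_real_derivative - 1) (at ?z)" unfolding 2 gpoly_numeral[abs_def] by (auto intro!: derivative_eq_intros)
      then show ?thesis by (rule that) (simp add: 2 gpoly_numeral power2_eq_square)
    next
      case 3
      have "(gpoly i has_real_derivative - 2 * z) (at z)" for z unfolding 3 gpoly_numeral[abs_def] by (auto intro!: derivative_eq_intros)
      moreover have "gpoly (Suc i) z = z * gpoly i z - - 2 * z" for z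
        by (simp add: 3 gpoly_numeral power2_eq_square power3_eq_cube algebra_simps)
      ultimately show ?thesis using that by blast
    qed
    have "((\<lambda>y. gpoly i ((x - y) / s)) has_real_derivative h' * (- 1 / s)) (at y)"
      using DERIV_chain2[OF h'(1) z] .
    moreover have "((\<lambda>y. std_normal_density ((x - y) / s)) has_real_derivative - ?z * std_normal_density ?z * (- 1 / s)) (at y)"
      using DERIV_chain2[OF std_normal_deriv z] .
    ultimately have "((\<lambda>y. gpoly i ((x - y) / s) * std_normal_density ((x - y) / s) / s ^ i) has_real_derivative
        ((h' * (- 1 / s)) * std_normal_density ?z + (- ?z * std_normal_density ?z * (- 1 / s)) * gpoly i ?z) / s ^ i) (at y)"
      by (intro DERIV_cdivide DERIV_mult)
    also have "((h' * (- 1 / s)) * std_normal_density ?z + (- ?z * std_normal_density ?z * (- 1 / s)) * gpoly i ?z) / s ^ i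
      = (?z * gpoly i ?z - h') * std_normal_density ?z / s ^ Suc i"
      using assms(2) by (simp add: divide_simps) (simp add: algebra_simps)
    finally show ?thesis using False by (simp add: gfd_def[abs_def] h'(2))
  qed
qed

lemma gpoly_bound: "1 \<le> i \<Longrightarrow> i \<le> 4 \<Longrightarrow> \<bar>gpoly i z\<bar> \<le> 9 * exp \<bar>z\<bar>"
proof -
  assume i: "1 \<le> i" "i \<le> 4"
  have e: "(\<Sum>k<4. \<bar>z\<bar> ^ k / fact k) \<le> exp \<bar>z\<bar>"
    unfolding exp_def using summable_exp_generic[of "\<bar>z\<bar>"]
    by (simp add: divide_inverse mult.commute scaleR_conv_of_real) (intro sum_le_suminf; auto)
  then have e': "1 + \<bar>z\<bar> + \<bar>z\<bar>\<^sup>2 / 2 + \<bar>z\<bar> ^ 3 / 6 \<le> exp \<bar>z\<bar>"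
    by (simp add: eval_nat_numeral)
  have nn: "0 \<le> \<bar>z\<bar>" "0 \<le> \<bar>z\<bar>\<^sup>2" "0 \<le> \<bar>z\<bar> ^ 3" by auto
  consider "i = 1" | "i = 2" | "i = 3" | "i = 4" using i by linarith
  then show ?thesis
  proof cases
    case 1
    then have "\<bar>gpoly i z\<bar> = 1" by simp
    then show ?thesis using e' nn by linarith
  next
    case 2
    then have "\<bar>gpoly i z\<bar> = \<bar>z\<bar>" by (simp add: numeral_2_eq_2)
    then show ?thesis using e' nn by linarith
  next
    case 3
    have "\<bar>1 - z\<^sup>2\<bar> \<le> 1 + \<bar>z\<bar>\<^sup>2" using abs_triangle_ineq4[of 1 "z\<^sup>2"] by simp
    moreover have "gpoly i z = 1 - z\<^sup>2" using 3 by (simp add: eval_nat_numeral)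
    ultimately show ?thesis using e' nn by linarith
  next
    case 4
    have "\<bar>3 * z - z ^ 3\<bar> \<le> 3 * \<bar>z\<bar> + \<bar>z\<bar> ^ 3" using abs_triangle_ineq4[of "3 * z" "z ^ 3"] by (simp add: abs_mult power_abs)
    moreover have "gpoly i z = 3 * z - z ^ 3" using 4 by (simp add: eval_nat_numeral)
    ultimately show ?thesis using e' nn by linarith
  qed
qed

text \<open>The \<open>9\<close> is that of \<open>gpoly_bound\<close>, the exponential comes from
  completing the square against the decay \<open>exp (- 2 * \<sigma> * \<bar>z\<bar>)\<close>, and
  the last factor dominates \<open>(1 / \<sigma>) ^ i\<close> for \<open>i \<le> 4\<close>.\<close>

definition gc :: "real \<Rightarrow> real" where
  "gc \<sigma> = 9 * exp ((2 * \<sigma> + 1)\<^sup>2 / 2) * (1 + 1 / \<sigma>) ^ 4"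

lemma gc_ge1: "0 < \<sigma> \<Longrightarrow> 1 \<le> gc \<sigma>"
proof -
  assume s: "0 < \<sigma>"
  have "9 * 1 * 1 \<le> 9 * exp ((2 * \<sigma> + 1)\<^sup>2 / 2) * (1 + 1 / \<sigma>) ^ 4"
    using s by (intro mult_mono one_le_power) auto
  then show ?thesis by (simp add: gc_def)
qed

text \<open>A Gaussian tail beats exponential decay, so at bandwidth \<open>s\<close> comparable to
  \<open>\<sigma> * L\<close> the two-sided exponential of scale \<open>L\<close> is an envelope.
  Unlike the Gaussian, it changes by a bounded factor under translations of order
  \<open>L\<close>.\<close>

lemma gfd_bound:
  assumes i: "1 \<le> i" "i \<le> 4" and \<sigma>: "0 < \<sigma>" and L: "1 \<le> L" and s: "\<sigma> * real L \<le> s" "s \<le> 2 * \<sigma> * real L"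
  shows "\<bar>gfd s x i y\<bar> \<le> gc \<sigma> / real L ^ i * exp (- \<bar>x - y\<bar> / real L)"
proof -
  have L': "1 \<le> real L" using L by simp
  have s0: "0 < s" using s(1) \<sigma> L' by (meson less_le_trans mult_pos_pos zero_less_one)
  define z where "z = (x - y) / s"
  have "\<bar>x - y\<bar> / real L = \<bar>z\<bar> * (s / real L)" using s0 by (simp add: z_def abs_divide)
  also have "\<dots> \<le> \<bar>z\<bar> * (2 * \<sigma>)" using s(2) L' by (intro mult_left_mono) (auto simp: divide_le_eq)
  also have "\<dots> = 2 * \<sigma> * \<bar>z\<bar>" by simp
  finally have zz: "\<bar>x - y\<bar> / real L \<le> 2 * \<sigma> * \<bar>z\<bar>" .
  have dens: "std_normal_density z \<le> exp (- z\<^sup>2 / 2)"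
  proof -
    have "1 \<le> sqrt (2 * pi)" using pi_ge_two by (intro real_le_rsqrt) auto
    then have "1 / sqrt (2 * pi) \<le> 1" by (simp add: divide_le_eq)
    then show ?thesis unfolding std_normal_density_def by (intro mult_left_le_one_le) auto
  qed
  have "0 \<le> (\<bar>z\<bar> - (2 * \<sigma> + 1))\<^sup>2" by simp
  then have sq: "\<bar>z\<bar> - z\<^sup>2 / 2 \<le> (2 * \<sigma> + 1)\<^sup>2 / 2 - 2 * \<sigma> * \<bar>z\<bar>"
    by (simp add: power2_eq_square algebra_simps)
  have "\<bar>gpoly i z\<bar> * std_normal_density z \<le> (9 * exp \<bar>z\<bar>) * exp (- z\<^sup>2 / 2)"
    using i dens by (intro mult_mono gpoly_bound) (auto simp: std_normal_density_def)
  also have "\<dots> = 9 * exp (\<bar>z\<bar> - z\<^sup>2 / 2)" by (simp add: exp_add[symmetric])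
  also have "\<dots> \<le> 9 * exp ((2 * \<sigma> + 1)\<^sup>2 / 2 - 2 * \<sigma> * \<bar>z\<bar>)" using sq by simp
  also have "\<dots> \<le> 9 * exp ((2 * \<sigma> + 1)\<^sup>2 / 2 + (- \<bar>x - y\<bar> / real L))" using zz by simp
  also have "\<dots> = 9 * exp ((2 * \<sigma> + 1)\<^sup>2 / 2) * exp (- \<bar>x - y\<bar> / real L)" by (simp only: exp_add mult.assoc)
  finally have A: "\<bar>gpoly i z\<bar> * std_normal_density z \<le> 9 * exp ((2 * \<sigma> + 1)\<^sup>2 / 2) * exp (- \<bar>x - y\<bar> / real L)" .
  have "1 / s ^ i \<le> 1 / (\<sigma> * real L) ^ i" using s \<sigma> L' s0 by (intro divide_left_mono power_mono) (auto intro!: mult_pos_pos)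
  also have "\<dots> = (1 / \<sigma>) ^ i / real L ^ i" by (simp add: power_mult_distrib power_divide)
  also have "\<dots> \<le> (1 + 1 / \<sigma>) ^ 4 / real L ^ i"
    using \<sigma> i by (intro divide_right_mono order_trans[OF power_mono[of "1/\<sigma>" "1 + 1/\<sigma>"] power_increasing]) auto
  finally have B: "1 / s ^ i \<le> (1 + 1 / \<sigma>) ^ 4 / real L ^ i" .
  have "\<bar>gfd s x i y\<bar> = (\<bar>gpoly i z\<bar> * std_normal_density z) * (1 / s ^ i)"
    using i s0 by (simp add: gfd_def z_def abs_mult std_normal_density_def)
  also have "\<dots> \<le> (9 * exp ((2 * \<sigma> + 1)\<^sup>2 / 2) * exp (- \<bar>x - y\<bar> / real L)) * ((1 + 1 / \<sigma>) ^ 4 / real L ^ i)"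
    using s0 by (intro mult_mono[OF A B]) auto
  finally show ?thesis by (simp add: gc_def mult_ac)
qed

lemma gfd_test_fun:
  assumes \<sigma>: "0 < \<sigma>" and L: "1 \<le> L" and s: "\<sigma> * real L \<le> s" "s \<le> 2 * \<sigma> * real L" and M: "1 \<le> M"
  shows "test_fun (gfd s x) (\<lambda>y. exp (- \<bar>x - y\<bar> / real L)) (gc \<sigma>) M L"
proof
  have s0: "0 < s" using s(1) \<sigma> L by (meson less_le_trans mult_pos_pos of_nat_0_less_iff less_one linorder_not_less)
  show "exp (- \<bar>x - (y + u)\<bar> / real L) \<le> exp (\<bar>u\<bar> / real L) * exp (- \<bar>x - y\<bar> / real L)" for y u
    unfolding exp_add[symmetric] exp_le_cancel_iff add_divide_distrib[symmetric]
    by (intro divide_right_mono) auto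
  show "\<bar>gfd s x i y\<bar> \<le> gc \<sigma> / real L ^ i * exp (- \<bar>x - y\<bar> / real L)" if "1 \<le> i" "i \<le> 4" for i y
    using gfd_bound[OF that assms(1-4)] .
  show "(gfd s x i has_real_derivative gfd s x (Suc i) y) (at y)" if "i < 4" for i y
    using gfd_deriv[OF that s0] .
  show "\<bar>gfd s x 0 y\<bar> \<le> gc \<sigma>" for y
    using Phi_bounds[of "(x - y) / s"] gc_ge1[OF \<sigma>] by (simp add: gfd_def)
qed (use assms gc_ge1[of \<sigma>] in auto)

text \<open>The case \<open>i = 0\<close> is the heat equation; the case \<open>i = 2\<close>
  controls the second time derivative in \<open>heat_step\<close>.\<close>

lemma heat_deriv:
  assumes "0 < \<sigma>" "0 < t" "i \<le> 2" "even i"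
  shows "((\<lambda>t. gfd (\<sigma> * sqrt t) x i y) has_real_derivative \<sigma>\<^sup>2 / 2 * gfd (\<sigma> * sqrt t) x (i + 2) y) (at t)"
proof -
  let ?z = "\<lambda>t. (x - y) / (\<sigma> * sqrt t)"
  have z: "(?z has_real_derivative - ?z t / (2 * t)) (at t)"
    using assms by (auto intro!: derivative_eq_intros simp: field_simps power2_eq_square)
  have d: "((\<lambda>t. std_normal_density (?z t)) has_real_derivative - ?z t * std_normal_density (?z t) * (- ?z t / (2 * t))) (at t)"
    using DERIV_chain2[OF std_normal_deriv z] .
  consider "i = 0" | "i = 2" using assms by (auto simp: le_Suc_eq numeral_2_eq_2)
  then show ?thesis
  proof cases
    case 1
    have A: "((\<lambda>t. Phi (?z t)) has_real_derivative std_normal_density (?z t) * (- ?z t / (2 * t))) (at t)"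
      using DERIV_chain2[OF Phi_deriv z] .
    have B: "std_normal_density (?z t) * (- ?z t / (2 * t)) = \<sigma>\<^sup>2 / 2 * gfd (\<sigma> * sqrt t) x 2 y"
    proof -
      have "gpoly 2 (?z t) = - ?z t" by (simp add: numeral_2_eq_2)
      moreover have "a * (- z / (2 * t)) = \<sigma>\<^sup>2 / 2 * (- z * a / (\<sigma>\<^sup>2 * t))" for a z :: real
        using assms by simp
      ultimately show ?thesis using assms by (simp only: gfd_def power_mult_distrib) simp
    qed
    have "((\<lambda>t. Phi (?z t)) has_real_derivative \<sigma>\<^sup>2 / 2 * gfd (\<sigma> * sqrt t) x 2 y) (at t)" using A unfolding B .
    moreover have "(\<lambda>t. gfd (\<sigma> * sqrt t) x 0 y) = (\<lambda>t. Phi (?z t))" by (simp add: gfd_def)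
    ultimately show ?thesis unfolding 1 add_0 by (simp only:)
  next
    case 2
    have e: "gfd (\<sigma> * sqrt t) x 2 y = - ?z t * std_normal_density (?z t) / (\<sigma>\<^sup>2 * t)" if "0 < t" for t
      using that by (simp add: gfd_def power_mult_distrib) (simp add: numeral_2_eq_2)
    have "((\<lambda>t. - ?z t * std_normal_density (?z t) / (\<sigma>\<^sup>2 * t)) has_real_derivative
      (((- (- ?z t / (2 * t))) * std_normal_density (?z t) + (- ?z t * std_normal_density (?z t) * (- ?z t / (2 * t))) * (- ?z t)) * (\<sigma>\<^sup>2 * t)
        - (- ?z t * std_normal_density (?z t)) * \<sigma>\<^sup>2) / ((\<sigma>\<^sup>2 * t) * (\<sigma>\<^sup>2 * t))) (at t)"
      by (rule DERIV_divide DERIV_mult DERIV_minus z d derivative_eq_intros refl | use assms in simp)+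
    moreover have "(((- (- ?z t / (2 * t))) * std_normal_density (?z t) + (- ?z t * std_normal_density (?z t) * (- ?z t / (2 * t))) * (- ?z t)) * (\<sigma>\<^sup>2 * t)
        - (- ?z t * std_normal_density (?z t)) * \<sigma>\<^sup>2) / ((\<sigma>\<^sup>2 * t) * (\<sigma>\<^sup>2 * t)) = \<sigma>\<^sup>2 / 2 * gfd (\<sigma> * sqrt t) x 4 y"
    proof -
      have g4: "gfd (\<sigma> * sqrt t) x 4 y = (3 * ?z t - ?z t ^ 3) * std_normal_density (?z t) / (\<sigma> ^ 4 * t\<^sup>2)"
      proof -
        have "sqrt t ^ 4 = t\<^sup>2" using assms by (simp add: power4_eq_xxxx power2_eq_square)
        then show ?thesis by (simp add: gfd_def gpoly_numeral power_mult_distrib)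
      qed
      have "((- (- a / (2 * t)) * b + (- a * b * (- a / (2 * t))) * (- a)) * (\<sigma>\<^sup>2 * t) - (- a * b) * \<sigma>\<^sup>2) / ((\<sigma>\<^sup>2 * t) * (\<sigma>\<^sup>2 * t))
        = \<sigma>\<^sup>2 / 2 * ((3 * a - a ^ 3) * b / (\<sigma> ^ 4 * t\<^sup>2))" for a b :: real
        using assms by (simp add: field_simps eval_nat_numeral)
      then show ?thesis unfolding g4 by blast
    qed
    ultimately have D: "((\<lambda>t. - ?z t * std_normal_density (?z t) / (\<sigma>\<^sup>2 * t)) has_real_derivative \<sigma>\<^sup>2 / 2 * gfd (\<sigma> * sqrt t) x 4 y) (at t)"
      by (simp only:)
    have Ev: "\<forall>\<^sub>F t in nhds t. - ?z t * std_normal_density (?z t) / (\<sigma>\<^sup>2 * t) = gfd (\<sigma> * sqrt t) x 2 y"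
      using eventually_nhds_in_open[of "{0<..}" t] assms by (auto simp: e elim: eventually_mono)
    have "((\<lambda>t. gfd (\<sigma> * sqrt t) x 2 y) has_real_derivative \<sigma>\<^sup>2 / 2 * gfd (\<sigma> * sqrt t) x 4 y) (at t)"
      using D DERIV_cong_ev[OF refl Ev refl] by (rule iffD1[rotated])
    then show ?thesis unfolding 2 by simp
  qed
qed

text \<open>One unit of time is the Gaussian counterpart of one summand. This is Taylor's formula in
  time, the second time derivative being \<open>\<sigma> ^ 4 / 4\<close> times the fourth spatial
  one; \<open>L\<close> remains an admissible scale on all of \<open>{N..N+1}\<close>.\<close>

lemma heat_step:
  assumes \<sigma>: "0 < \<sigma>" and L: "1 \<le> L" "real L \<le> sqrt N" "sqrt (N + 1) \<le> 2 * real L"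
  shows "\<bar>gfd (\<sigma> * sqrt (N + 1)) x 0 y - gfd (\<sigma> * sqrt N) x 0 y - \<sigma>\<^sup>2 / 2 * gfd (\<sigma> * sqrt N) x 2 y\<bar>
    \<le> \<sigma> ^ 4 * gc \<sigma> / real L ^ 4 * exp (- \<bar>x - y\<bar> / real L)"
proof -
  have N0: "0 < N"
  proof -
    have "0 < sqrt N" using L by (meson less_le_trans of_nat_0_less_iff less_one linorder_not_less)
    then show ?thesis by simp
  qed
  let ?B = "gc \<sigma> / real L ^ 4 * exp (- \<bar>x - y\<bar> / real L)"
  have B: "\<bar>gfd (\<sigma> * sqrt t) x 4 y\<bar> \<le> ?B" if "N \<le> t" "t \<le> N + 1" for t
  proof (rule gfd_bound)
    have "sqrt N \<le> sqrt t" "sqrt t \<le> sqrt (N + 1)" using that by auto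
    then have "real L \<le> sqrt t" "sqrt t \<le> 2 * real L" using L by linarith+
    then show "\<sigma> * real L \<le> \<sigma> * sqrt t" "\<sigma> * sqrt t \<le> 2 * \<sigma> * real L" using \<sigma> by auto
  qed (use \<sigma> L in auto)
  have B0: "0 \<le> ?B" using gc_ge1[OF \<sigma>] by simp
  let ?f2 = "\<lambda>t. gfd (\<sigma> * sqrt t) x 2 y"
  have "norm (?f2 t - ?f2 N) \<le> (\<sigma>\<^sup>2 / 2 * ?B) * norm (t - N)" if t: "t \<in> {N..N+1}" for t
  proof (rule field_differentiable_bound[where S="{N..N+1}" and f'="\<lambda>t. \<sigma>\<^sup>2 / 2 * gfd (\<sigma> * sqrt t) x 4 y"])
    show "(?f2 has_field_derivative \<sigma>\<^sup>2 / 2 * gfd (\<sigma> * sqrt z) x 4 y) (at z within {N..N+1})" if "z \<in> {N..N+1}" for z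
      using heat_deriv[of \<sigma> z 2 x y] \<sigma> N0 that by (auto intro: has_field_derivative_at_within)
    show "norm (\<sigma>\<^sup>2 / 2 * gfd (\<sigma> * sqrt z) x 4 y) \<le> \<sigma>\<^sup>2 / 2 * ?B" if "z \<in> {N..N+1}" for z
      unfolding real_norm_def abs_mult using B[of z] that by (intro mult_mono) auto
  qed (use t in auto)
  then have f2: "\<bar>?f2 t - ?f2 N\<bar> \<le> \<sigma>\<^sup>2 / 2 * ?B" if "t \<in> {N..N+1}" for t
  proof -
    have "(\<sigma>\<^sup>2 / 2 * ?B) * norm (t - N) \<le> (\<sigma>\<^sup>2 / 2 * ?B) * 1" using that mult_nonneg_nonneg[OF _ B0, of "\<sigma>\<^sup>2 / 2"] by (intro mult_left_mono) auto
    with \<open>t \<in> {N..N+1} \<Longrightarrow> norm (?f2 t - ?f2 N) \<le> (\<sigma>\<^sup>2 / 2 * ?B) * norm (t - N)\<close>[OF that] show ?thesis by simp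
  qed
  \<comment> \<open>With the linear part subtracted, the derivative is
    \<open>\<sigma>\<^sup>2 / 2 * (?f2 t - ?f2 N)\<close>, which \<open>f2\<close> already
    bounds.\<close>
  let ?h = "\<lambda>t. gfd (\<sigma> * sqrt t) x 0 y - t * (\<sigma>\<^sup>2 / 2 * ?f2 N)"
  have "norm (?h (N + 1) - ?h N) \<le> (\<sigma>\<^sup>2 / 2 * (\<sigma>\<^sup>2 / 2 * ?B)) * norm (N + 1 - N)"
  proof (rule field_differentiable_bound[where S="{N..N+1}" and f'="\<lambda>t. \<sigma>\<^sup>2 / 2 * ?f2 t - 1 * (\<sigma>\<^sup>2 / 2 * ?f2 N)"])
    show "(?h has_field_derivative \<sigma>\<^sup>2 / 2 * ?f2 z - 1 * (\<sigma>\<^sup>2 / 2 * ?f2 N)) (at z within {N..N+1})" if "z \<in> {N..N+1}" for z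
      using heat_deriv[of \<sigma> z 0 x y] \<sigma> N0 that
      by (intro DERIV_diff DERIV_cmult_right DERIV_ident) (auto intro: has_field_derivative_at_within simp: numeral_2_eq_2)
    show "norm (\<sigma>\<^sup>2 / 2 * ?f2 z - 1 * (\<sigma>\<^sup>2 / 2 * ?f2 N)) \<le> \<sigma>\<^sup>2 / 2 * (\<sigma>\<^sup>2 / 2 * ?B)" if "z \<in> {N..N+1}" for z
    proof -
      have "\<sigma>\<^sup>2 / 2 * ?f2 z - 1 * (\<sigma>\<^sup>2 / 2 * ?f2 N) = \<sigma>\<^sup>2 / 2 * (?f2 z - ?f2 N)" by (simp add: right_diff_distrib)
      moreover have "\<bar>\<sigma>\<^sup>2 / 2 * (?f2 z - ?f2 N)\<bar> \<le> \<sigma>\<^sup>2 / 2 * (\<sigma>\<^sup>2 / 2 * ?B)"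
        unfolding abs_mult using f2[OF that] by (rule mult_mono[rotated]) auto
      ultimately show ?thesis by (simp only: real_norm_def)
    qed
  qed auto
  also have "(\<sigma>\<^sup>2 / 2 * (\<sigma>\<^sup>2 / 2 * ?B)) * norm (N + 1 - N) \<le> \<sigma> ^ 4 * ?B"
  proof -
    have "\<sigma>\<^sup>2 / 2 * (\<sigma>\<^sup>2 / 2 * b) * norm (N + 1 - N) \<le> \<sigma> ^ 4 * b" if "0 \<le> b" for b
    proof -
      have "\<sigma>\<^sup>2 / 2 * (\<sigma>\<^sup>2 / 2 * b) * norm (N + 1 - N) = \<sigma> ^ 4 * b / 4"
        by (simp add: power4_eq_xxxx power2_eq_square)
      moreover have "0 \<le> \<sigma> ^ 4 * b" using that by simp
      ultimately show ?thesis by linarith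
    qed
    then show ?thesis using B0 by blast
  qed
  finally have "\<bar>?h (N + 1) - ?h N\<bar> \<le> \<sigma> ^ 4 * ?B" by (simp only: real_norm_def)
  moreover have "a - (N + 1) * d - (b - N * d) = a - b - d" for a b d :: real by (simp add: algebra_simps)
  ultimately have "\<bar>gfd (\<sigma> * sqrt (N + 1)) x 0 y - gfd (\<sigma> * sqrt N) x 0 y - \<sigma>\<^sup>2 / 2 * ?f2 N\<bar> \<le> \<sigma> ^ 4 * ?B"
    by (simp only:)
  then show ?thesis by simp
qed

section \<open>Smoothing and concentration\<close>

text \<open>The third Hermite function, which is the derivative of \<open>gpoly 3\<close> times the
  normal density. Its moments of order \<open>0\<close> and \<open>1\<close> vanish, so it
  annihilates affine functions.\<close>

definition herm3 :: "real \<Rightarrow> real" where "herm3 z = (z ^ 3 - 3 * z) * std_normal_density z"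

lemma herm3_eq: "herm3 z = std_normal_density z * z ^ 3 - 3 * (std_normal_density z * z ^ 1)"
  by (simp add: herm3_def algebra_simps)

lemma herm3_integrable: "integrable lborel herm3"
  unfolding herm3_eq[abs_def] by (intro Bochner_Integration.integrable_diff integrable_mult_right integrable_std_normal_moment)

lemma herm3_z: "herm3 z * z = std_normal_density z * z ^ 4 - 3 * (std_normal_density z * z ^ 2)"
  by (simp add: herm3_def algebra_simps eval_nat_numeral)

lemma herm3_z2: "herm3 z * z\<^sup>2 = std_normal_density z * z ^ 5 - 3 * (std_normal_density z * z ^ 3)"
  by (simp add: herm3_def algebra_simps eval_nat_numeral)

lemma herm3_z_integrable: "integrable lborel (\<lambda>z. herm3 z * z)" "integrable lborel (\<lambda>z. herm3 z * z\<^sup>2)"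
  unfolding herm3_z herm3_z2 by (intro Bochner_Integration.integrable_diff integrable_mult_right integrable_std_normal_moment)+

lemma herm3_integral: "(LBINT z. herm3 z) = 0" "(LBINT z. herm3 z * z) = 0"
proof -
  have o: "(LBINT z. std_normal_density z * z ^ 3) = 0" "(LBINT z. std_normal_density z * z ^ 1) = 0"
    using integral_std_normal_moment_odd[of 1] integral_std_normal_moment_odd[of 0] by auto
  show "(LBINT z. herm3 z) = 0"
    unfolding herm3_eq by (subst Bochner_Integration.integral_diff) (use o integrable_std_normal_moment[of 1] in \<open>auto intro!: integrable_mult_right integrable_std_normal_moment\<close>)
  have e: "(LBINT z. std_normal_density z * z ^ 4) = 3" "(LBINT z. std_normal_density z * z ^ 2) = 1"
    using integral_std_normal_moment_even[of 2] integral_std_normal_moment_even[of 1] by (auto simp: fact_numeral)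
  show "(LBINT z. herm3 z * z) = 0"
    unfolding herm3_z by (subst Bochner_Integration.integral_diff) (use e in \<open>auto intro!: integrable_mult_right integrable_std_normal_moment\<close>)
qed

lemma integral_antiderivative:
  fixes G k :: "real \<Rightarrow> real"
  assumes d: "\<And>z. (G has_real_derivative k z) (at z)" and c: "\<And>z. isCont k z"
    and i: "integrable lborel k" and l: "(G \<longlongrightarrow> 0) at_bot"
  shows "(LBINT z. k z * indicator {..w} z) = G w"
proof -
  have "(LBINT z=-\<infinity>..ereal w. k z) = G w - 0"
  proof (rule interval_integral_FTC_integrable)
    show "(G has_vector_derivative k z) (at z)" for z
      using d by (simp add: has_real_derivative_iff_has_vector_derivative)
    show "set_integrable lborel (einterval (-\<infinity>) (ereal w)) k"
      unfolding set_integrable_def using integrable_real_mult_indicator[OF _ i, of "einterval (-\<infinity>) (ereal w)"]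
      by (simp add: mult.commute)
    show "((G \<circ> real_of_ereal) \<longlongrightarrow> 0) (at_right (- \<infinity>))"
      using l by (simp add: ereal_tendsto_simps)
    show "((G \<circ> real_of_ereal) \<longlongrightarrow> G w) (at_left (ereal w))"
      using DERIV_isCont[OF d, of w] by (simp add: ereal_tendsto_simps isCont_def filterlim_at_split)
  qed (use c in auto)
  moreover have "(LBINT z=-\<infinity>..ereal w. k z) = (LBINT z. indicator {..<w} z * k z)"
    by (simp add: interval_lebesgue_integral_def set_lebesgue_integral_def einterval_def lessThan_def)
  moreover have "(LBINT z. indicator {..<w} z * k z) = (LBINT z. k z * indicator {..w} z)"
  proof (rule integral_cong_AE)
    have "AE z in lborel. z \<noteq> w" by (rule AE_lborel_singleton)
    then show "AE z in lborel. indicator {..<w} z * k z = k z * indicator {..w} z"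
      by eventually_elim (auto simp: indicator_def)
  qed (use i in auto)
  ultimately show ?thesis by simp
qed

text \<open>Integration by parts in the form of Fubini: \<open>G\<close> integrates \<open>k\<close>
  up to \<open>(x - T) / s\<close>, and \<open>z \<le> (x - T) / s\<close> means
  \<open>T \<le> x - s * z\<close>. Expectations become integrals of the distribution function, into
  which a Berry-Esseen bound can be inserted.\<close>

lemma (in prob_space) expectation_antiderivative:
  fixes G k :: "real \<Rightarrow> real"
  assumes d: "\<And>z. (G has_real_derivative k z) (at z)" and c: "\<And>z. isCont k z"
    and i: "integrable lborel k" and l: "(G \<longlongrightarrow> 0) at_bot"
    and T[measurable]: "T \<in> borel_measurable M" and s: "0 < s"
  shows "expectation (\<lambda>\<omega>. G ((x - T \<omega>) / s)) = (LBINT z. k z * prob {\<omega> \<in> space M. T \<omega> \<le> x - s * z})"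
    and "integrable lborel (\<lambda>z. k z * prob {\<omega> \<in> space M. T \<omega> \<le> x - s * z})"
proof -
  interpret P: pair_sigma_finite M lborel ..
  have k[measurable]: "k \<in> borel_measurable borel" using i by auto
  let ?f = "\<lambda>(\<omega>, z). k z * indicator {..(x - T \<omega>) / s} z"
  have ind: "indicator {..(x - T \<omega>) / s} z = (if T \<omega> \<le> x - s * z then 1 else (0::real))" for \<omega> z
    using s by (auto simp: indicator_def pos_le_divide_eq algebra_simps)
  have m[measurable]: "?f \<in> borel_measurable (M \<Otimes>\<^sub>M lborel)"
    unfolding ind by measurable
  have int: "integrable (M \<Otimes>\<^sub>M lborel) ?f"
  proof (rule P.Fubini_integrable[OF m])
    have "integrable M (\<lambda>\<omega>. LBINT z. norm (k z * indicator {..(x - T \<omega>) / s} z))"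
    proof (rule integrable_const_bound[where B="LBINT z. norm (k z)"])
      show "AE \<omega> in M. norm (LBINT z. norm (k z * indicator {..(x - T \<omega>) / s} z)) \<le> (LBINT z. norm (k z))"
      proof (rule AE_I2)
        fix \<omega>
        have "(LBINT z. norm (k z * indicator {..(x - T \<omega>) / s} z)) \<le> (LBINT z. norm (k z))"
          using i by (intro integral_mono integrable_norm integrable_real_mult_indicator) (auto simp: indicator_def)
        then show "norm (LBINT z. norm (k z * indicator {..(x - T \<omega>) / s} z)) \<le> (LBINT z. norm (k z))" by simp
      qed
    qed (unfold ind, measurable)
    then show "integrable M (\<lambda>\<omega>. LBINT z. norm (?f (\<omega>, z)))" by simp
    show "AE \<omega> in M. integrable lborel (\<lambda>z. ?f (\<omega>, z))"
      using i by (auto intro!: integrable_real_mult_indicator)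
  qed
  have inner: "(\<integral>\<omega>. k z * indicator {..(x - T \<omega>) / s} z \<partial>M) = k z * prob {\<omega> \<in> space M. T \<omega> \<le> x - s * z}" for z
  proof -
    have "(\<integral>\<omega>. k z * indicator {..(x - T \<omega>) / s} z \<partial>M) = (\<integral>\<omega>. k z * indicator {\<omega> \<in> space M. T \<omega> \<le> x - s * z} \<omega> \<partial>M)"
      unfolding ind by (intro Bochner_Integration.integral_cong) (auto simp: indicator_def)
    then show ?thesis by simp
  qed
  have "expectation (\<lambda>\<omega>. G ((x - T \<omega>) / s)) = (\<integral>\<omega>. (LBINT z. ?f (\<omega>, z)) \<partial>M)"
    using integral_antiderivative[OF d c i l] by simp
  also have "\<dots> = (LBINT z. (\<integral>\<omega>. ?f (\<omega>, z) \<partial>M))"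
    using P.Fubini_integral[of "\<lambda>\<omega> z. k z * indicator {..(x - T \<omega>) / s} z"] int by simp
  finally show "expectation (\<lambda>\<omega>. G ((x - T \<omega>) / s)) = (LBINT z. k z * prob {\<omega> \<in> space M. T \<omega> \<le> x - s * z})"
    by (simp only: prod.case inner)
  show "integrable lborel (\<lambda>z. k z * prob {\<omega> \<in> space M. T \<omega> \<le> x - s * z})"
    using P.integrable_snd[OF int] by (simp only: prod.case inner)
qed

lemma isCont_std_normal: "isCont std_normal_density z"
  by (rule DERIV_isCont[OF std_normal_deriv])

lemma isCont_Phi: "isCont Phi z"
  by (rule DERIV_isCont[OF Phi_deriv])

lemma Phi_measurable[measurable]: "Phi \<in> borel_measurable borel"
  by (intro borel_measurable_continuous_onI continuous_at_imp_continuous_on ballI isCont_Phi)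

lemma Phi_at_bot: "(Phi \<longlongrightarrow> 0) at_bot"
proof -
  interpret prob_space "centered_normal 1" by (rule prob_space_centered_normal) simp
  interpret real_distribution "centered_normal 1" by standard auto
  have "Phi = cdf (centered_normal 1)" by (simp add: fun_eq_iff Phi_def cdf_def)
  then show ?thesis using cdf_lim_at_bot by simp
qed

lemma herm3_deriv: "((\<lambda>z. gpoly 3 z * std_normal_density z) has_real_derivative herm3 z) (at z)"
proof -
  have "((\<lambda>z. (1 - z\<^sup>2) * std_normal_density z) has_real_derivative (0 - 2 * z) * std_normal_density z + - z * std_normal_density z * (1 - z\<^sup>2)) (at z)"
    by (intro DERIV_mult std_normal_deriv DERIV_diff DERIV_const) (auto intro!: derivative_eq_intros)
  then show ?thesis by (simp add: gpoly_numeral herm3_def algebra_simps power2_eq_square power3_eq_cube)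
qed

lemma herm3_at_bot: "((\<lambda>z. gpoly 3 z * std_normal_density z) \<longlongrightarrow> 0) at_bot"
  unfolding gpoly_numeral std_normal_density_def by real_asymp

text \<open>The derivative of the normal density is bounded by \<open>1\<close>, which gives a
  quadratic remainder with constant \<open>1\<close>.\<close>

lemma Phi_taylor: "\<bar>Phi b - Phi a - std_normal_density a * (b - a)\<bar> \<le> (b - a)\<^sup>2"
proof -
  have z1: "\<bar>- z * std_normal_density z\<bar> \<le> 1" for z
  proof -
    have "\<bar>z\<bar> \<le> exp (z\<^sup>2 / 2)"
    proof -
      have "0 \<le> (\<bar>z\<bar> - 1)\<^sup>2" by simp
      then have "\<bar>z\<bar> \<le> 1 + z\<^sup>2 / 2" by (simp add: power2_eq_square algebra_simps)
      also have "\<dots> \<le> exp (z\<^sup>2 / 2)" by (rule exp_ge_add_one_self)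
      finally show ?thesis .
    qed
    then have "\<bar>z\<bar> * exp (- z\<^sup>2 / 2) \<le> 1"
      by (simp add: exp_minus field_simps)
    moreover have "1 / sqrt (2 * pi) \<le> 1" (is "?k \<le> 1")
    proof -
      have "1 \<le> sqrt (2 * pi)" using pi_ge_two by (intro real_le_rsqrt) auto
      then show ?thesis by (simp add: divide_le_eq)
    qed
    ultimately have "(1 / sqrt (2 * pi)) * (\<bar>z\<bar> * exp (- z\<^sup>2 / 2)) \<le> 1"
      by (rule mult_le_one[rotated 2]) auto
    then show ?thesis by (simp add: std_normal_density_def abs_mult mult_ac)
  qed
  have lip: "\<bar>std_normal_density u - std_normal_density v\<bar> \<le> \<bar>u - v\<bar>" for u v
    using field_differentiable_bound[of UNIV std_normal_density "\<lambda>z. - z * std_normal_density z" 1 u v] std_normal_deriv z1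
    by (auto intro: has_field_derivative_at_within)
  let ?S = "{min a b..max a b}"
  have "norm ((Phi b - std_normal_density a * b) - (Phi a - std_normal_density a * a)) \<le> \<bar>b - a\<bar> * norm (b - a)"
  proof (rule field_differentiable_bound[where S="?S" and f'="\<lambda>z. std_normal_density z - std_normal_density a"])
    show "((\<lambda>z. Phi z - std_normal_density a * z) has_field_derivative std_normal_density z - std_normal_density a) (at z within ?S)" for z
      using DERIV_diff[OF Phi_deriv[of z] DERIV_cmult[OF DERIV_ident, of "std_normal_density a"]] by (auto intro: has_field_derivative_at_within)
    show "norm (std_normal_density z - std_normal_density a) \<le> \<bar>b - a\<bar>" if "z \<in> ?S" for z
      using lip[of z a] that by auto
  qed auto
  then show ?thesis by (simp add: power2_eq_square algebra_simps abs_mult_self_eq flip: abs_mult)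
qed

definition m0 :: real where "m0 = (LBINT z. \<bar>herm3 z\<bar>)"
definition m2 :: real where "m2 = (LBINT z. \<bar>herm3 z * z\<^sup>2\<bar>)"

lemma m_nonneg: "0 \<le> m0" "0 \<le> m2"
  unfolding m0_def m2_def by simp_all

text \<open>Replacing the distribution function by the Gaussian one costs
  \<open>m0 * \<Delta>\<close>. In the Gaussian integral the affine part of \<open>Phi\<close> at
  \<open>x / s'\<close> is annihilated and only the remainder of \<open>Phi_taylor\<close> survives.
  Its contribution is of order \<open>1 / (s * s'\<^sup>2)\<close> instead of
  \<open>s^-3\<close>.\<close>

lemma (in prob_space) expectation_gfd3:
  assumes T[measurable]: "T \<in> borel_measurable M" and s: "0 < s" "0 < s'"
    and \<Delta>: "\<And>t. \<bar>prob {\<omega> \<in> space M. T \<omega> \<le> t} - Phi (t / s')\<bar> \<le> \<Delta>"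
  shows "\<bar>expectation (\<lambda>\<omega>. gfd s x 3 (T \<omega>))\<bar> \<le> (m0 * \<Delta> + m2 * (s / s')\<^sup>2) / s ^ 3"
proof -
  let ?F = "\<lambda>t. prob {\<omega> \<in> space M. T \<omega> \<le> t}"
  let ?\<Psi> = "\<lambda>z. Phi ((x - s * z) / s')"
  let ?lin = "\<lambda>z. Phi (x / s') - std_normal_density (x / s') * (s / s' * z)"
  have kc: "isCont herm3 z" for z
    unfolding herm3_def[abs_def] by (intro continuous_intros isCont_std_normal)
  have e: "expectation (\<lambda>\<omega>. gpoly 3 ((x - T \<omega>) / s) * std_normal_density ((x - T \<omega>) / s)) = (LBINT z. herm3 z * ?F (x - s * z))"
    and i1: "integrable lborel (\<lambda>z. herm3 z * ?F (x - s * z))"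
    using expectation_antiderivative[OF herm3_deriv kc herm3_integrable herm3_at_bot T s(1)] by auto
  have i2: "integrable lborel (\<lambda>z. herm3 z * ?\<Psi> z)"
    by (rule Bochner_Integration.integrable_bound[OF herm3_integrable])
      (use herm3_integrable in \<open>auto simp: abs_mult Phi_bounds intro!: mult_right_le_one_le\<close>)
  have i3: "integrable lborel (\<lambda>z. herm3 z * ?lin z)" and l0: "(LBINT z. herm3 z * ?lin z) = 0"
  proof -
    have eq: "(\<lambda>z. herm3 z * ?lin z) = (\<lambda>z. Phi (x / s') * herm3 z - (std_normal_density (x / s') * (s / s')) * (herm3 z * z))"
      by (simp add: fun_eq_iff algebra_simps)
    show "integrable lborel (\<lambda>z. herm3 z * ?lin z)" unfolding eq
      by (intro Bochner_Integration.integrable_diff integrable_mult_right herm3_integrable herm3_z_integrable)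
    show "(LBINT z. herm3 z * ?lin z) = 0" unfolding eq
      using herm3_integrable herm3_z_integrable by (subst Bochner_Integration.integral_diff) (auto simp: herm3_integral)
  qed
  have A: "\<bar>(LBINT z. herm3 z * ?F (x - s * z)) - (LBINT z. herm3 z * ?\<Psi> z)\<bar> \<le> m0 * \<Delta>"
  proof -
    have i4: "integrable lborel (\<lambda>z. herm3 z * ?F (x - s * z) - herm3 z * ?\<Psi> z)"
      by (rule Bochner_Integration.integrable_diff[OF i1 i2])
    have i5: "integrable lborel (\<lambda>z. \<bar>herm3 z\<bar> * \<Delta>)"
      by (rule integrable_mult_left[OF integrable_abs[OF herm3_integrable]])
    have pt: "\<bar>herm3 z * ?F (x - s * z) - herm3 z * ?\<Psi> z\<bar> \<le> \<bar>herm3 z\<bar> * \<Delta>" for z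
    proof -
      have "\<bar>herm3 z\<bar> * \<bar>?F (x - s * z) - ?\<Psi> z\<bar> \<le> \<bar>herm3 z\<bar> * \<Delta>" by (rule mult_left_mono[OF \<Delta>]) simp
      then show ?thesis by (simp only: abs_mult[symmetric] right_diff_distrib)
    qed
    have "\<bar>(LBINT z. herm3 z * ?F (x - s * z)) - (LBINT z. herm3 z * ?\<Psi> z)\<bar> = \<bar>LBINT z. herm3 z * ?F (x - s * z) - herm3 z * ?\<Psi> z\<bar>"
      by (simp only: Bochner_Integration.integral_diff[OF i1 i2])
    also have "\<dots> \<le> (LBINT z. \<bar>herm3 z * ?F (x - s * z) - herm3 z * ?\<Psi> z\<bar>)" by (rule integral_abs_bound)
    also have "\<dots> \<le> (LBINT z. \<bar>herm3 z\<bar> * \<Delta>)"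
      by (rule integral_mono[OF integrable_abs[OF i4] i5 pt])
    finally show ?thesis by (simp add: m0_def)
  qed
  have B: "\<bar>LBINT z. herm3 z * ?\<Psi> z\<bar> \<le> m2 * (s / s')\<^sup>2"
  proof -
    have i4: "integrable lborel (\<lambda>z. herm3 z * ?\<Psi> z - herm3 z * ?lin z)"
      by (rule Bochner_Integration.integrable_diff[OF i2 i3])
    have i5: "integrable lborel (\<lambda>z. \<bar>herm3 z * z\<^sup>2\<bar> * (s / s')\<^sup>2)"
      by (rule integrable_mult_left[OF integrable_abs[OF herm3_z_integrable(2)]])
    have pt: "\<bar>herm3 z * ?\<Psi> z - herm3 z * ?lin z\<bar> \<le> \<bar>herm3 z * z\<^sup>2\<bar> * (s / s')\<^sup>2" for z
    proof -
      have d: "(x - s * z) / s' - x / s' = - (s / s' * z)" by (simp add: diff_divide_distrib)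
      have "\<bar>?\<Psi> z - ?lin z\<bar> \<le> (s / s' * z)\<^sup>2"
        using Phi_taylor[of "(x - s * z) / s'" "x / s'"] unfolding d by (simp add: algebra_simps)
      then have "\<bar>herm3 z\<bar> * \<bar>?\<Psi> z - ?lin z\<bar> \<le> \<bar>herm3 z\<bar> * (s / s' * z)\<^sup>2" by (intro mult_left_mono) auto
      also have "\<dots> = \<bar>herm3 z * z\<^sup>2\<bar> * (s / s')\<^sup>2" by (simp only: power_mult_distrib abs_mult abs_power2 mult_ac)
      finally show ?thesis by (simp only: abs_mult[symmetric] right_diff_distrib)
    qed
    have "\<bar>LBINT z. herm3 z * ?\<Psi> z\<bar> = \<bar>LBINT z. herm3 z * ?\<Psi> z - herm3 z * ?lin z\<bar>"
      unfolding Bochner_Integration.integral_diff[OF i2 i3] l0 by simp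
    also have "\<dots> \<le> (LBINT z. \<bar>herm3 z * ?\<Psi> z - herm3 z * ?lin z\<bar>)" by (rule integral_abs_bound)
    also have "\<dots> \<le> (LBINT z. \<bar>herm3 z * z\<^sup>2\<bar> * (s / s')\<^sup>2)"
      by (rule integral_mono[OF integrable_abs[OF i4] i5 pt])
    finally show ?thesis by (simp add: m2_def)
  qed
  have "expectation (\<lambda>\<omega>. gfd s x 3 (T \<omega>)) = (LBINT z. herm3 z * ?F (x - s * z)) / s ^ 3"
    unfolding e[symmetric] by (simp add: gfd_def)
  moreover have "\<bar>LBINT z. herm3 z * ?F (x - s * z)\<bar> \<le> m0 * \<Delta> + m2 * (s / s')\<^sup>2" using A B by linarith
  ultimately show ?thesis using s by (simp add: abs_divide divide_right_mono)
qed

text \<open>Splitting at distance \<open>2 L\<close> from \<open>x\<close> bounds the concentration function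
  \<open>q\<close> below by a constant plus twice \<open>exp (- 2)\<close> times its own supremum.\<close>

lemma (in prob_space) expectation_exp_concentration:
  assumes T[measurable]: "T \<in> borel_measurable M" and s: "0 < s" and L: "0 < L"
    and \<Delta>: "\<And>t. \<bar>prob {\<omega> \<in> space M. T \<omega> \<le> t} - Phi (t / s)\<bar> \<le> \<Delta>"
  shows "expectation (\<lambda>\<omega>. exp (- \<bar>x - T \<omega>\<bar> / L)) \<le> 8 * L / s + 4 * \<Delta>"
proof -
  define q where "q x = expectation (\<lambda>\<omega>. exp (- \<bar>x - T \<omega>\<bar> / L))" for x
  have int: "integrable M (\<lambda>\<omega>. exp (- \<bar>x - T \<omega>\<bar> / L))" for x
    using L by (intro integrable_const_bound[where B=1]) auto
  have q1: "q x \<le> 1" for x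
  proof -
    have "q x \<le> expectation (\<lambda>_. 1)" unfolding q_def using L int by (intro integral_mono) auto
    then show ?thesis by (simp add: prob_space)
  qed
  define A where "A = (SUP x. q x)"
  have qA: "q x \<le> A" for x unfolding A_def using q1 by (intro cSUP_upper bdd_aboveI2[where M=1]) auto
  have P: "prob {\<omega> \<in> space M. \<bar>x - T \<omega>\<bar> \<le> 2 * L} \<le> 4 * L / s + 2 * \<Delta>" for x
  proof (rule field_le_epsilon)
    fix e :: real assume e: "0 < e"
    \<comment> \<open>The slack accounts for the left endpoint: the event contains it, whereas a
      difference of distribution functions leaves it out.\<close>
    let ?a = "x - 2 * L - s * e"
    have "{\<omega> \<in> space M. \<bar>x - T \<omega>\<bar> \<le> 2 * L} \<subseteq> {\<omega> \<in> space M. T \<omega> \<le> x + 2 * L} - {\<omega> \<in> space M. T \<omega> \<le> ?a}"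
      using s e by (auto simp: abs_le_iff) (smt (verit) mult_pos_pos)
    then have "prob {\<omega> \<in> space M. \<bar>x - T \<omega>\<bar> \<le> 2 * L} \<le> prob ({\<omega> \<in> space M. T \<omega> \<le> x + 2 * L} - {\<omega> \<in> space M. T \<omega> \<le> ?a})"
      by (intro finite_measure_mono) auto
    also have "\<dots> = prob {\<omega> \<in> space M. T \<omega> \<le> x + 2 * L} - prob {\<omega> \<in> space M. T \<omega> \<le> ?a}"
    proof (rule finite_measure_Diff)
      have "?a \<le> x + 2 * L" using s e L by (smt (verit) mult_pos_pos)
      then show "{\<omega> \<in> space M. T \<omega> \<le> ?a} \<subseteq> {\<omega> \<in> space M. T \<omega> \<le> x + 2 * L}" by auto
    qed auto
    also have "\<dots> \<le> (Phi ((x + 2 * L) / s) - Phi (?a / s)) + 2 * \<Delta>"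
      using \<Delta>[of "x + 2 * L"] \<Delta>[of ?a] by linarith
    also have "Phi ((x + 2 * L) / s) - Phi (?a / s) \<le> \<bar>(x + 2 * L) / s - ?a / s\<bar>"
      using Phi_lipschitz[of "(x + 2 * L) / s" "?a / s"] by linarith
    also have "(x + 2 * L) / s - ?a / s = 4 * L / s + e" using s by (simp add: field_simps)
    also have "\<bar>4 * L / s + e\<bar> = 4 * L / s + e" using s L e by simp
    finally show "prob {\<omega> \<in> space M. \<bar>x - T \<omega>\<bar> \<le> 2 * L} \<le> 4 * L / s + 2 * \<Delta> + e" by linarith
  qed
  have e2: "exp (- 2 :: real) \<le> 1 / 4"
  proof -
    have "(2::real)\<^sup>2 \<le> (exp 1)\<^sup>2" using exp_ge_add_one_self[of "1::real"] by (intro power_mono) auto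
    also have "(exp 1 :: real)\<^sup>2 = exp 2" by (simp add: exp_double[of 1, simplified, symmetric])
    finally show ?thesis by (simp add: exp_minus field_simps)
  qed
  have "q x \<le> (4 * L / s + 2 * \<Delta>) + A / 2" for x
  proof -
    \<comment> \<open>Outside the window, moving the centre by \<open>2 * L\<close> towards
      \<open>t\<close> gains exactly the factor \<open>exp (- 2)\<close>, which is at most
      \<open>1/4\<close>.\<close>
    have pt: "exp (- \<bar>x - t\<bar> / L) \<le> indicator {t. \<bar>x - t\<bar> \<le> 2 * L} t + (1/4) * exp (- \<bar>x + 2 * L - t\<bar> / L) + (1/4) * exp (- \<bar>x - 2 * L - t\<bar> / L)" for t
    proof -
      consider "\<bar>x - t\<bar> \<le> 2 * L" | "x + 2 * L < t" | "t < x - 2 * L" by linarith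
      then show ?thesis
      proof cases
        case 1
        have "exp (- \<bar>x - t\<bar> / L) \<le> 1" using L by simp
        with 1 show ?thesis by (smt (verit) exp_gt_zero indicator_simps(1) mem_Collect_eq mult_pos_pos divide_pos_pos)
      next
        case 2
        then have "- \<bar>x - t\<bar> / L = - 2 + (- \<bar>x + 2 * L - t\<bar> / L)" using L by (simp add: field_simps)
        then have "exp (- \<bar>x - t\<bar> / L) = exp (- 2) * exp (- \<bar>x + 2 * L - t\<bar> / L)" by (simp only: exp_add)
        also have "\<dots> \<le> (1/4) * exp (- \<bar>x + 2 * L - t\<bar> / L)" using e2 by (intro mult_right_mono) auto
        moreover have "0 \<le> indicator {t. \<bar>x - t\<bar> \<le> 2 * L} t + (1/4) * exp (- \<bar>x - 2 * L - t\<bar> / L)" by simp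
        ultimately show ?thesis by linarith
      next
        case 3
        then have "- \<bar>x - t\<bar> / L = - 2 + (- \<bar>x - 2 * L - t\<bar> / L)" using L by (simp add: field_simps)
        then have "exp (- \<bar>x - t\<bar> / L) = exp (- 2) * exp (- \<bar>x - 2 * L - t\<bar> / L)" by (simp only: exp_add)
        also have "\<dots> \<le> (1/4) * exp (- \<bar>x - 2 * L - t\<bar> / L)" using e2 by (intro mult_right_mono) auto
        moreover have "0 \<le> indicator {t. \<bar>x - t\<bar> \<le> 2 * L} t + (1/4) * exp (- \<bar>x + 2 * L - t\<bar> / L)" by simp
        ultimately show ?thesis by linarith
      qed
    qed
    let ?I = "indicator {\<omega> \<in> space M. \<bar>x - T \<omega>\<bar> \<le> 2 * L} :: 'a \<Rightarrow> real"
    have ii: "integrable M ?I" by (intro integrable_const_bound[where B=1]) (auto simp: indicator_def)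
    have "q x \<le> expectation (\<lambda>\<omega>. ?I \<omega> + (1/4) * exp (- \<bar>x + 2 * L - T \<omega>\<bar> / L) + (1/4) * exp (- \<bar>x - 2 * L - T \<omega>\<bar> / L))"
      unfolding q_def
    proof (rule integral_mono)
      show "exp (- \<bar>x - T \<omega>\<bar> / L) \<le> ?I \<omega> + (1/4) * exp (- \<bar>x + 2 * L - T \<omega>\<bar> / L) + (1/4) * exp (- \<bar>x - 2 * L - T \<omega>\<bar> / L)"
        if "\<omega> \<in> space M" for \<omega>
        using pt[of "T \<omega>"] that by (simp add: indicator_def)
    qed (use int ii in auto)
    also have "\<dots> = prob {\<omega> \<in> space M. \<bar>x - T \<omega>\<bar> \<le> 2 * L} + (1/4) * q (x + 2 * L) + (1/4) * q (x - 2 * L)"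
      using int ii by (simp add: q_def)
    also have "\<dots> \<le> (4 * L / s + 2 * \<Delta>) + A / 2" using P[of x] qA[of "x + 2 * L"] qA[of "x - 2 * L"] by linarith
    finally show ?thesis .
  qed
  \<comment> \<open>The supremum \<open>A\<close> is finite because \<open>q \<le> 1\<close>, so the
    inequality can be solved for it; this doubles the constants.\<close>
  then have "A \<le> (4 * L / s + 2 * \<Delta>) + A / 2" unfolding A_def by (intro cSUP_least) auto
  with qA[of x] show ?thesis unfolding q_def by linarith
qed


section \<open>Gaussian convolution and the smoothing inequality\<close>

lemma gauss_conv:
  assumes s: "0 < s" "0 < s'"
  shows "(LBINT z. std_normal_density z * Phi ((x - s' * z) / s)) = Phi (x / sqrt (s\<^sup>2 + s'\<^sup>2))"
    and "integrable lborel (\<lambda>z. std_normal_density z * Phi ((x - s' * z) / s))"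
proof -
  let ?r = "sqrt (s\<^sup>2 + s'\<^sup>2)"
  have r: "0 < ?r" using s by (simp add: add_pos_pos)
  show i: "integrable lborel (\<lambda>z. std_normal_density z * Phi ((x - s' * z) / s))"
  proof (rule Bochner_Integration.integrable_bound)
    show "integrable lborel std_normal_density" by (rule integrable_normal_density) simp
  qed (auto simp: abs_mult Phi_bounds intro!: mult_right_le_one_le)
  have shift: "(\<integral>\<^sup>+u. ennreal (normal_density 0 s (u - y)) * indicator {..x} u \<partial>lborel) = ennreal (Phi ((x - y) / s))" for y
  proof -
    have "(\<integral>\<^sup>+u. ennreal (normal_density 0 s (u - y)) * indicator {..x} u \<partial>lborel)
      = ennreal \<bar>1\<bar> * (\<integral>\<^sup>+v. ennreal (normal_density 0 s (y + 1 * v - y)) * indicator {..x} (y + 1 * v) \<partial>lborel)"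
      by (intro nn_integral_real_affine) auto
    also have "\<dots> = (\<integral>\<^sup>+v. ennreal (normal_density 0 s v) * indicator {..x - y} v \<partial>lborel)"
      by (auto intro!: nn_integral_cong simp: indicator_def)
    also have "\<dots> = emeasure (centered_normal s) {..x - y}"
      unfolding centered_normal_def by (subst emeasure_density) auto
    also have "\<dots> = ennreal (Phi ((x - y) / s))"
      using prob_space_centered_normal[OF s(1)]
      by (simp add: measure_centered_normal[OF s(1), symmetric] finite_measure.emeasure_eq_measure prob_space.finite_measure)
    finally show ?thesis .
  qed
  have "ennreal (Phi (x / ?r)) = emeasure (centered_normal ?r) {..x}"
    using prob_space_centered_normal[OF r]
    by (simp add: measure_centered_normal[OF r, symmetric] finite_measure.emeasure_eq_measure prob_space.finite_measure)
  also have "\<dots> = (\<integral>\<^sup>+u. ennreal (normal_density 0 ?r u) * indicator {..x} u \<partial>lborel)"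
    unfolding centered_normal_def by (subst emeasure_density) auto
  also have "\<dots> = (\<integral>\<^sup>+u. (\<integral>\<^sup>+y. ennreal (normal_density 0 s (u - y) * normal_density 0 s' y) \<partial>lborel) * indicator {..x} u \<partial>lborel)"
    by (intro nn_integral_cong arg_cong2[where f="(*)"] refl fun_cong[OF conv_normal_density_zero_mean[OF s], symmetric])
  also have "\<dots> = (\<integral>\<^sup>+u. (\<integral>\<^sup>+y. ennreal (normal_density 0 s (u - y) * normal_density 0 s' y) * indicator {..x} u \<partial>lborel) \<partial>lborel)"
    by (intro nn_integral_cong nn_integral_multc[symmetric]) auto
  also have "\<dots> = (\<integral>\<^sup>+y. (\<integral>\<^sup>+u. ennreal (normal_density 0 s (u - y) * normal_density 0 s' y) * indicator {..x} u \<partial>lborel) \<partial>lborel)"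
    by (rule lborel_pair.Fubini') measurable
  also have "\<dots> = (\<integral>\<^sup>+y. ennreal (normal_density 0 s' y) * ennreal (Phi ((x - y) / s)) \<partial>lborel)"
  proof (rule nn_integral_cong)
    fix y
    have "(\<integral>\<^sup>+u. ennreal (normal_density 0 s (u - y) * normal_density 0 s' y) * indicator {..x} u \<partial>lborel)
      = (\<integral>\<^sup>+u. ennreal (normal_density 0 s' y) * (ennreal (normal_density 0 s (u - y)) * indicator {..x} u) \<partial>lborel)"
      by (intro nn_integral_cong) (simp add: ennreal_mult mult_ac)
    also have "\<dots> = ennreal (normal_density 0 s' y) * (\<integral>\<^sup>+u. ennreal (normal_density 0 s (u - y)) * indicator {..x} u \<partial>lborel)"
      by (intro nn_integral_cmult) auto
    finally show "(\<integral>\<^sup>+u. ennreal (normal_density 0 s (u - y) * normal_density 0 s' y) * indicator {..x} u \<partial>lborel)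
       = ennreal (normal_density 0 s' y) * ennreal (Phi ((x - y) / s))" by (simp only: shift)
  qed
  also have "\<dots> = ennreal \<bar>s'\<bar> * (\<integral>\<^sup>+z. ennreal (normal_density 0 s' (0 + s' * z)) * ennreal (Phi ((x - (0 + s' * z)) / s)) \<partial>lborel)"
    using s by (intro nn_integral_real_affine) auto
  also have "\<dots> = (\<integral>\<^sup>+z. ennreal (std_normal_density z * Phi ((x - s' * z) / s)) \<partial>lborel)"
  proof (subst nn_integral_cmult[symmetric], simp, intro nn_integral_cong)
    fix z :: real
    have "s' * normal_density 0 s' (s' * z) = std_normal_density z"
      using s by (simp add: normal_density_def real_sqrt_mult power_mult_distrib)
    then show "ennreal \<bar>s'\<bar> * (ennreal (normal_density 0 s' (0 + s' * z)) * ennreal (Phi ((x - (0 + s' * z)) / s)))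
      = ennreal (std_normal_density z * Phi ((x - s' * z) / s))"
      using s Phi_bounds by (simp add: ennreal_mult[symmetric] mult.assoc[symmetric])
  qed
  also have "\<dots> = ennreal (LBINT z. std_normal_density z * Phi ((x - s' * z) / s))"
    using i Phi_bounds by (intro nn_integral_eq_integral) auto
  finally show "(LBINT z. std_normal_density z * Phi ((x - s' * z) / s)) = Phi (x / ?r)"
    using Phi_bounds by (subst (asm) ennreal_inj) (auto intro!: integral_nonneg_AE)
qed

text \<open>Chebyshev's inequality in disguise: \<open>d - (A + d) / 4 * z\<^sup>2 \<le> H z\<close>
  holds for all \<open>z\<close>, and the standard normal law has second moment
  \<open>1\<close>.\<close>

lemma gauss_average_ge:
  assumes i: "integrable lborel (\<lambda>z. std_normal_density z * H z)"
    and A: "\<And>z. - A \<le> H z" and d: "\<And>z. \<bar>z\<bar> \<le> 2 \<Longrightarrow> d \<le> H z" and nn: "0 \<le> A" "0 \<le> d"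
  shows "3 / 4 * d - A / 4 \<le> (LBINT z. std_normal_density z * H z)"
proof -
  have i0: "integrable lborel (\<lambda>z. d * std_normal_density z - (A + d) / 4 * (std_normal_density z * z ^ 2))"
    by (intro Bochner_Integration.integrable_diff integrable_mult_right integrable_std_normal_moment) auto
  have e: "(LBINT z. std_normal_density z * z ^ 2) = 1"
    using integral_std_normal_moment_even[of 1] by simp
  have "3 / 4 * d - A / 4 = (LBINT z. d * std_normal_density z - (A + d) / 4 * (std_normal_density z * z ^ 2))"
    using integrable_std_normal_moment[of 2] by (subst Bochner_Integration.integral_diff) (auto simp: e field_simps)
  also have "\<dots> \<le> (LBINT z. std_normal_density z * H z)"
  proof (rule integral_mono[OF i0 i])
    fix z :: real
    have "d - (A + d) / 4 * z ^ 2 \<le> H z"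
    proof (cases "\<bar>z\<bar> \<le> 2")
      case True
      have "0 \<le> (A + d) / 4 * z ^ 2" using nn by simp
      with d[OF True] show ?thesis by linarith
    next
      case False
      then have "2 * 2 \<le> \<bar>z\<bar> * \<bar>z\<bar>" by (intro mult_mono) auto
      then have "4 \<le> z ^ 2" by (simp add: power2_eq_square)
      then have "(A + d) / 4 * 4 \<le> (A + d) / 4 * z ^ 2" using nn by (intro mult_left_mono) auto
      with A[of z] show ?thesis by simp
    qed
    then have "std_normal_density z * (d - (A + d) / 4 * z ^ 2) \<le> std_normal_density z * H z"
      by (intro mult_left_mono) auto
    then show "d * std_normal_density z - (A + d) / 4 * (std_normal_density z * z ^ 2) \<le> std_normal_density z * H z"
      by (simp add: algebra_simps)
  qed
  finally show ?thesis .
qed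

lemma smoothing_arith:
  fixes a b c D d :: real
  assumes "3 / 4 * (a - b - c) - D / 4 \<le> d" shows "a - b \<le> 4 / 3 * d + D / 3 + c"
  using assms by (simp add: field_simps)

text \<open>By monotonicity of the distribution function a deviation at \<open>x\<close> persists,
  up to the variation of \<open>Phi\<close>, on an interval of length \<open>4 * s'\<close> to one
  side. The Gaussian average centred in its middle sees the deviation with weight at least
  \<open>3/4\<close> and loses at most \<open>\<Delta>\<close> elsewhere.\<close>

lemma (in prob_space) smoothing:
  assumes T[measurable]: "T \<in> borel_measurable M" and s: "0 < s" "0 < s'"
    and \<delta>: "\<And>x. \<bar>expectation (\<lambda>\<omega>. Phi ((x - T \<omega>) / s')) - Phi (x / sqrt (s\<^sup>2 + s'\<^sup>2))\<bar> \<le> \<delta>"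
  shows "\<bar>prob {\<omega> \<in> space M. T \<omega> \<le> x} - Phi (x / s)\<bar> \<le> 2 * \<delta> + 6 * s' / s"
proof -
  define F where "F t = prob {\<omega> \<in> space M. T \<omega> \<le> t}" for t
  define \<Delta> where "\<Delta> = (SUP t. \<bar>F t - Phi (t / s)\<bar>)"
  have F01: "0 \<le> F t" "F t \<le> 1" for t unfolding F_def by auto
  have Fmono: "F a \<le> F b" if "a \<le> b" for a b
    unfolding F_def using that by (intro finite_measure_mono) auto
  have b1: "\<bar>F t - Phi (t / s)\<bar> \<le> 1" for t using F01[of t] Phi_bounds[of "t / s"] by (auto simp: abs_le_iff)
  have le\<Delta>: "\<bar>F t - Phi (t / s)\<bar> \<le> \<Delta>" for t
    unfolding \<Delta>_def using b1 by (intro cSUP_upper bdd_aboveI2[where M=1]) auto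
  have \<Delta>0: "0 \<le> \<Delta>" using le\<Delta>[of 0] by linarith
  have iF: "integrable lborel (\<lambda>z. std_normal_density z * F (y - s' * z))"
    and eF: "expectation (\<lambda>\<omega>. Phi ((y - T \<omega>) / s')) = (LBINT z. std_normal_density z * F (y - s' * z))" for y
    unfolding F_def using expectation_antiderivative[OF Phi_deriv isCont_std_normal _ Phi_at_bot T s(2)] by auto
  have int: "integrable lborel (\<lambda>z. std_normal_density z * (F (y - s' * z) - Phi ((y - s' * z) / s)))" for y
    unfolding right_diff_distrib by (rule Bochner_Integration.integrable_diff[OF iF gauss_conv(2)[OF s]])
  have D: "\<bar>LBINT z. std_normal_density z * (F (y - s' * z) - Phi ((y - s' * z) / s))\<bar> \<le> \<delta>" for y
    unfolding right_diff_distrib Bochner_Integration.integral_diff[OF iF gauss_conv(2)[OF s]] gauss_conv(1)[OF s] eF[symmetric]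
    by (rule \<delta>)
  have \<delta>0: "0 \<le> \<delta>" using D[of 0] by linarith
  \<comment> \<open>\<open>Phi\<close> is \<open>1\<close>-Lipschitz, so this bounds its variation
    over the interval.\<close>
  let ?c = "4 * s' / s"
  have c0: "0 < ?c" using s by simp
  have PhiL: "Phi (b / s) - Phi (a / s) \<le> ?c" if "a \<le> b" "b - a \<le> 4 * s'" for a b
  proof -
    have "Phi (b / s) - Phi (a / s) \<le> \<bar>b / s - a / s\<bar>" using Phi_lipschitz[of "b / s" "a / s"] by linarith
    also have "\<dots> = (b - a) / s" using that s by (simp add: diff_divide_distrib[symmetric])
    also have "\<dots> \<le> ?c" using that s by (intro divide_right_mono) auto
    finally show ?thesis .
  qed
  have up: "F x - Phi (x / s) \<le> 4 / 3 * \<delta> + \<Delta> / 3 + ?c" for x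
  proof (cases "F x - Phi (x / s) \<le> ?c")
    case True then show ?thesis using \<Delta>0 \<delta>0 by linarith
  next
    case False
    let ?y = "x + 2 * s'"
    have "3 / 4 * (F x - Phi (x / s) - ?c) - \<Delta> / 4 \<le> (LBINT z. std_normal_density z * (F (?y - s' * z) - Phi ((?y - s' * z) / s)))"
    proof (rule gauss_average_ge[OF int])
      fix z show "- \<Delta> \<le> F (?y - s' * z) - Phi ((?y - s' * z) / s)" using le\<Delta>[of "?y - s' * z"] by linarith
      assume z: "\<bar>z\<bar> \<le> 2"
      have "s' * z \<le> s' * 2" "s' * (-2) \<le> s' * z" using z s mult_left_mono[of z 2 s'] mult_left_mono[of "- 2" z s'] by auto
      then have "x \<le> ?y - s' * z" "?y - s' * z - x \<le> 4 * s'" by auto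
      then show "F x - Phi (x / s) - ?c \<le> F (?y - s' * z) - Phi ((?y - s' * z) / s)"
        using Fmono[of x "?y - s' * z"] PhiL[of x "?y - s' * z"] by linarith
    qed (use False \<Delta>0 in auto)
    from order_trans[OF this abs_le_D1[OF D]] show ?thesis by (rule smoothing_arith)
  qed
  have lo: "Phi (x / s) - F x \<le> 4 / 3 * \<delta> + \<Delta> / 3 + ?c" for x
  proof (cases "Phi (x / s) - F x \<le> ?c")
    case True then show ?thesis using \<Delta>0 \<delta>0 by linarith
  next
    case False
    let ?y = "x - 2 * s'"
    have i': "integrable lborel (\<lambda>z. std_normal_density z * (Phi ((?y - s' * z) / s) - F (?y - s' * z)))"
      unfolding right_diff_distrib by (rule Bochner_Integration.integrable_diff[OF gauss_conv(2)[OF s] iF])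
    have "3 / 4 * (Phi (x / s) - F x - ?c) - \<Delta> / 4 \<le> (LBINT z. std_normal_density z * (Phi ((?y - s' * z) / s) - F (?y - s' * z)))"
    proof (rule gauss_average_ge[OF i'])
      fix z show "- \<Delta> \<le> Phi ((?y - s' * z) / s) - F (?y - s' * z)" using le\<Delta>[of "?y - s' * z"] by linarith
      assume z: "\<bar>z\<bar> \<le> 2"
      have "s' * z \<le> s' * 2" "s' * (-2) \<le> s' * z" using z s mult_left_mono[of z 2 s'] mult_left_mono[of "- 2" z s'] by auto
      then have "?y - s' * z \<le> x" "x - (?y - s' * z) \<le> 4 * s'" by auto
      then show "Phi (x / s) - F x - ?c \<le> Phi ((?y - s' * z) / s) - F (?y - s' * z)"
        using Fmono[of "?y - s' * z" x] PhiL[of "?y - s' * z" x] by linarith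
    qed (use False \<Delta>0 in auto)
    also have "\<dots> = - (LBINT z. std_normal_density z * (F (?y - s' * z) - Phi ((?y - s' * z) / s)))"
      unfolding Bochner_Integration.integral_minus[symmetric] by (intro Bochner_Integration.integral_cong) (auto simp: algebra_simps)
    finally show ?thesis using abs_le_D2[OF D[of ?y]] by (intro smoothing_arith) (rule order_trans)
  qed
  \<comment> \<open>Taking suprema gives an inequality for \<open>\<Delta>\<close> itself, which is
    finite by \<open>b1\<close>. Solving it turns \<open>4 / 3\<close> into \<open>2\<close> and the
    \<open>4\<close> of \<open>?c\<close> into \<open>6\<close>.\<close>
  have "\<Delta> \<le> 4 / 3 * \<delta> + \<Delta> / 3 + ?c"
    unfolding \<Delta>_def[of] using up lo by (intro cSUP_least) (auto simp: abs_le_iff \<Delta>_def)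
  then have "\<Delta> \<le> 2 * \<delta> + 6 * s' / s" by simp
  with le\<Delta>[of x] show ?thesis unfolding F_def by linarith
qed

section \<open>Summation over the scales\<close>

lemma sum_inverse_squares_le:
  assumes "1 \<le> a" shows "(\<Sum>v=a..n. 1 / (real v)\<^sup>2) \<le> 2 / real a"
proof (cases "a \<le> n")
  case True
  \<comment> \<open>The additional \<open>- 1 / real n\<close> makes the induction
    telescope.\<close>
  then have "(\<Sum>v=a..n. 1 / (real v)\<^sup>2) \<le> 2 / real a - 1 / real n"
  proof (induction n rule: dec_induct)
    case base
    then show ?case using assms by (simp add: power2_eq_square field_simps)
  next
    case (step n)
    have n: "0 < real n" using assms step by simp
    have "1 / (real (Suc n))\<^sup>2 \<le> 1 / (real n * real (Suc n))"
      using n by (intro divide_left_mono) (auto simp: power2_eq_square)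
    also have "\<dots> = 1 / real n - 1 / real (Suc n)" using n by (simp add: field_simps)
    finally show ?case using step by (simp add: sum.nat_ivl_Suc')
  qed
  then show ?thesis by (rule order_trans) simp
qed (use assms in simp)

text \<open>The value \<open>v\<close> is taken only by the integers from \<open>v\<^sup>2\<close>
  to \<open>(v + 1)\<^sup>2 - 1\<close>, of which there are
  \<open>2 * v + 1 \<le> 3 * v\<close>.\<close>

lemma sum_floor_sqrt_le:
  fixes a :: "nat \<Rightarrow> real"
  assumes a: "\<And>v. 0 \<le> a v"
  shows "(\<Sum>N=1..n. a (floor_sqrt N)) \<le> (\<Sum>v=1..n. 3 * (real v * a v))"
proof -
  have "(\<Sum>N=1..n. a (floor_sqrt N)) = (\<Sum>v\<in>{1..n}. \<Sum>N\<in>{N \<in> {1..n}. floor_sqrt N = v}. a (floor_sqrt N))"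
  proof (rule sum.group[symmetric])
    show "floor_sqrt ` {1..n} \<subseteq> {1..n}"
    proof (clarsimp, intro conjI)
      fix N assume "Suc 0 \<le> N" "N \<le> n"
      then show "Suc 0 \<le> floor_sqrt N" "floor_sqrt N \<le> n"
        using floor_sqrt_le[of N] floor_sqrt_greater_zero_iff[of N] by linarith+
    qed
  qed auto
  also have "\<dots> \<le> (\<Sum>v\<in>{1..n}. 3 * (real v * a v))"
  proof (rule sum_mono)
    fix v assume v: "v \<in> {1..n}"
    have sub: "{N \<in> {1..n}. floor_sqrt N = v} \<subseteq> {v\<^sup>2..<(Suc v)\<^sup>2}"
      using floor_sqrt_power2_le Suc_floor_sqrt_power2_gt by auto
    have "card {N \<in> {1..n}. floor_sqrt N = v} \<le> card {v\<^sup>2..<(Suc v)\<^sup>2}"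
      by (intro card_mono sub) simp
    also have "\<dots> = 2 * v + 1" by (simp add: power2_eq_square)
    also have "\<dots> \<le> 3 * v" using v by simp
    finally have c: "real (card {N \<in> {1..n}. floor_sqrt N = v}) \<le> 3 * real v" by linarith
    have "(\<Sum>N\<in>{N \<in> {1..n}. floor_sqrt N = v}. a (floor_sqrt N)) = real (card {N \<in> {1..n}. floor_sqrt N = v}) * a v"
      by simp
    also have "\<dots> \<le> (3 * real v) * a v" using c a by (intro mult_right_mono)
    finally show "(\<Sum>N\<in>{N \<in> {1..n}. floor_sqrt N = v}. a (floor_sqrt N)) \<le> 3 * (real v * a v)" by simp
  qed
  finally show ?thesis .
qed

text \<open>Here \<open>\<theta> p\<close> stands for the maximum of \<open>\<phi> p l\<close> over \<open>l \<le> p / (r + 1)\<close>.\<close>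

locale theta_sum =
  fixes \<theta> :: "nat \<Rightarrow> real" and Th :: real and R :: nat
  assumes theta_nn: "\<And>p. 0 \<le> \<theta> p" and Th_bound: "\<And>n. (\<Sum>g=1..n. real g * \<theta> g) \<le> Th"
    and R_ge1: "1 \<le> R"
begin

definition tl :: "nat \<Rightarrow> real" where "tl k = (\<Sum>i. \<theta> (i + k))"

lemma Th_nn: "0 \<le> Th" using Th_bound[of 0] by simp

lemma summable_theta: "summable (\<lambda>i. \<theta> (i + k))"
proof -
  have "summable (\<lambda>i. \<theta> (Suc i))"
  proof (rule summableI_nonneg_bounded)
    fix n
    have "(\<Sum>i<n. \<theta> (Suc i)) \<le> (\<Sum>i<n. real (Suc i) * \<theta> (Suc i))"
    proof (rule sum_mono)
      fix i show "\<theta> (Suc i) \<le> real (Suc i) * \<theta> (Suc i)"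
        using theta_nn[of "Suc i"] mult_right_mono[of 1 "real (Suc i)" "\<theta> (Suc i)"] by simp
    qed
    also have "\<dots> = (\<Sum>g=1..n. real g * \<theta> g)"
      by (simp add: sum.atLeast1_atMost_eq)
    finally show "(\<Sum>i<n. \<theta> (Suc i)) \<le> Th" using Th_bound[of n] by linarith
  qed (use theta_nn in auto)
  then have "summable \<theta>" using summable_Suc_iff by blast
  then show ?thesis by (rule summable_ignore_initial_segment)
qed

lemma tl_nn: "0 \<le> tl k"
  unfolding tl_def using theta_nn by (intro suminf_nonneg summable_theta) auto

text \<open>\<open>\<theta> p\<close> is counted in \<open>tl v\<close> exactly for
  \<open>v \<le> p\<close>, so the sum of the tails is a first moment. The series are cut at
  \<open>m\<close> first, which keeps the exchange of sums finite.\<close>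

lemma tl_sum: "(\<Sum>v=1..n. tl v) \<le> Th"
proof (rule LIMSEQ_le_const2)
  show "(\<lambda>m. \<Sum>v=1..n. \<Sum>i<m. \<theta> (i + v)) \<longlonglongrightarrow> (\<Sum>v=1..n. tl v)"
    unfolding tl_def by (intro tendsto_sum summable_LIMSEQ summable_theta)
  have "(\<Sum>v=1..n. \<Sum>i<m. \<theta> (i + v)) \<le> Th" for m
  proof -
    have "(\<Sum>v=1..n. \<Sum>i<m. \<theta> (i + v)) \<le> (\<Sum>v=1..n. \<Sum>p=1..m+n. if v \<le> p then \<theta> p else 0)"
    proof (rule sum_mono)
      fix v assume v: "v \<in> {1..n}"
      have "(\<Sum>i<m. \<theta> (i + v)) = (\<Sum>p\<in>(\<lambda>i. i + v) ` {..<m}. \<theta> p)"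
        by (subst sum.reindex) auto
      also have "\<dots> \<le> (\<Sum>p\<in>{1..m+n} \<inter> {p. v \<le> p}. \<theta> p)"
        using v theta_nn by (intro sum_mono2) auto
      also have "\<dots> = (\<Sum>p=1..m+n. if v \<le> p then \<theta> p else 0)"
        by (subst sum.inter_restrict) auto
      finally show "(\<Sum>i<m. \<theta> (i + v)) \<le> (\<Sum>p=1..m+n. if v \<le> p then \<theta> p else 0)" .
    qed
    also have "\<dots> = (\<Sum>p=1..m+n. \<Sum>v=1..n. if v \<le> p then \<theta> p else 0)" by (rule sum.swap)
    also have "\<dots> \<le> (\<Sum>p=1..m+n. real p * \<theta> p)"
    proof (rule sum_mono)
      fix p
      have "(\<Sum>v=1..n. if v \<le> p then \<theta> p else 0) = (\<Sum>v\<in>{1..n} \<inter> {v. v \<le> p}. \<theta> p)"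
        by (subst sum.inter_restrict) auto
      also have "\<dots> \<le> (\<Sum>v\<in>{1..p}. \<theta> p)" using theta_nn by (intro sum_mono2) auto
      finally show "(\<Sum>v=1..n. if v \<le> p then \<theta> p else 0) \<le> real p * \<theta> p" by simp
    qed
    finally show ?thesis using Th_bound[of "m + n"] by linarith
  qed
  then show "\<exists>N. \<forall>m\<ge>N. (\<Sum>v=1..n. \<Sum>i<m. \<theta> (i + v)) \<le> Th" by blast
qed

text \<open>The indices \<open>d * v + 1\<close> are distinct and at least \<open>v\<close>, so the
  sum is dominated by a part of the first moment.\<close>

lemma sum_theta_affine:
  assumes d: "1 \<le> d" shows "(\<Sum>v=1..n. real v * \<theta> (d * v + 1)) \<le> Th"
proof -
  have "(\<Sum>v=1..n. real v * \<theta> (d * v + 1)) \<le> (\<Sum>v=1..n. real (d * v + 1) * \<theta> (d * v + 1))"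
  proof (rule sum_mono, rule mult_right_mono)
    fix v have "1 * v \<le> d * v" by (rule mult_le_mono1[OF d])
    then show "real v \<le> real (d * v + 1)" by linarith
  qed (rule theta_nn)
  also have "\<dots> = (\<Sum>g\<in>(\<lambda>v. d * v + 1) ` {1..n}. real g * \<theta> g)"
    using d by (subst sum.reindex) (auto simp: inj_on_def)
  also have "\<dots> \<le> (\<Sum>g=1..d*n+1. real g * \<theta> g)"
    using theta_nn by (intro sum_mono2) auto
  also have "\<dots> \<le> Th" by (rule Th_bound)
  finally show ?thesis .
qed

lemma series_tail_bound:
  fixes c :: "nat \<Rightarrow> real"
  assumes c: "\<And>p. \<bar>c p\<bar> \<le> K * \<theta> p"
  shows "\<bar>(\<Sum>i<n. c (i + 1)) - (\<Sum>p. c (p + 1))\<bar> \<le> K * tl (n + 1)"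
proof -
  have sa: "summable (\<lambda>i. \<bar>c (i + j)\<bar>)" for j
    by (rule summable_comparison_test'[of "\<lambda>i. K * \<theta> (i + j)" 0])
      (use c summable_theta in \<open>auto intro: summable_mult\<close>)
  have "(\<Sum>p. c (p + 1)) = (\<Sum>i. c (i + (n + 1))) + (\<Sum>i<n. c (i + 1))"
    using suminf_split_initial_segment[OF summable_rabs_cancel[OF sa[of 1]], of n] by simp
  then have "\<bar>(\<Sum>i<n. c (i + 1)) - (\<Sum>p. c (p + 1))\<bar> = \<bar>\<Sum>i. c (i + (n + 1))\<bar>" by linarith
  also have "\<dots> \<le> (\<Sum>i. \<bar>c (i + (n + 1))\<bar>)" by (rule summable_rabs[OF sa])
  also have "\<dots> \<le> (\<Sum>i. K * \<theta> (i + (n + 1)))"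
    using c by (intro suminf_le sa summable_mult summable_theta)
  also have "\<dots> = K * tl (n + 1)" unfolding tl_def by (rule suminf_mult[OF summable_theta])
  finally show ?thesis .
qed

definition cR :: nat where "cR = R * (R + 1)"
definition Wf :: "nat \<Rightarrow> real" where "Wf v = (\<Sum>g=1..cR * v. (real g)\<^sup>2 * \<theta> g)"
definition Tf :: "nat \<Rightarrow> real" where "Tf v = \<theta> (v + 1) + \<theta> (R * v + 1) + \<theta> (cR * v + 1)"
text \<open>The error of the step at scale \<open>v\<close>, relative to \<open>Q / v\<close>. About \<open>2 * v\<close> integers \<open>N\<close> have
  \<open>floor_sqrt N = v\<close>, so summing the steps uses \<open>v * eta v\<close>.\<close>

definition eta :: "nat \<Rightarrow> real" where "eta v = (1 + Wf v) / real v ^ 3 + Tf v + tl (v + 1) / real v"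
definition Heta :: real where "Heta = 3 * (2 + 2 * cR * Th + 4 * Th)"

lemma cR_ge1: "1 \<le> cR" using R_ge1 by (simp add: cR_def)

lemma Wf_nn: "0 \<le> Wf v" unfolding Wf_def using theta_nn by (intro sum_nonneg) auto
lemma Tf_nn: "0 \<le> Tf v" unfolding Tf_def using theta_nn by (intro add_nonneg_nonneg)
lemma eta_nn: "0 \<le> eta v" unfolding eta_def using Wf_nn Tf_nn tl_nn by (intro add_nonneg_nonneg divide_nonneg_nonneg) auto
lemma Heta_nn: "0 \<le> Heta" unfolding Heta_def using Th_nn by simp

text \<open>The index \<open>g\<close> contributes only at scales \<open>v \<ge> g / cR\<close>,
  where the sum of \<open>1 / v\<^sup>2\<close> is of order \<open>cR / g\<close>. This lowers the
  truncated second moments to the first moment.\<close>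

lemma sum_Wf: "(\<Sum>v=1..n. Wf v / (real v)\<^sup>2) \<le> 2 * cR * Th"
proof -
  have "(\<Sum>v=1..n. Wf v / (real v)\<^sup>2) = (\<Sum>v=1..n. \<Sum>g=1..cR * n. if g \<le> cR * v then (real g)\<^sup>2 * \<theta> g * (1 / (real v)\<^sup>2) else 0)"
  proof (rule sum.cong[OF refl])
    fix v assume v: "v \<in> {1..n}"
    then have "cR * v \<le> cR * n" by simp
    then have "{1..cR * v} = {1..cR * n} \<inter> {g. g \<le> cR * v}" using order_trans[of _ "cR * v" "cR * n"] by auto
    then have "Wf v = (\<Sum>g=1..cR * n. if g \<le> cR * v then (real g)\<^sup>2 * \<theta> g else 0)"
      unfolding Wf_def by (simp only:) (subst sum.inter_restrict, auto)
    then show "Wf v / (real v)\<^sup>2 = (\<Sum>g=1..cR * n. if g \<le> cR * v then (real g)\<^sup>2 * \<theta> g * (1 / (real v)\<^sup>2) else 0)"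
      by (simp only: sum_divide_distrib) (intro sum.cong; simp)
  qed
  also have "\<dots> = (\<Sum>g=1..cR * n. \<Sum>v=1..n. if g \<le> cR * v then (real g)\<^sup>2 * \<theta> g * (1 / (real v)\<^sup>2) else 0)"
    by (rule sum.swap)
  also have "\<dots> \<le> (\<Sum>g=1..cR * n. 2 * cR * (real g * \<theta> g))"
  proof (rule sum_mono)
    fix g assume g: "g \<in> {1..cR * n}"
    define A where "A = {1..n} \<inter> {v. g \<le> cR * v}"
    have s: "(\<Sum>v=1..n. if g \<le> cR * v then (real g)\<^sup>2 * \<theta> g * (1 / (real v)\<^sup>2) else 0) = (\<Sum>v\<in>A. (real g)\<^sup>2 * \<theta> g * (1 / (real v)\<^sup>2))"
      unfolding A_def by (subst sum.inter_restrict) auto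
    show "(\<Sum>v=1..n. if g \<le> cR * v then (real g)\<^sup>2 * \<theta> g * (1 / (real v)\<^sup>2) else 0) \<le> 2 * cR * (real g * \<theta> g)"
    proof (cases "A = {}")
      case True then show ?thesis unfolding s using theta_nn by simp
    next
      case False
      have fin: "finite A" by (simp add: A_def)
      define a where "a = Min A"
      have aA: "a \<in> A" unfolding a_def using fin False by (rule Min_in)
      then have a: "1 \<le> a" "g \<le> cR * a" by (auto simp: A_def)
      have "A \<subseteq> {a..n}" using fin by (auto simp: a_def A_def)
      then have "(\<Sum>v\<in>A. 1 / (real v)\<^sup>2) \<le> (\<Sum>v=a..n. 1 / (real v)\<^sup>2)" by (intro sum_mono2) auto
      also have "\<dots> \<le> 2 / real a" by (rule sum_inverse_squares_le[OF a(1)])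
      also have "\<dots> \<le> 2 * cR / real g"
      proof -
        have "real g \<le> real cR * real a" using a(2) by (metis of_nat_le_iff of_nat_mult)
        then show ?thesis using a(1) g by (simp add: field_simps)
      qed
      finally have "(real g)\<^sup>2 * \<theta> g * (\<Sum>v\<in>A. 1 / (real v)\<^sup>2) \<le> (real g)\<^sup>2 * \<theta> g * (2 * cR / real g)"
        using theta_nn by (intro mult_left_mono) auto
      also have "\<dots> = 2 * cR * (real g * \<theta> g)" using g by (simp add: power2_eq_square)
      finally show ?thesis unfolding s by (simp add: sum_distrib_left)
    qed
  qed
  also have "\<dots> = 2 * cR * (\<Sum>g=1..cR * n. real g * \<theta> g)" by (simp add: sum_distrib_left)
  also have "\<dots> \<le> 2 * cR * Th" by (intro mult_left_mono Th_bound) simp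
  finally show ?thesis .
qed

text \<open>The multiplicity \<open>3 * v\<close> of a scale turns the summands of
  \<open>eta\<close> into \<open>1 / v\<^sup>2\<close>, \<open>Wf v / v\<^sup>2\<close>,
  \<open>v\<close> times values of \<open>\<theta>\<close>, and \<open>tl\<close>; apart from the
  first series, each is controlled by \<open>Th\<close>.\<close>

lemma sum_eta: "(\<Sum>N=1..n. eta (floor_sqrt N)) \<le> Heta"
proof -
  have "(\<Sum>N=1..n. eta (floor_sqrt N)) \<le> (\<Sum>v=1..n. 3 * (real v * eta v))"
    by (rule sum_floor_sqrt_le[OF eta_nn])
  also have "\<dots> = 3 * (\<Sum>v=1..n. 1 / (real v)\<^sup>2 + Wf v / (real v)\<^sup>2 + (real v * \<theta> (1 * v + 1) + real v * \<theta> (R * v + 1) + real v * \<theta> (cR * v + 1)) + tl (v + 1))"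
    unfolding sum_distrib_left
  proof (rule sum.cong[OF refl])
    fix v assume "v \<in> {1..n}"
    then have v: "0 < real v" by simp
    have "real v * eta v = (1 + Wf v) / (real v)\<^sup>2 + real v * Tf v + tl (v + 1)"
    proof -
      have "real v * (w / real v ^ 3) = w / (real v)\<^sup>2" for w
        using v by (simp add: power2_eq_square power3_eq_cube)
      then show ?thesis unfolding eta_def distrib_left using v by simp
    qed
    then show "3 * (real v * eta v) = 3 * (1 / (real v)\<^sup>2 + Wf v / (real v)\<^sup>2 + (real v * \<theta> (1 * v + 1) + real v * \<theta> (R * v + 1) + real v * \<theta> (cR * v + 1)) + tl (v + 1))"
      by (simp add: Tf_def distrib_left add_divide_distrib)
  qed
  also have "\<dots> \<le> 3 * (2 + 2 * cR * Th + (Th + Th + Th) + Th)"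
  proof -
    have "(\<Sum>v=1..n. tl (v + 1)) = (\<Sum>v\<in>{2..n+1}. tl v)"
      by (rule sum.reindex_bij_witness[of _ "\<lambda>v. v - 1" "\<lambda>v. v + 1"]) auto
    also have "\<dots> \<le> (\<Sum>v=1..n+1. tl v)" using tl_nn by (intro sum_mono2) auto
    finally have "(\<Sum>v=1..n. tl (v + 1)) \<le> Th" using tl_sum[of "n + 1"] by linarith
    moreover have "(\<Sum>v=1..n. 1 / (real v)\<^sup>2) \<le> 2" using sum_inverse_squares_le[of 1 n] by simp
    ultimately show ?thesis
      unfolding sum.distrib
      using sum_Wf[of n] sum_theta_affine[of 1 n] sum_theta_affine[OF R_ge1, of n] sum_theta_affine[OF cR_ge1, of n]
      by (intro mult_left_mono add_mono) auto
  qed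
  finally show ?thesis by (simp add: Heta_def)
qed

end

section \<open>Comparison of one step with the heat flow\<close>

locale berry_esseen_setting = weak_dep \<nu> X C M \<phi> + theta_sum \<theta> Th R
  for \<nu> :: "'a measure" and X C M \<phi> \<theta> Th R +
  fixes \<sigma> :: real
  assumes theta_le: "\<And>p l. R * l \<le> p \<Longrightarrow> \<phi> p l \<le> \<theta> p"
    and sigma_pos: "0 < \<sigma>"
    and sigma_sq: "\<sigma>\<^sup>2 = expectation (\<lambda>\<omega>. X 0 \<omega> * X 0 \<omega>) + 2 * (\<Sum>p. expectation (\<lambda>\<omega>. X 0 \<omega> * X (p + 1) \<omega>))"
begin

text \<open>\<open>K3\<close> depends only on \<open>C\<close>, \<open>M\<close>,
  \<open>gc \<sigma>\<close>, \<open>R\<close> and \<open>Th\<close>, hence is uniform in the time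
  \<open>N\<close>, the index \<open>k\<close> and the point \<open>x\<close>. The other summands
  come from \<open>heat_step\<close> and from replacing \<open>s2\<close> by
  \<open>\<sigma>\<^sup>2\<close>.\<close>

definition K4 :: real where
  "K4 = dep_test.K3 C M (gc \<sigma>) R Th + \<sigma> ^ 4 * gc \<sigma> + 3 * C * M\<^sup>2 * gc \<sigma>"

definition KZ :: real where "KZ = 3 * C * M\<^sup>2 * ((R + 3) * Th) + M ^ 3"

definition QQ :: "real \<Rightarrow> nat \<Rightarrow> nat \<Rightarrow> real" where
  "QQ x L k = expectation (\<lambda>\<omega>. exp (- \<bar>x - S X (k - 1) \<omega>\<bar> / real L))"

lemma floor_sqrt_bounds:
  assumes "1 \<le> N"
  shows "1 \<le> floor_sqrt N" "real (floor_sqrt N) \<le> sqrt N" "sqrt (real N + 1) \<le> 2 * real (floor_sqrt N)" "sqrt N \<le> 2 * real (floor_sqrt N)"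
proof -
  show 1: "1 \<le> floor_sqrt N" using assms floor_sqrt_greater_zero_iff[of N] by linarith
  have "real ((floor_sqrt N)\<^sup>2) \<le> real N" using floor_sqrt_power2_le[of N] of_nat_le_iff by blast
  then have "(real (floor_sqrt N))\<^sup>2 \<le> real N" by simp
  then show "real (floor_sqrt N) \<le> sqrt N" by (rule real_le_rsqrt)
  have "N + 1 \<le> (Suc (floor_sqrt N))\<^sup>2" using Suc_floor_sqrt_power2_gt[of N] by linarith
  also have "\<dots> \<le> (2 * floor_sqrt N)\<^sup>2" using 1 by (intro power_mono) auto
  finally have "real (N + 1) \<le> real ((2 * floor_sqrt N)\<^sup>2)" using of_nat_le_iff by blast
  then have "real N + 1 \<le> (2 * real (floor_sqrt N))\<^sup>2" by simp
  then show "sqrt (real N + 1) \<le> 2 * real (floor_sqrt N)" by (intro real_le_lsqrt) auto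
  moreover have "sqrt N \<le> sqrt (real N + 1)" by simp
  ultimately show "sqrt N \<le> 2 * real (floor_sqrt N)" by linarith
qed

lemma dep_test_instance:
  assumes "1 \<le> N" "1 \<le> k"
  shows "dep_test \<nu> X C M \<phi> (gfd (\<sigma> * sqrt N) x) (\<lambda>y. exp (- \<bar>x - y\<bar> / real (floor_sqrt N))) (gc \<sigma>) (floor_sqrt N) R k \<theta> Th"
proof (intro dep_test.intro dep_test_axioms.intro)
  show "weak_dep \<nu> X C M \<phi>" by (rule weak_dep_axioms)
  note b = floor_sqrt_bounds[OF assms(1)]
  show "test_fun (gfd (\<sigma> * sqrt N) x) (\<lambda>y. exp (- \<bar>x - y\<bar> / real (floor_sqrt N))) (gc \<sigma>) M (floor_sqrt N)"
    using b sigma_pos M_ge1 by (intro gfd_test_fun) auto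
qed (use assms R_ge1 theta_le Th_bound in auto)

text \<open>Of the two truncations in \<open>s2\<close> the earlier one decides: the first omitted
  lag is \<open>floor_sqrt N + 1\<close> or \<open>k\<close>, and the error is the tail of
  \<open>\<theta>\<close> from there.\<close>

lemma s2_close:
  assumes "1 \<le> N" "1 \<le> k"
  shows "\<bar>dep_test.s2 \<nu> X (floor_sqrt N) k - \<sigma>\<^sup>2\<bar> \<le> 2 * (3 * C * M\<^sup>2 * (tl (floor_sqrt N + 1) + tl k))"
proof -
  \<comment> \<open>\<open>s2\<close> does not involve the test function, so any point serves; here
    it is \<open>0\<close>.\<close>
  interpret D: dep_test \<nu> X C M \<phi> "gfd (\<sigma> * sqrt N) 0" "\<lambda>y. exp (- \<bar>0 - y\<bar> / real (floor_sqrt N))" "gc \<sigma>" "floor_sqrt N" R k \<theta> Th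
    using dep_test_instance[OF assms] .
  let ?L = "floor_sqrt N" and ?c = "\<lambda>p. expectation (\<lambda>\<omega>. X 0 \<omega> * X p \<omega>)"
  define n where "n = min ?L (k - 1)"
  have "(\<Sum>p=1..?L. if p < k then ?c p else 0) = (\<Sum>p\<in>{1..?L} \<inter> {p. p < k}. ?c p)"
    by (subst sum.inter_restrict) auto
  also have "{1..?L} \<inter> {p. p < k} = {1..n}" unfolding n_def using assms by auto
  also have "(\<Sum>p=1..n. ?c p) = (\<Sum>i<n. ?c (i + 1))" by (simp add: sum.atLeast1_atMost_eq)
  finally have s2: "D.s2 = ?c 0 + 2 * (\<Sum>i<n. ?c (i + 1))" unfolding D.s2_def D.cp_def by simp
  have "\<bar>?c p\<bar> \<le> 3 * C * M\<^sup>2 * \<theta> p" for p using D.cp_bound unfolding D.cp_def .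
  then have "\<bar>(\<Sum>i<n. ?c (i + 1)) - (\<Sum>p. ?c (p + 1))\<bar> \<le> 3 * C * M\<^sup>2 * tl (n + 1)"
    by (rule series_tail_bound)
  moreover have "D.s2 - \<sigma>\<^sup>2 = 2 * ((\<Sum>i<n. ?c (i + 1)) - (\<Sum>p. ?c (p + 1)))"
    unfolding s2 sigma_sq by (simp add: algebra_simps)
  moreover have "tl (n + 1) \<le> tl (?L + 1) + tl k"
  proof -
    have "n + 1 = ?L + 1 \<or> n + 1 = k" unfolding n_def using assms by auto
    then show ?thesis using tl_nn[of k] tl_nn[of "?L + 1"] by auto
  qed
  then have "3 * C * M\<^sup>2 * tl (n + 1) \<le> 3 * C * M\<^sup>2 * (tl (?L + 1) + tl k)"
    using C_ge1 by (intro mult_left_mono) auto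
  ultimately show ?thesis by (simp add: abs_mult)
qed

text \<open>Both expectations are compared with that of
  \<open>f = gfd (\<sigma> * sqrt N) x 0\<close> at \<open>S_{k-1}\<close>. The summand adds
  \<open>s2 / 2\<close> times the expectation of \<open>f''\<close>, the unit of time adds
  \<open>\<sigma>\<^sup>2 / 2\<close> times it, and the two nearly cancel.\<close>

lemma lindeberg_step:
  assumes N: "1 \<le> N" and k: "1 \<le> k"
  defines "L \<equiv> floor_sqrt N"
  shows "\<bar>expectation (\<lambda>\<omega>. gfd (\<sigma> * sqrt N) x 0 (S X k \<omega>)) - expectation (\<lambda>\<omega>. gfd (\<sigma> * sqrt (real N + 1)) x 0 (S X (k - 1) \<omega>))\<bar>
    \<le> KZ * \<bar>expectation (\<lambda>\<omega>. gfd (\<sigma> * sqrt N) x 3 (S X (k - 1) \<omega>))\<bar> + K4 * (QQ x L k / L * (eta L + tl k))"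
proof -
  interpret D: dep_test \<nu> X C M \<phi> "gfd (\<sigma> * sqrt N) x" "\<lambda>y. exp (- \<bar>x - y\<bar> / real L)" "gc \<sigma>" L R k \<theta> Th
    unfolding L_def using dep_test_instance[OF N k] .
  note b = floor_sqrt_bounds[OF N, folded L_def]
  let ?f = "gfd (\<sigma> * sqrt N) x" and ?g = "gfd (\<sigma> * sqrt (real N + 1)) x"
  let ?S = "S X (k - 1)"
  have Qe: "D.Q = QQ x L k" unfolding D.Q_def QQ_def by simp
  have Q0: "0 \<le> QQ x L k" using D.Q_nonneg Qe by simp
  have KZe: "D.KZ = KZ" unfolding D.KZ_def KZ_def by simp
  have Ze: "D.Z = expectation (\<lambda>\<omega>. ?f 3 (?S \<omega>))" unfolding D.Z_def by simp
  have We: "D.W = Wf L" unfolding D.W_def Wf_def D.\<Lambda>_def cR_def by simp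
  have Le: "\<theta> (L + 1) + \<theta> (R * L + 1) + \<theta> (D.\<Lambda> + 1) = Tf L" unfolding Tf_def D.\<Lambda>_def cR_def by simp
  have L0: "0 < real L" using b(1) by simp
  let ?v = "expectation (\<lambda>\<omega>. ?f 0 (S X k \<omega>)) - expectation (\<lambda>\<omega>. ?f 0 (?S \<omega>)) - D.s2 / 2 * expectation (\<lambda>\<omega>. ?f 2 (?S \<omega>))"
  obtain \<kappa> where \<kappa>: "\<bar>\<kappa>\<bar> \<le> KZ" "\<bar>?v - \<kappa> * D.Z\<bar> \<le> D.K3 * QQ x L k * ((1 + Wf L) / real L ^ 4 + Tf L / real L)"
    using D.step_expansion unfolding D.near_Z_def KZe Qe We Le by blast
  have v: "\<bar>?v\<bar> \<le> KZ * \<bar>expectation (\<lambda>\<omega>. ?f 3 (?S \<omega>))\<bar> + D.K3 * QQ x L k * ((1 + Wf L) / real L ^ 4 + Tf L / real L)"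
  proof -
    have "\<bar>\<kappa> * D.Z\<bar> \<le> KZ * \<bar>expectation (\<lambda>\<omega>. ?f 3 (?S \<omega>))\<bar>" unfolding abs_mult Ze using \<kappa>(1) by (intro mult_right_mono) auto
    with \<kappa>(2) show ?thesis by linarith
  qed
  have intg: "bddrv \<nu> (\<lambda>\<omega>. ?g 0 (?S \<omega>))"
    by (rule bddrv_comp[where c=1]) (use Phi_bounds in \<open>auto simp: gfd_def[abs_def]\<close>)
  have heat: "\<bar>expectation (\<lambda>\<omega>. ?g 0 (?S \<omega>)) - expectation (\<lambda>\<omega>. ?f 0 (?S \<omega>)) - \<sigma>\<^sup>2 / 2 * expectation (\<lambda>\<omega>. ?f 2 (?S \<omega>))\<bar>
     \<le> \<sigma> ^ 4 * gc \<sigma> / real L ^ 4 * QQ x L k"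
  proof -
    have "expectation (\<lambda>\<omega>. ?g 0 (?S \<omega>)) - expectation (\<lambda>\<omega>. ?f 0 (?S \<omega>)) - \<sigma>\<^sup>2 / 2 * expectation (\<lambda>\<omega>. ?f 2 (?S \<omega>))
      = expectation (\<lambda>\<omega>. ?g 0 (?S \<omega>) - ?f 0 (?S \<omega>) - \<sigma>\<^sup>2 / 2 * ?f 2 (?S \<omega>))"
      using bddrv_integrable[OF intg] bddrv_integrable[OF D.bddrv_fd[of 0]] bddrv_integrable[OF D.bddrv_fd[of 2]] by simp
    then have "\<bar>expectation (\<lambda>\<omega>. ?g 0 (?S \<omega>)) - expectation (\<lambda>\<omega>. ?f 0 (?S \<omega>)) - \<sigma>\<^sup>2 / 2 * expectation (\<lambda>\<omega>. ?f 2 (?S \<omega>))\<bar>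
      \<le> expectation (\<lambda>\<omega>. \<bar>?g 0 (?S \<omega>) - ?f 0 (?S \<omega>) - \<sigma>\<^sup>2 / 2 * ?f 2 (?S \<omega>)\<bar>)"
      by (simp only: integral_abs_bound)
    also have "\<dots> \<le> expectation (\<lambda>\<omega>. \<sigma> ^ 4 * gc \<sigma> / real L ^ 4 * exp (- \<bar>x - ?S \<omega>\<bar> / real L))"
    proof (rule integral_mono)
      show "integrable \<nu> (\<lambda>\<omega>. \<bar>?g 0 (?S \<omega>) - ?f 0 (?S \<omega>) - \<sigma>\<^sup>2 / 2 * ?f 2 (?S \<omega>)\<bar>)"
        by (intro integrable_abs bddrv_integrable bddrv_diff bddrv_cmult intg D.bddrv_fd) auto
      show "integrable \<nu> (\<lambda>\<omega>. \<sigma> ^ 4 * gc \<sigma> / real L ^ 4 * exp (- \<bar>x - ?S \<omega>\<bar> / real L))"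
        by (intro bddrv_integrable bddrv_cmult D.bddrv_psi)
      show "\<bar>?g 0 (?S \<omega>) - ?f 0 (?S \<omega>) - \<sigma>\<^sup>2 / 2 * ?f 2 (?S \<omega>)\<bar> \<le> \<sigma> ^ 4 * gc \<sigma> / real L ^ 4 * exp (- \<bar>x - ?S \<omega>\<bar> / real L)" for \<omega>
        using b by (intro heat_step sigma_pos) auto
    qed
    finally show ?thesis by (simp add: QQ_def)
  qed
  have f2: "\<bar>expectation (\<lambda>\<omega>. ?f 2 (?S \<omega>))\<bar> \<le> gc \<sigma> / real L ^ 2 * QQ x L k"
  proof -
    have "\<bar>expectation (\<lambda>\<omega>. ?f 2 (?S \<omega>))\<bar> \<le> expectation (\<lambda>\<omega>. \<bar>?f 2 (?S \<omega>)\<bar>)" by (rule integral_abs_bound)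
    also have "\<dots> \<le> expectation (\<lambda>\<omega>. gc \<sigma> / real L ^ 2 * exp (- \<bar>x - ?S \<omega>\<bar> / real L))"
      using D.fd_bound[of 2] by (intro integral_mono integrable_abs bddrv_integrable bddrv_cmult D.bddrv_fd D.bddrv_psi) auto
    finally show ?thesis by (simp add: QQ_def)
  qed
  have s2: "\<bar>(D.s2 - \<sigma>\<^sup>2) / 2 * expectation (\<lambda>\<omega>. ?f 2 (?S \<omega>))\<bar> \<le> (3 * C * M\<^sup>2 * (tl (L + 1) + tl k)) * (gc \<sigma> / real L ^ 2 * QQ x L k)"
    unfolding abs_mult using s2_close[OF N k, folded L_def] f2 C_ge1 tl_nn by (intro mult_mono) auto
  have "expectation (\<lambda>\<omega>. ?f 0 (S X k \<omega>)) - expectation (\<lambda>\<omega>. ?g 0 (?S \<omega>))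
     = ?v - (expectation (\<lambda>\<omega>. ?g 0 (?S \<omega>)) - expectation (\<lambda>\<omega>. ?f 0 (?S \<omega>)) - \<sigma>\<^sup>2 / 2 * expectation (\<lambda>\<omega>. ?f 2 (?S \<omega>)))
       + (D.s2 - \<sigma>\<^sup>2) / 2 * expectation (\<lambda>\<omega>. ?f 2 (?S \<omega>))"
    by (simp add: field_simps)
  then have "\<bar>expectation (\<lambda>\<omega>. ?f 0 (S X k \<omega>)) - expectation (\<lambda>\<omega>. ?g 0 (?S \<omega>))\<bar>
    \<le> KZ * \<bar>expectation (\<lambda>\<omega>. ?f 3 (?S \<omega>))\<bar> + (D.K3 * QQ x L k * ((1 + Wf L) / real L ^ 4 + Tf L / real L)
      + \<sigma> ^ 4 * gc \<sigma> / real L ^ 4 * QQ x L k + (3 * C * M\<^sup>2 * (tl (L + 1) + tl k)) * (gc \<sigma> / real L ^ 2 * QQ x L k))"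
    using v heat s2 by linarith
  also have "D.K3 * QQ x L k * ((1 + Wf L) / real L ^ 4 + Tf L / real L)
      + \<sigma> ^ 4 * gc \<sigma> / real L ^ 4 * QQ x L k + (3 * C * M\<^sup>2 * (tl (L + 1) + tl k)) * (gc \<sigma> / real L ^ 2 * QQ x L k)
    \<le> K4 * (QQ x L k / L * (eta L + tl k))"
  proof -
    define E where "E = eta L + tl k"
    define q where "q = QQ x L k / real L"
    have q: "0 \<le> q" unfolding q_def using Q0 by simp
    have Lp: "1 / real L \<le> 1" using b(1) by simp
    have e1: "((1 + Wf L) / real L ^ 4 + Tf L / real L) = (1 / real L) * ((1 + Wf L) / real L ^ 3 + Tf L)"
      using L0 by (simp add: field_simps eval_nat_numeral)
    have u1: "(1 + Wf L) / real L ^ 3 + Tf L \<le> E"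
      unfolding E_def eta_def using tl_nn L0 by simp
    have u2: "1 / real L ^ 3 \<le> E"
    proof -
      have "1 / real L ^ 3 \<le> (1 + Wf L) / real L ^ 3" using Wf_nn L0 by (intro divide_right_mono) auto
      then show ?thesis using u1 Tf_nn[of L] by linarith
    qed
    have u3: "(tl (L + 1) + tl k) / real L \<le> E"
    proof -
      have "tl k / real L \<le> tl k" using tl_nn[of k] Lp b(1) by (simp add: divide_le_eq mult_le_cancel_left1)
      moreover have "0 \<le> (1 + Wf L) / real L ^ 3" using Wf_nn by simp
      ultimately show ?thesis unfolding E_def eta_def using Tf_nn[of L] by (simp add: add_divide_distrib)
    qed
    have K3: "0 \<le> D.K3" unfolding D.K3_def using D.K2_ge(3) D.K0_nonneg D.Th_nonneg by (intro add_nonneg_nonneg mult_nonneg_nonneg) auto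
    have g0: "0 \<le> gc \<sigma>" using gc_ge1[OF sigma_pos] by simp
    have "D.K3 * QQ x L k * ((1 + Wf L) / real L ^ 4 + Tf L / real L) = D.K3 * (q * ((1 + Wf L) / real L ^ 3 + Tf L))"
      unfolding e1 q_def by simp
    also have "\<dots> \<le> D.K3 * (q * E)" using u1 q K3 by (intro mult_left_mono)
    finally have 1: "D.K3 * QQ x L k * ((1 + Wf L) / real L ^ 4 + Tf L / real L) \<le> D.K3 * (q * E)" .
    have "\<sigma> ^ 4 * gc \<sigma> / real L ^ 4 * QQ x L k = \<sigma> ^ 4 * gc \<sigma> * (q * (1 / real L ^ 3))"
      unfolding q_def by (simp add: eval_nat_numeral)
    also have "\<dots> \<le> \<sigma> ^ 4 * gc \<sigma> * (q * E)" using u2 q g0 by (intro mult_left_mono) auto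
    finally have 2: "\<sigma> ^ 4 * gc \<sigma> / real L ^ 4 * QQ x L k \<le> \<sigma> ^ 4 * gc \<sigma> * (q * E)" .
    have "(3 * C * M\<^sup>2 * (tl (L + 1) + tl k)) * (gc \<sigma> / real L ^ 2 * QQ x L k) = 3 * C * M\<^sup>2 * gc \<sigma> * (q * ((tl (L + 1) + tl k) / real L))"
      unfolding q_def by (simp add: power2_eq_square)
    also have "\<dots> \<le> 3 * C * M\<^sup>2 * gc \<sigma> * (q * E)" using u3 q g0 C_ge1 by (intro mult_left_mono) auto
    finally have 3: "(3 * C * M\<^sup>2 * (tl (L + 1) + tl k)) * (gc \<sigma> / real L ^ 2 * QQ x L k) \<le> 3 * C * M\<^sup>2 * gc \<sigma> * (q * E)" .
    show ?thesis unfolding K4_def E_def[symmetric] q_def[symmetric] distrib_right using 1 2 3 by linarith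
  qed
  finally show ?thesis by simp
qed

end

section \<open>Induction\<close>

lemma sum_inverse_sqrt_le: "(\<Sum>i=1..n. 1 / sqrt (real i)) \<le> 2 * sqrt (real n)"
proof (induction n)
  case (Suc n)
  let ?a = "sqrt (real n)" and ?b = "sqrt (real n + 1)"
  have b0: "0 < ?b" and ab: "?a \<le> ?b" by auto
  have "1 = (?b - ?a) * (?b + ?a)" by (simp add: algebra_simps)
  also have "\<dots> \<le> (?b - ?a) * (2 * ?b)" using ab by (intro mult_left_mono) auto
  also have "\<dots> = 2 * (?b - ?a) * ?b" by (simp only: mult_ac)
  finally have "1 / ?b \<le> 2 * (?b - ?a)" using pos_divide_le_eq[OF b0] by blast
  then show ?case using Suc by (simp add: add.commute)
qed simp

text \<open>Each term is at most the difference of \<open>6 / sqrt N\<close> between consecutive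
  integers, and these differences telescope.\<close>

lemma sum_inverse_sqrt_cube_le:
  assumes m: "1 \<le> m"
  shows "(\<Sum>i<n. 1 / (real (m + i) * sqrt (real (m + i)))) \<le> 6 / sqrt (real m)"
proof -
  have "(\<Sum>i<n. 1 / (real (m + i) * sqrt (real (m + i)))) \<le> 6 / sqrt (real m) - 6 / sqrt (real (m + n))"
  proof (induction n)
    case (Suc n)
    define N where "N = real (m + n)"
    have N: "1 \<le> N" unfolding N_def using m by simp
    let ?a = "sqrt N" and ?b = "sqrt (N + 1)"
    have a0: "0 < ?a" using N by simp
    have b: "?b \<le> 3 / 2 * ?a"
    proof (rule real_le_lsqrt)
      show "N + 1 \<le> (3 / 2 * ?a)\<^sup>2" using N by (simp add: power_mult_distrib power2_eq_square)
    qed (use N in auto)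
    have b0: "0 < ?b" using N by simp
    have "1 / (N * ?a) \<le> 6 * (1 / ?a - 1 / ?b)"
    proof -
      have "1 = (?b - ?a) * (?b + ?a)" using N by (simp add: algebra_simps)
      also have "\<dots> \<le> (?b - ?a) * (5 / 2 * ?a)" using b by (intro mult_left_mono) auto
      finally have "1 \<le> (?b - ?a) * (5 / 2 * ?a)" .
      then have "?b * 1 \<le> ?b * ((?b - ?a) * (5 / 2 * ?a))" using b0 by (intro mult_left_mono) auto
      also have "\<dots> \<le> (3 / 2 * ?a) * ((?b - ?a) * (5 / 2 * ?a))"
        using a0 by (intro mult_right_mono[OF b]) auto
      also have "\<dots> = 15 / 4 * (?a * ?a) * (?b - ?a)" by simp
      also have "\<dots> = 15 / 4 * N * (?b - ?a)" using N by simp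
      also have "\<dots> \<le> 6 * N * (?b - ?a)" using N by (intro mult_right_mono) auto
      finally have h: "?b \<le> 6 * N * (?b - ?a)" unfolding mult_1_right .
      have "6 * (1 / ?a - 1 / ?b) = 6 * N * (?b - ?a) / (N * ?a * ?b)" using a0 b0 N by (simp add: field_simps)
      moreover have "?b / (N * ?a * ?b) \<le> 6 * N * (?b - ?a) / (N * ?a * ?b)"
        using h a0 b0 N by (intro divide_right_mono) auto
      moreover have "?b / (N * ?a * ?b) = 1 / (N * ?a)" using b0 by simp
      ultimately show ?thesis by linarith
    qed
    moreover have "real (m + Suc n) = N + 1" unfolding N_def by simp
    ultimately show ?case using Suc unfolding N_def by (simp add: right_diff_distrib add_ac)
  qed simp
  then show ?thesis by (rule order_trans) simp
qed

lemma sum_rev_shift: "(\<Sum>k=1..n. f (n - k + m)) = (\<Sum>i<n. f (m + i))"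
  for f :: "nat \<Rightarrow> real"
  by (rule sum.reindex_bij_witness[of _ "\<lambda>i. n - i" "\<lambda>k. n - k"]) (auto simp: add.commute)

section \<open>Inductive estimates\<close>

context berry_esseen_setting begin

definition be_bound :: "real \<Rightarrow> nat \<Rightarrow> bool" where
  "be_bound B j \<longleftrightarrow> (\<forall>t. \<bar>prob {\<omega> \<in> space \<nu>. S X j \<omega> \<le> t} - Phi (t / (\<sigma> * sqrt j))\<bar> \<le> B / sqrt j)"

definition KQ :: real where "KQ = 16 * (1 + 1 / \<sigma>)"
definition K5 :: real where "K5 = 2 * m0 / \<sigma> ^ 3 + 2 * m2 / \<sigma> ^ 3 + 16 * gc \<sigma>"

lemma half_sqrt:
  assumes "real n \<le> 2 * y" "1 \<le> n"
  shows "1 / sqrt y \<le> 2 / sqrt n" "1 / y \<le> 2 / n"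
proof -
  have n: "0 < real n" and y: "0 < y" using assms by auto
  have "sqrt n \<le> sqrt (4 * y)" using assms y by simp
  then have "sqrt n \<le> 2 * sqrt y" by (simp add: real_sqrt_mult)
  then show "1 / sqrt y \<le> 2 / sqrt n" using n y by (simp add: field_simps)
  show "1 / y \<le> 2 / n" using n y assms by (simp add: field_simps)
qed

text \<open>If \<open>n \<le> 2 * (k - 1)\<close>, the bound at \<open>j = k - 1\<close> yields
  concentration, with \<open>n / j \<le> 2\<close>. Otherwise the remaining time is at least
  \<open>n / 2\<close>, so \<open>L / sqrt n\<close> is bounded below and the trivial bound
  \<open>1\<close> is enough.\<close>

lemma Q_bound:
  assumes k: "1 \<le> k" "k \<le> n" and m: "1 \<le> m" and B: "0 \<le> B"
    and IH: "\<And>j. 1 \<le> j \<Longrightarrow> j < n \<Longrightarrow> be_bound B j"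
  defines "L \<equiv> floor_sqrt (n - k + m)"
  shows "QQ x L k \<le> KQ * (real L / sqrt n) * (1 + B / sqrt m)"
proof -
  have N1: "1 \<le> n - k + m" using m by simp
  note b = floor_sqrt_bounds[OF N1, folded L_def]
  have L0: "0 < real L" and n0: "0 < real n" and m0: "0 < real m" using b k m by auto
  have BM: "0 \<le> B / sqrt m" using B by simp
  have Bn: "0 \<le> real L / sqrt n" using L0 by simp
  show ?thesis
  proof (cases "n \<le> 2 * (k - 1)")
    case True
    define j where "j = k - 1"
    have j: "1 \<le> j" "j < n" using True k by (auto simp: j_def)
    have jn: "real n \<le> 2 * real j" using True unfolding j_def by linarith
    have r: "1 / sqrt j \<le> 2 / sqrt n" using half_sqrt(1)[OF jn] k by simp
    have "QQ x L k \<le> 8 * real L / (\<sigma> * sqrt j) + 4 * (B / sqrt j)"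
      unfolding QQ_def j_def[symmetric] using IH[OF j] j sigma_pos L0
      by (intro expectation_exp_concentration) (auto simp: be_bound_def)
    also have "\<dots> = (8 * real L / \<sigma> + 4 * B) * (1 / sqrt j)" by (simp add: add_divide_distrib)
    also have "\<dots> \<le> (8 * real L / \<sigma> + 4 * B) * (2 / sqrt n)"
      using r B sigma_pos by (intro mult_left_mono) auto
    \<comment> \<open>The term with \<open>B\<close> carries no factor \<open>L\<close>. Since
      \<open>sqrt m \<le> 2 * L\<close>, one is supplied in exchange for \<open>1 / sqrt m\<close>,
      the small factor that will close the induction.\<close>
    also have "\<dots> \<le> (8 * real L / \<sigma> + 8 * real L * (B / sqrt m)) * (2 / sqrt n)"
    proof (intro mult_right_mono add_left_mono)
      have "sqrt m \<le> sqrt (n - k + m)" by simp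
      then have "sqrt m \<le> 2 * real L" using b(4) by linarith
      then have "4 * B * sqrt m \<le> 4 * B * (2 * real L)" using B by (intro mult_left_mono) auto
      then show "4 * B \<le> 8 * real L * (B / sqrt m)" using m0 by (simp add: field_simps)
    qed simp
    also have "\<dots> = 16 * (real L / sqrt n) * (1 / \<sigma> + B / sqrt m)"
      by (simp add: algebra_simps add_divide_distrib)
    also have "\<dots> \<le> 16 * (real L / sqrt n) * ((1 + 1 / \<sigma>) * (1 + B / sqrt m))"
    proof (intro mult_left_mono)
      have "(1 + 1 / \<sigma>) * (1 + b) = 1 + b + 1 / \<sigma> + 1 / \<sigma> * b" for b by (simp add: algebra_simps add_divide_distrib)
      note e = this[of "B / sqrt m"]
      have "0 \<le> 1 / \<sigma> * (B / sqrt m)" using BM sigma_pos by (intro mult_nonneg_nonneg) auto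
      then show "1 / \<sigma> + B / sqrt m \<le> (1 + 1 / \<sigma>) * (1 + B / sqrt m)" unfolding e by simp
    qed (use Bn in auto)
    also have "\<dots> = KQ * (real L / sqrt n) * (1 + B / sqrt m)" by (simp only: KQ_def mult_ac)
    finally show ?thesis .
  next
    case False
    have "n \<le> 2 * (n - k + m)" using False k m by arith
    then have "real n \<le> 2 * real (n - k + m)" by linarith
    then have "sqrt n \<le> sqrt (4 * real (n - k + m))" by (intro real_sqrt_le_mono) linarith
    also have "\<dots> = 2 * sqrt (real (n - k + m))" by (simp only: real_sqrt_mult real_sqrt_four)
    also have "\<dots> \<le> 4 * real L" using b(4) by linarith
    finally have "1 \<le> 4 * (real L / sqrt n)" using n0 by (simp add: field_simps)
    also have "\<dots> \<le> KQ * (real L / sqrt n)" using sigma_pos Bn unfolding KQ_def by (intro mult_right_mono) (auto simp: field_simps)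
    also have "\<dots> \<le> KQ * (real L / sqrt n) * (1 + B / sqrt m)"
      using BM Bn sigma_pos mult_left_mono[of 1 "1 + B / sqrt m" "KQ * (real L / sqrt n)"] by (simp add: KQ_def)
    finally have one: "1 \<le> KQ * (real L / sqrt n) * (1 + B / sqrt m)" .
    have "QQ x L k \<le> expectation (\<lambda>_. 1)"
      unfolding QQ_def using L0 by (intro integral_mono integrable_const_bound[where B=1]) auto
    then show ?thesis using one prob_space by simp
  qed
qed

text \<open>The two halves are those of \<open>Q_bound\<close>. Late steps use
  \<open>expectation_gfd3\<close> with the inductive bound; early ones use the crude order
  \<open>L^-3\<close>, which is at most of order \<open>1 / (n * sqrt N)\<close> when
  \<open>N \<ge> n / 2\<close>.\<close>

lemma f3_bound:
  assumes k: "1 \<le> k" "k \<le> n" and m: "1 \<le> m" and B: "0 \<le> B"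
    and IH: "\<And>j. 1 \<le> j \<Longrightarrow> j < n \<Longrightarrow> be_bound B j"
  defines "N \<equiv> n - k + m"
  shows "\<bar>expectation (\<lambda>\<omega>. gfd (\<sigma> * sqrt N) x 3 (S X (k - 1) \<omega>))\<bar>
    \<le> K5 * (1 / (real n * sqrt N) + B / sqrt n * (1 / (real N * sqrt N)))"
proof -
  have N1: "1 \<le> N" using m by (simp add: N_def)
  note b = floor_sqrt_bounds[OF N1]
  have n0: "0 < real n" and N0: "0 < real N" using N1 k by auto
  define u v where "u = 1 / (real n * sqrt N)" and "v = B / sqrt n * (1 / (real N * sqrt N))"
  have u0: "0 \<le> u" and v0: "0 \<le> v" unfolding u_def v_def using B by auto
  have c0: "0 \<le> 2 * m0 / \<sigma> ^ 3" "0 \<le> 2 * m2 / \<sigma> ^ 3" "0 \<le> 16 * gc \<sigma>"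
    using m_nonneg sigma_pos gc_ge1[OF sigma_pos] by auto
  show ?thesis
  proof (cases "n \<le> 2 * (k - 1)")
    case True
    define j where "j = k - 1"
    have j: "1 \<le> j" "j < n" using True k by (auto simp: j_def)
    have jn: "real n \<le> 2 * real j" using True unfolding j_def by linarith
    have r: "1 / sqrt j \<le> 2 / sqrt n" "1 / real j \<le> 2 / real n" using half_sqrt[OF jn] k by auto
    have s3: "(\<sigma> * sqrt N) ^ 3 = \<sigma> ^ 3 * (real N * sqrt N)" by (simp add: power_mult_distrib power3_eq_cube)
    have sq: "(\<sigma> * sqrt N / (\<sigma> * sqrt j))\<^sup>2 = real N / real j"
      using sigma_pos j by (simp add: power_divide)
    have "\<bar>expectation (\<lambda>\<omega>. gfd (\<sigma> * sqrt N) x 3 (S X j \<omega>))\<bar>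
       \<le> (m0 * (B / sqrt j) + m2 * (\<sigma> * sqrt N / (\<sigma> * sqrt j))\<^sup>2) / (\<sigma> * sqrt N) ^ 3"
      using IH[OF j] sigma_pos N0 j by (intro expectation_gfd3) (auto simp: be_bound_def)
    also have "\<dots> = m0 * B / (\<sigma> ^ 3 * (real N * sqrt N)) * (1 / sqrt j) + m2 / (\<sigma> ^ 3 * sqrt N) * (1 / real j)"
      unfolding sq s3 using N0 by (simp add: add_divide_distrib mult_ac)
    also have "\<dots> \<le> m0 * B / (\<sigma> ^ 3 * (real N * sqrt N)) * (2 / sqrt n) + m2 / (\<sigma> ^ 3 * sqrt N) * (2 / real n)"
      using r B sigma_pos m_nonneg by (intro add_mono mult_left_mono) auto
    also have "\<dots> = (2 * m0 / \<sigma> ^ 3) * v + (2 * m2 / \<sigma> ^ 3) * u" by (simp add: u_def v_def mult_ac)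
    also have "\<dots> \<le> K5 * v + K5 * u"
      unfolding K5_def using u0 v0 c0 by (intro add_mono mult_right_mono) auto
    finally show ?thesis unfolding j_def u_def v_def by (simp add: distrib_left)
  next
    case False
    interpret D: dep_test \<nu> X C M \<phi> "gfd (\<sigma> * sqrt N) x" "\<lambda>y. exp (- \<bar>x - y\<bar> / real (floor_sqrt N))" "gc \<sigma>" "floor_sqrt N" R k \<theta> Th
      using dep_test_instance[OF N1 k(1)] .
    have "n \<le> 2 * N" unfolding N_def using False k m by arith
    then have nN: "real n \<le> 2 * real N" by linarith
    have g0: "0 \<le> gc \<sigma>" using c0 by simp
    have "\<bar>expectation (\<lambda>\<omega>. gfd (\<sigma> * sqrt N) x 3 (S X (k - 1) \<omega>))\<bar> \<le> gc \<sigma> / real (floor_sqrt N) ^ 3"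
    proof (rule abs_expectation_le)
      show "AE \<omega> in \<nu>. \<bar>gfd (\<sigma> * sqrt N) x 3 (S X (k - 1) \<omega>)\<bar> \<le> gc \<sigma> / real (floor_sqrt N) ^ 3"
      proof (rule AE_I2)
        fix \<omega>
        have "gc \<sigma> / real (floor_sqrt N) ^ 3 * exp (- \<bar>x - S X (k - 1) \<omega>\<bar> / real (floor_sqrt N)) \<le> gc \<sigma> / real (floor_sqrt N) ^ 3"
          using g0 by (intro mult_left_le) auto
        with D.fd_bound[of 3 "S X (k - 1) \<omega>"] show "\<bar>gfd (\<sigma> * sqrt N) x 3 (S X (k - 1) \<omega>)\<bar> \<le> gc \<sigma> / real (floor_sqrt N) ^ 3" by simp
      qed
    qed (rule D.bddrv_fd, simp)
    also have "\<dots> \<le> gc \<sigma> / (sqrt N / 2) ^ 3"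
      using b g0 N0 by (intro divide_left_mono power_mono mult_pos_pos) auto
    also have "\<dots> = 8 * gc \<sigma> * (1 / sqrt N) * (1 / real N)" using N0 by (simp add: power3_eq_cube mult_ac)
    also have "\<dots> \<le> 8 * gc \<sigma> * (1 / sqrt N) * (2 / real n)"
      using half_sqrt(2)[OF nN] k g0 by (intro mult_left_mono) auto
    also have "\<dots> = 16 * gc \<sigma> * u" by (simp add: u_def)
    also have "\<dots> \<le> K5 * (u + v)"
      unfolding K5_def using u0 v0 c0 by (intro mult_mono) auto
    finally show ?thesis unfolding u_def v_def .
  qed
qed

definition K6 :: real where "K6 = 6 * KZ * K5 + K4 * KQ * (Heta + Th)"

lemma K_nonneg: "0 \<le> KZ" "0 \<le> K4" "0 \<le> K5" "0 \<le> KQ" "0 \<le> K6"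
proof -
  interpret D: dep_test \<nu> X C M \<phi> "gfd (\<sigma> * sqrt (1::nat)) 0" "\<lambda>y. exp (- \<bar>0 - y\<bar> / real (floor_sqrt 1))" "gc \<sigma>" "floor_sqrt 1" R 1 \<theta> Th
    using dep_test_instance[of 1 1 0] by simp
  have g: "0 \<le> gc \<sigma>" using gc_ge1[OF sigma_pos] by simp
  show 1: "0 \<le> KZ" unfolding KZ_def using C_ge1 M_ge1 Th_nn by simp
  have "0 \<le> D.K3" unfolding D.K3_def using D.K2_ge(3) D.K0_nonneg D.Th_nonneg by (intro add_nonneg_nonneg mult_nonneg_nonneg) auto
  then show 2: "0 \<le> K4" unfolding K4_def using g C_ge1 by simp
  show 3: "0 \<le> K5" unfolding K5_def using m_nonneg sigma_pos g by simp
  show 4: "0 \<le> KQ" unfolding KQ_def using sigma_pos by simp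
  show "0 \<le> K6" unfolding K6_def using 1 2 3 4 Heta_nn Th_nn by simp
qed

text \<open>The sequence \<open>a\<close> runs from the Gaussian value at \<open>k = 0\<close>,
  where the sum is \<open>0\<close>, to the smoothed law of \<open>S X n\<close>. The terms
  \<open>1 / (n * sqrt N)\<close> sum to order \<open>1 / sqrt n\<close> and the terms
  \<open>1 / (N * sqrt N)\<close> to order \<open>1 / sqrt m\<close>, so \<open>B\<close> always
  comes with the factor \<open>1 / sqrt m\<close>.\<close>

lemma smoothed_bound:
  fixes n m :: nat
  assumes n: "1 \<le> n" and m: "1 \<le> m" and B: "0 \<le> B"
    and IH: "\<And>j. 1 \<le> j \<Longrightarrow> j < n \<Longrightarrow> be_bound B j"
  shows "\<bar>expectation (\<lambda>\<omega>. Phi ((x - S X n \<omega>) / (\<sigma> * sqrt m))) - Phi (x / (\<sigma> * sqrt (n + m)))\<bar>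
    \<le> K6 * (1 + B / sqrt m) / sqrt n"
proof -
  define a where "a k = expectation (\<lambda>\<omega>. gfd (\<sigma> * sqrt (n - k + m)) x 0 (S X k \<omega>))" for k :: nat
  have n0: "0 < real n" and m0: "0 < real m" using n m by auto
  have BM: "0 \<le> B / sqrt m" using B by simp
  have an: "a n = expectation (\<lambda>\<omega>. Phi ((x - S X n \<omega>) / (\<sigma> * sqrt m)))"
    unfolding a_def by (simp add: gfd_def)
  have a0: "a 0 = Phi (x / (\<sigma> * sqrt (n + m)))"
    unfolding a_def by (simp add: gfd_def prob_space)
  let ?w = "1 + B / sqrt m"
  let ?N = "\<lambda>k. n - k + m"
  have stepk: "\<bar>a k - a (k - 1)\<bar> \<le> KZ * K5 * (1 / n * (1 / sqrt (?N k)) + B / sqrt n * (1 / (real (?N k) * sqrt (?N k))))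
      + K4 * (KQ * ?w / sqrt n) * (eta (floor_sqrt (?N k)) + tl k)" if k: "k \<in> {1..n}" for k
  proof -
    have k': "1 \<le> k" "k \<le> n" using k by auto
    have N1: "1 \<le> ?N k" using m by simp
    let ?L = "floor_sqrt (?N k)"
    have L0: "0 < real ?L" using floor_sqrt_bounds(1)[OF N1] m by simp
    have e: "real (n - (k - 1) + m) = real (?N k) + 1" using k' by simp
    have "\<bar>a k - a (k - 1)\<bar> \<le> KZ * \<bar>expectation (\<lambda>\<omega>. gfd (\<sigma> * sqrt (?N k)) x 3 (S X (k - 1) \<omega>))\<bar>
       + K4 * (QQ x ?L k / ?L * (eta ?L + tl k))"
      unfolding a_def e by (rule lindeberg_step[OF N1 k'(1)])
    also have "\<dots> \<le> KZ * (K5 * (1 / (real n * sqrt (?N k)) + B / sqrt n * (1 / (real (?N k) * sqrt (?N k)))))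
       + K4 * ((KQ * ?w / sqrt n) * (eta ?L + tl k))"
    proof (rule add_mono)
      show "KZ * \<bar>expectation (\<lambda>\<omega>. gfd (\<sigma> * sqrt (?N k)) x 3 (S X (k - 1) \<omega>))\<bar>
         \<le> KZ * (K5 * (1 / (real n * sqrt (?N k)) + B / sqrt n * (1 / (real (?N k) * sqrt (?N k)))))"
        by (intro mult_left_mono f3_bound[OF k' m B IH] K_nonneg)
      have "QQ x ?L k / ?L \<le> (KQ * (real ?L / sqrt n) * ?w) / ?L"
        using L0 by (intro divide_right_mono Q_bound[OF k' m B IH]) auto
      also have "\<dots> = KQ * ?w / sqrt n"
      proof -
        have "KQ * (l / sqrt n) * ?w / l = KQ * ?w / sqrt n" if "0 < l" for l using that by simp
        from this[OF L0] show ?thesis .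
      qed
      finally show "K4 * (QQ x ?L k / ?L * (eta ?L + tl k)) \<le> K4 * ((KQ * ?w / sqrt n) * (eta ?L + tl k))"
        using eta_nn tl_nn by (intro mult_left_mono mult_right_mono K_nonneg) (auto intro: add_nonneg_nonneg)
    qed
    also have "\<dots> = KZ * K5 * (1 / n * (1 / sqrt (?N k)) + B / sqrt n * (1 / (real (?N k) * sqrt (?N k))))
      + K4 * (KQ * ?w / sqrt n) * (eta ?L + tl k)" by (simp only: mult.assoc times_divide_times_eq mult_1_left)
    finally show ?thesis .
  qed
  have tele: "a n - a 0 = (\<Sum>k=1..n. a k - a (k - 1))"
    using sum_telescope''[of 0 n a] by (simp add: sum.atLeast1_atMost_eq sum_telescope lessThan_Suc_atMost sum_lessThan_telescope)
  have s1: "(\<Sum>k=1..n. 1 / sqrt (real (?N k))) \<le> 2 * sqrt n"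
  proof -
    have "(\<Sum>k=1..n. 1 / sqrt (real (?N k))) = (\<Sum>i<n. 1 / sqrt (real (m + i)))" by (rule sum_rev_shift)
    also have "\<dots> \<le> (\<Sum>i<n. 1 / sqrt (real (Suc i)))"
      using m by (intro sum_mono divide_left_mono) auto
    also have "\<dots> = (\<Sum>i=1..n. 1 / sqrt (real i))" by (simp add: sum.atLeast1_atMost_eq)
    finally show ?thesis using sum_inverse_sqrt_le[of n] by linarith
  qed
  have s2: "(\<Sum>k=1..n. 1 / (real (?N k) * sqrt (?N k))) \<le> 6 / sqrt m"
    unfolding sum_rev_shift[of "\<lambda>N. 1 / (real N * sqrt (real N))" n m] by (rule sum_inverse_sqrt_cube_le[OF m])
  have s3: "(\<Sum>k=1..n. eta (floor_sqrt (?N k))) \<le> Heta"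
  proof -
    have "(\<Sum>k=1..n. eta (floor_sqrt (?N k))) = (\<Sum>i<n. eta (floor_sqrt (m + i)))"
      by (rule sum_rev_shift[of "\<lambda>N. eta (floor_sqrt N)"])
    also have "\<dots> = (\<Sum>N\<in>(\<lambda>i. m + i) ` {..<n}. eta (floor_sqrt N))"
      by (subst sum.reindex) auto
    also have "\<dots> \<le> (\<Sum>N=1..m+n. eta (floor_sqrt N))"
      using m eta_nn by (intro sum_mono2) auto
    finally show ?thesis using sum_eta[of "m + n"] by linarith
  qed
  have "\<bar>a n - a 0\<bar> \<le> (\<Sum>k=1..n. KZ * K5 * (1 / n * (1 / sqrt (?N k)) + B / sqrt n * (1 / (real (?N k) * sqrt (?N k))))
      + K4 * (KQ * ?w / sqrt n) * (eta (floor_sqrt (?N k)) + tl k))"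
    unfolding tele by (intro order_trans[OF sum_abs] sum_mono stepk)
  also have "\<dots> = KZ * K5 * (1 / n * (\<Sum>k=1..n. 1 / sqrt (?N k)) + B / sqrt n * (\<Sum>k=1..n. 1 / (real (?N k) * sqrt (?N k))))
      + K4 * (KQ * ?w / sqrt n) * ((\<Sum>k=1..n. eta (floor_sqrt (?N k))) + (\<Sum>k=1..n. tl k))"
    by (simp only: sum.distrib sum_distrib_left[symmetric])
  also have "\<dots> \<le> KZ * K5 * (1 / n * (2 * sqrt n) + B / sqrt n * (6 / sqrt m)) + K4 * (KQ * ?w / sqrt n) * (Heta + Th)"
    using s1 s2 s3 tl_sum[of n] K_nonneg BM B
    by (intro add_mono mult_left_mono mult_nonneg_nonneg divide_nonneg_nonneg) auto
  also have "\<dots> \<le> KZ * K5 * (6 * ?w / sqrt n) + K4 * (KQ * ?w / sqrt n) * (Heta + Th)"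
  proof (intro add_right_mono mult_left_mono)
    have "1 / n * (2 * sqrt n) = 2 / sqrt n" using n0 by (simp add: real_div_sqrt field_simps)
    moreover have "2 / sqrt n \<le> 6 / sqrt n" using n0 by (intro divide_right_mono) auto
    ultimately show "1 / n * (2 * sqrt n) + B / sqrt n * (6 / sqrt m) \<le> 6 * ?w / sqrt n"
      by (simp add: add_divide_distrib distrib_left mult_ac)
  qed (use K_nonneg in auto)
  also have "\<dots> = K6 * ?w / sqrt n"
  proof -
    have "KZ * K5 * (6 * w / s) + K4 * (KQ * w / s) * H = (6 * KZ * K5 + K4 * KQ * H) * w / s" for w s H
      by (simp add: algebra_simps add_divide_distrib)
    then show ?thesis unfolding K6_def .
  qed
  finally show ?thesis unfolding an a0 .
qed

text \<open>The variances \<open>\<sigma>\<^sup>2 * n\<close> and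
  \<open>\<sigma>\<^sup>2 * m\<close> add up to that of the Gaussian target in
  \<open>smoothed_bound\<close>; the quotient of the two bandwidths in \<open>smoothing\<close> is
  \<open>sqrt m / sqrt n\<close>.\<close>

lemma berry_esseen_step:
  fixes n m :: nat
  assumes n: "1 \<le> n" and m: "1 \<le> m" and B: "0 \<le> B"
    and IH: "\<And>j. 1 \<le> j \<Longrightarrow> j < n \<Longrightarrow> be_bound B j"
  shows "be_bound (2 * K6 * (1 + B / sqrt m) + 6 * sqrt m) n"
  unfolding be_bound_def
proof
  fix t
  have n0: "0 < real n" and m0: "0 < real m" using n m by auto
  have r: "sqrt ((\<sigma> * sqrt n)\<^sup>2 + (\<sigma> * sqrt m)\<^sup>2) = \<sigma> * sqrt (n + m)"
  proof -
    have "(\<sigma> * sqrt n)\<^sup>2 + (\<sigma> * sqrt m)\<^sup>2 = \<sigma>\<^sup>2 * (real n + real m)" by (simp add: power_mult_distrib distrib_left)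
    then show ?thesis using sigma_pos by (simp add: real_sqrt_mult)
  qed
  have "\<bar>prob {\<omega> \<in> space \<nu>. S X n \<omega> \<le> t} - Phi (t / (\<sigma> * sqrt n))\<bar>
     \<le> 2 * (K6 * (1 + B / sqrt m) / sqrt n) + 6 * (\<sigma> * sqrt m) / (\<sigma> * sqrt n)"
    using n0 m0 sigma_pos smoothed_bound[OF n m B IH]
    by (intro smoothing) (auto simp: r)
  also have "\<dots> = (2 * K6 * (1 + B / sqrt m) + 6 * sqrt m) / sqrt n"
    using sigma_pos by (simp add: add_divide_distrib)
  finally show "\<bar>prob {\<omega> \<in> space \<nu>. S X n \<omega> \<le> t} - Phi (t / (\<sigma> * sqrt n))\<bar>
     \<le> (2 * K6 * (1 + B / sqrt m) + 6 * sqrt m) / sqrt n" .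
qed

theorem berry_esseen: "\<exists>B>0. \<forall>n\<ge>1. be_bound B n"
proof -
  obtain m :: nat where m: "16 * K6\<^sup>2 + 1 \<le> real m" using real_arch_simple by blast
  have m1: "1 \<le> m" using m by (smt (verit) of_nat_1 of_nat_le_iff zero_le_power2)
  have "(4 * K6)\<^sup>2 \<le> real m" using m by (simp add: power_mult_distrib)
  then have sm: "4 * K6 \<le> sqrt m" by (rule real_le_rsqrt)
  \<comment> \<open>Twice the part of the new constant that is free of \<open>B\<close>: as
    \<open>4 * K6 \<le> sqrt m\<close>, the coefficient \<open>2 * K6 / sqrt m\<close> of
    \<open>B\<close> is at most \<open>1 / 2\<close>.\<close>
  define B where "B = 2 * (2 * K6 + 6 * sqrt m)"
  have m0: "0 < sqrt m" using m1 by simp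
  have B: "0 < B" unfolding B_def using K_nonneg(5) m0 by (intro mult_pos_pos add_nonneg_pos) auto
  have BB: "2 * K6 * (1 + B / sqrt m) + 6 * sqrt m \<le> B"
  proof -
    have "2 * K6 / sqrt m \<le> 1 / 2" using sm m0 by (simp add: divide_le_eq)
    then have "B * (2 * K6 / sqrt m) \<le> B * (1 / 2)" using B by (intro mult_left_mono) auto
    moreover have "2 * K6 * (1 + B / sqrt m) = 2 * K6 + B * (2 * K6 / sqrt m)" by (simp add: distrib_left mult_ac)
    ultimately show ?thesis unfolding B_def by simp
  qed
  have "be_bound B n" if "1 \<le> n" for n
    using that
  \<comment> \<open>There is no separate base case: for \<open>n = 1\<close> the induction
    hypothesis is empty and \<open>berry_esseen_step\<close> applies all the same.\<close>
  proof (induction n rule: less_induct)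
    case (less n)
    have "be_bound (2 * K6 * (1 + B / sqrt m) + 6 * sqrt m) n"
      using less B by (intro berry_esseen_step m1) auto
    then show ?case unfolding be_bound_def
      using BB by (meson divide_right_mono order_trans real_sqrt_ge_zero of_nat_0_le_iff)
  qed
  then show ?thesis using B by blast
qed

end

section \<open>Reduction of the theorem\<close>

lemma stationary_expectation:
  assumes st: "stationary \<nu> X" and h: "h \<in> borel_measurable (PiM UNIV (\<lambda>_. borel))"
  shows "(\<integral>\<omega>. h (\<lambda>k. X (k + m) \<omega>) \<partial>\<nu>) = (\<integral>\<omega>. h (\<lambda>k. X k \<omega>) \<partial>\<nu> :: real)"
proof -
  have m[measurable]: "X k \<in> borel_measurable \<nu>" for k using st by (simp add: stationary_def)
  have "(\<integral>\<omega>. h (\<lambda>k. X (k + m) \<omega>) \<partial>\<nu>) = (\<integral>y. h y \<partial>distr \<nu> (PiM UNIV (\<lambda>_. borel)) (\<lambda>\<omega> k. X (k + m) \<omega>))"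
    using h by (intro integral_distr[symmetric] measurable_PiM_single') auto
  also have "distr \<nu> (PiM UNIV (\<lambda>_. borel)) (\<lambda>\<omega> k. X (k + m) \<omega>) = distr \<nu> (PiM UNIV (\<lambda>_. borel)) (\<lambda>\<omega> k. X k \<omega>)"
    using st by (simp add: stationary_def)
  also have "(\<integral>y. h y \<partial>distr \<nu> (PiM UNIV (\<lambda>_. borel)) (\<lambda>\<omega> k. X k \<omega>)) = (\<integral>\<omega>. h (\<lambda>k. X k \<omega>) \<partial>\<nu>)"
    using h by (intro integral_distr measurable_PiM_single') auto
  finally show ?thesis .
qed

text \<open>The bound for one variable holds almost surely iff its indicator has expectation
  \<open>1\<close>, and stationarity transports this expectation. Countably many null sets are then
  discarded at once.\<close>

lemma stationary_AE_bound:
  assumes st: "stationary \<nu> X" and ps: "prob_space \<nu>" and M: "Linf_norm \<nu> (X 0) \<le> ereal M"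
  shows "AE \<omega> in \<nu>. \<forall>k. \<bar>X k \<omega>\<bar> \<le> M"
proof -
  interpret prob_space \<nu> by fact
  have m[measurable]: "X k \<in> borel_measurable \<nu>" for k using st by (simp add: stationary_def)
  have 0: "AE \<omega> in \<nu>. \<bar>X 0 \<omega>\<bar> \<le> M"
    using esssup_AE[of "\<lambda>\<omega>. ereal \<bar>X 0 \<omega>\<bar>" \<nu>]
  proof eventually_elim
    case (elim \<omega>)
    then have "ereal \<bar>X 0 \<omega>\<bar> \<le> ereal M" using M unfolding Linf_norm_def by (rule order_trans)
    then show ?case by simp
  qed
  have "AE \<omega> in \<nu>. \<bar>X k \<omega>\<bar> \<le> M" for k
  proof -
    have e0: "(\<integral>\<omega>. indicator {y. \<bar>y\<bar> \<le> M} (X (0 + k) \<omega>) \<partial>\<nu>) = (\<integral>\<omega>. indicator {y. \<bar>y\<bar> \<le> M} (X 0 \<omega>) \<partial>\<nu> :: real)"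
      by (rule stationary_expectation[OF st, of "\<lambda>y. indicator {y. \<bar>y\<bar> \<le> M} (y 0)"]) measurable
    have "prob {\<omega> \<in> space \<nu>. \<bar>X k \<omega>\<bar> \<le> M} = prob {\<omega> \<in> space \<nu>. \<bar>X 0 \<omega>\<bar> \<le> M}"
    proof -
      have "(\<integral>\<omega>. indicator {y. \<bar>y\<bar> \<le> M} (X k \<omega>) \<partial>\<nu>) = prob {\<omega> \<in> space \<nu>. \<bar>X k \<omega>\<bar> \<le> M}" for k
      proof -
        have "(\<integral>\<omega>. indicator {y. \<bar>y\<bar> \<le> M} (X k \<omega>) \<partial>\<nu>) = (\<integral>\<omega>. indicator {\<omega> \<in> space \<nu>. \<bar>X k \<omega>\<bar> \<le> M} \<omega> \<partial>\<nu> :: real)"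
          by (intro Bochner_Integration.integral_cong) (auto simp: indicator_def)
        then show ?thesis by simp
      qed
      then show ?thesis using e0 by simp
    qed
    also have "\<dots> = 1" using 0 by (subst prob_Collect_eq_1) auto
    finally show ?thesis by (subst (asm) prob_Collect_eq_1) auto
  qed
  then show ?thesis by (simp add: AE_all_countable)
qed

section \<open>Growth of the second moments\<close>

context weak_dep begin

lemma second_moment_step:
  "expectation (\<lambda>\<omega>. (S X (Suc n) \<omega>)\<^sup>2) - expectation (\<lambda>\<omega>. (S X n \<omega>)\<^sup>2)
   = expectation (\<lambda>\<omega>. X 0 \<omega> * X 0 \<omega>) + 2 * (\<Sum>i<n. expectation (\<lambda>\<omega>. X 0 \<omega> * X (i + 1) \<omega>))"
proof -
  have "(S X (Suc n) \<omega>)\<^sup>2 = (S X n \<omega>)\<^sup>2 + (2 * (\<Sum>k=1..n. X k \<omega> * X (Suc n) \<omega>) + X (Suc n) \<omega> * X (Suc n) \<omega>)" for \<omega>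
    unfolding S_def by (simp add: power2_eq_square algebra_simps sum_distrib_left)
  then have "expectation (\<lambda>\<omega>. (S X (Suc n) \<omega>)\<^sup>2) = expectation (\<lambda>\<omega>. (S X n \<omega>)\<^sup>2 + (2 * (\<Sum>k=1..n. X k \<omega> * X (Suc n) \<omega>) + X (Suc n) \<omega> * X (Suc n) \<omega>))"
    by simp
  also have "\<dots> = expectation (\<lambda>\<omega>. (S X n \<omega>)\<^sup>2) + (2 * (\<Sum>k=1..n. expectation (\<lambda>\<omega>. X k \<omega> * X (Suc n) \<omega>)) + expectation (\<lambda>\<omega>. X (Suc n) \<omega> * X (Suc n) \<omega>))"
  proof -
    have i1: "integrable \<nu> (\<lambda>\<omega>. X k \<omega> * X j \<omega>)" for k j by (intro bddrv_integrable bddrv_mult bddrv_X)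
    have i2: "integrable \<nu> (\<lambda>\<omega>. (S X n \<omega>)\<^sup>2)" by (intro bddrv_integrable bddrv_power bddrv_S)
    have "expectation (\<lambda>\<omega>. \<Sum>k=1..n. X k \<omega> * X (Suc n) \<omega>) = (\<Sum>k=1..n. expectation (\<lambda>\<omega>. X k \<omega> * X (Suc n) \<omega>))"
      by (rule Bochner_Integration.integral_sum) (rule i1)
    moreover have "integrable \<nu> (\<lambda>\<omega>. \<Sum>k=1..n. X k \<omega> * X (Suc n) \<omega>)" by (rule Bochner_Integration.integrable_sum) (rule i1)
    ultimately show ?thesis using i1 i2 by simp
  qed
  also have "expectation (\<lambda>\<omega>. X (Suc n) \<omega> * X (Suc n) \<omega>) = expectation (\<lambda>\<omega>. X 0 \<omega> * X 0 \<omega>)"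
    using X_corr[of "Suc n" 0] by simp
  also have "(\<Sum>k=1..n. expectation (\<lambda>\<omega>. X k \<omega> * X (Suc n) \<omega>)) = (\<Sum>i<n. expectation (\<lambda>\<omega>. X 0 \<omega> * X (i + 1) \<omega>))"
  proof (rule sum.reindex_bij_witness[of _ "\<lambda>i. n - i" "\<lambda>k. n - k"])
    fix k assume k: "k \<in> {1..n}"
    have "k + (n - k + 1) = Suc n" using k by auto
    then show "expectation (\<lambda>\<omega>. X 0 \<omega> * X (n - k + 1) \<omega>) = expectation (\<lambda>\<omega>. X k \<omega> * X (Suc n) \<omega>)"
      using X_corr[of k "n - k + 1"] by simp
  qed auto
  finally show ?thesis by simp
qed

text \<open>The increments of the second moment differ from \<open>v\<close> by tails of
  \<open>\<theta>\<close>, and these tails are summable. An error that is bounded, rather than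
  \<open>o(n)\<close>, is what gives boundedness in \<open>L^2\<close> when
  \<open>v = 0\<close>.\<close>

lemma second_moment_asymptotics:
  assumes ts: "theta_sum \<theta> Th R" and th: "\<And>p. \<phi> p 0 \<le> \<theta> p"
  defines "v \<equiv> expectation (\<lambda>\<omega>. X 0 \<omega> * X 0 \<omega>) + 2 * (\<Sum>p. expectation (\<lambda>\<omega>. X 0 \<omega> * X (p + 1) \<omega>))"
  shows "\<bar>expectation (\<lambda>\<omega>. (S X n \<omega>)\<^sup>2) - real n * v\<bar> \<le> 6 * C * M\<^sup>2 * Th"
proof -
  interpret theta_sum \<theta> Th R by fact
  let ?c = "\<lambda>p. expectation (\<lambda>\<omega>. X 0 \<omega> * X p \<omega>)"
  have cb: "\<bar>?c p\<bar> \<le> 3 * C * M\<^sup>2 * \<theta> p" for p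
  proof -
    have "3 * C * M\<^sup>2 * \<phi> p 0 \<le> 3 * C * M\<^sup>2 * \<theta> p" using th C_ge1 by (intro mult_left_mono) auto
    with corr_bound[of p] show ?thesis by linarith
  qed
  let ?m = "\<lambda>n. expectation (\<lambda>\<omega>. (S X n \<omega>)\<^sup>2)"
  have d: "\<bar>?m (Suc n) - ?m n - v\<bar> \<le> 6 * C * M\<^sup>2 * tl (n + 1)" for n
  proof -
    have e: "?m (Suc n) - ?m n - v = 2 * ((\<Sum>i<n. ?c (i + 1)) - (\<Sum>p. ?c (p + 1)))"
      unfolding second_moment_step v_def by (simp add: algebra_simps)
    have "\<bar>2 * s\<bar> \<le> 2 * t" if "\<bar>s\<bar> \<le> t" for s t :: real using that by (simp add: abs_mult)
    from this[OF series_tail_bound[OF cb, of n]] have "\<bar>?m (Suc n) - ?m n - v\<bar> \<le> 2 * (3 * C * M\<^sup>2 * tl (n + 1))" unfolding e .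
    then show ?thesis by simp
  qed
  have "\<bar>?m n - real n * v\<bar> \<le> 6 * C * M\<^sup>2 * (\<Sum>k=1..n. tl k)"
  proof (induction n)
    case (Suc n)
    have "?m (Suc n) - real (Suc n) * v = (?m n - real n * v) + (?m (Suc n) - ?m n - v)" by (simp add: algebra_simps)
    then have "\<bar>?m (Suc n) - real (Suc n) * v\<bar> \<le> 6 * C * M\<^sup>2 * (\<Sum>k=1..n. tl k) + 6 * C * M\<^sup>2 * tl (n + 1)"
      using Suc d[of n] by linarith
    then show ?case by (simp add: distrib_left)
  qed simp
  also have "\<dots> \<le> 6 * C * M\<^sup>2 * Th" using tl_sum C_ge1 by (intro mult_left_mono) auto
  finally show ?thesis .
qed

end

lemma abs_linear_bound_limit:
  fixes a :: "nat \<Rightarrow> real"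
  assumes "\<And>n. \<bar>a n - real n * v\<bar> \<le> K"
  shows "(\<lambda>n. a n / real n) \<longlonglongrightarrow> v"
proof -
  have "(\<lambda>n. K / real n) \<longlonglongrightarrow> 0" by (rule lim_const_over_n)
  moreover have "\<forall>\<^sub>F n in sequentially. norm (a n / real n - v) \<le> K / real n"
  proof (rule eventually_sequentiallyI[of 1])
    fix n :: nat assume n: "1 \<le> n"
    then have "a n / real n - v = (a n - real n * v) / real n" by (simp add: field_simps)
    then show "norm (a n / real n - v) \<le> K / real n" using assms[of n] n by (simp add: abs_divide divide_right_mono)
  qed
  ultimately have "(\<lambda>n. a n / real n - v) \<longlonglongrightarrow> 0" by (rule Lim_null_comparison[rotated])
  then show ?thesis by (simp add: LIM_zero_iff)
qed

theorem mainTheorem1: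
  fixes \<nu> :: "'a measure" and X :: "nat \<Rightarrow> 'a \<Rightarrow> real"
    and C M r :: real and \<phi> :: "nat \<Rightarrow> nat \<Rightarrow> real"
  assumes "prob_space \<nu>"
    and "stationary \<nu> X"
    and "\<And>k. Linf_norm \<nu> (X k) < \<infinity>"
    and "\<And>k. (\<integral>\<omega>. X k \<omega> \<partial>\<nu>) = 0"
    and "C \<ge> 1"
    and "ereal M \<ge> max 1 (Linf_norm \<nu> (X 0))"
    and "r \<ge> 0"
    and "\<And>p l. \<phi> p l \<le> 1"
    and "(\<lambda>p. real p * Max ((\<lambda>l. \<phi> p l) ` {0..nat \<lfloor>real p / (r + 1)\<rfloor>})) summable_on {1..}"
    and "cov_bound \<nu> X C M \<phi>"
  shows "\<exists>\<sigma>::real.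
     (\<lambda>n. 1 / sqrt (real n) * sqrt (\<integral>\<omega>. (S X n \<omega>)\<^sup>2 \<partial>\<nu>)) \<longlonglongrightarrow> \<sigma> \<and>
     (\<sigma> = 0 \<longrightarrow> (\<exists>K. \<forall>n. sqrt (\<integral>\<omega>. (S X n \<omega>)\<^sup>2 \<partial>\<nu>) \<le> K)) \<and>
     (\<sigma> > 0 \<longrightarrow>
        weak_conv_m (\<lambda>n. distr \<nu> borel (\<lambda>\<omega>. S X n \<omega> / sqrt (real n))) (centered_normal \<sigma>) \<and>
        (\<exists>B>0. \<forall>n\<ge>1.
           (SUP x::real. \<bar>measure \<nu> {\<omega> \<in> space \<nu>. S X n \<omega> / sqrt (real n) \<le> x}
                          - measure (centered_normal \<sigma>) {..x}\<bar>)
             \<le> B / sqrt (real n)))"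
proof -
  interpret prob_space \<nu> by fact
  have m[measurable]: "X k \<in> borel_measurable \<nu>" for k using assms(2) by (simp add: stationary_def)
  have M: "1 \<le> M" "Linf_norm \<nu> (X 0) \<le> ereal M" using assms(6) by (auto simp: one_ereal_def)
  interpret weak_dep \<nu> X C M \<phi>
  proof
    show "AE \<omega> in \<nu>. \<forall>k. \<bar>X k \<omega>\<bar> \<le> M" using stationary_AE_bound[OF assms(2,1) M(2)] .
    show "expectation (\<lambda>\<omega>. X k \<omega> * X (k + p) \<omega>) = expectation (\<lambda>\<omega>. X 0 \<omega> * X p \<omega>)" for k p
      using stationary_expectation[OF assms(2), of "\<lambda>y. y 0 * y p" k] by (simp add: add.commute)
  qed (use assms M in auto)
  \<comment> \<open>An integer at least \<open>r + 1\<close>: then \<open>R * l \<le> p\<close> puts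
    \<open>l\<close> into the range of the maximum that defines \<open>\<theta> p\<close>.\<close>
  define R where "R = nat \<lceil>r + 1\<rceil>"
  have R: "1 \<le> R" "r + 1 \<le> real R" using assms(7) unfolding R_def by linarith+
  define \<theta> where "\<theta> p = Max ((\<lambda>l. \<phi> p l) ` {0..nat \<lfloor>real p / (r + 1)\<rfloor>})" for p
  have th_ge: "\<phi> p l \<le> \<theta> p" if "l \<le> nat \<lfloor>real p / (r + 1)\<rfloor>" for p l
    unfolding \<theta>_def using that by (intro Max_ge) auto
  have th0: "0 \<le> \<theta> p" for p using th_ge[of 0 p] phi_nonneg[of p 0] by linarith
  have th: "\<phi> p l \<le> \<theta> p" if "R * l \<le> p" for p l
  proof (rule th_ge)
    have "(r + 1) * real l \<le> real R * real l" using R by (intro mult_right_mono) auto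
    also have "\<dots> \<le> real p" using that by (metis of_nat_le_iff of_nat_mult)
    finally have "real l \<le> real p / (r + 1)" using assms(7) by (simp add: pos_le_divide_eq mult.commute)
    then show "l \<le> nat \<lfloor>real p / (r + 1)\<rfloor>" by linarith
  qed
  define Th where "Th = infsum (\<lambda>p. real p * \<theta> p) {1..}"
  have sm: "(\<lambda>p. real p * \<theta> p) summable_on {1..}" using assms(9) unfolding \<theta>_def .
  have Th: "(\<Sum>g=1..n. real g * \<theta> g) \<le> Th" for n
    unfolding Th_def using th0 by (intro finite_sum_le_infsum sm) auto
  have ts: "theta_sum \<theta> Th R" by unfold_locales (use th0 Th R in auto)
  define v where "v = expectation (\<lambda>\<omega>. X 0 \<omega> * X 0 \<omega>) + 2 * (\<Sum>p. expectation (\<lambda>\<omega>. X 0 \<omega> * X (p + 1) \<omega>))"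
  have mom: "\<bar>expectation (\<lambda>\<omega>. (S X n \<omega>)\<^sup>2) - real n * v\<bar> \<le> 6 * C * M\<^sup>2 * Th" for n
    unfolding v_def using th[of 0] by (intro second_moment_asymptotics[OF ts]) auto
  have lim: "(\<lambda>n. expectation (\<lambda>\<omega>. (S X n \<omega>)\<^sup>2) / real n) \<longlonglongrightarrow> v"
    by (rule abs_linear_bound_limit[OF mom])
  \<comment> \<open>The sign is not visible in the series; it comes from \<open>v\<close> being a
    limit of nonnegative quotients.\<close>
  have v0: "0 \<le> v" by (rule LIMSEQ_le_const[OF lim]) (auto intro!: exI[of _ 0])
  define \<sigma> where "\<sigma> = sqrt v"
  have s2: "\<sigma>\<^sup>2 = v" using v0 by (simp add: \<sigma>_def)
  have "(\<lambda>n. 1 / sqrt (real n) * sqrt (\<integral>\<omega>. (S X n \<omega>)\<^sup>2 \<partial>\<nu>)) \<longlonglongrightarrow> \<sigma>"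
    using tendsto_real_sqrt[OF lim] by (simp add: \<sigma>_def real_sqrt_divide)
  moreover have "\<exists>K. \<forall>n. sqrt (\<integral>\<omega>. (S X n \<omega>)\<^sup>2 \<partial>\<nu>) \<le> K" if "\<sigma> = 0"
  proof (intro exI allI)
    fix n
    have "v = 0" using that s2 by simp
    then show "sqrt (\<integral>\<omega>. (S X n \<omega>)\<^sup>2 \<partial>\<nu>) \<le> sqrt (6 * C * M\<^sup>2 * Th)" using mom[of n] by simp
  qed
  moreover have "weak_conv_m (\<lambda>n. distr \<nu> borel (\<lambda>\<omega>. S X n \<omega> / sqrt (real n))) (centered_normal \<sigma>) \<and>
        (\<exists>B>0. \<forall>n\<ge>1. (SUP x::real. \<bar>measure \<nu> {\<omega> \<in> space \<nu>. S X n \<omega> / sqrt (real n) \<le> x}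
                          - measure (centered_normal \<sigma>) {..x}\<bar>) \<le> B / sqrt (real n))" if pos: "0 < \<sigma>"
  proof -
    interpret T: theta_sum \<theta> Th R by (rule ts)
    interpret berry_esseen_setting \<nu> X C M \<phi> \<theta> Th R \<sigma>
    proof
      show "\<phi> p l \<le> \<theta> p" if "R * l \<le> p" for p l by (rule th[OF that])
      show "0 < \<sigma>" by (rule pos)
      show "\<sigma>\<^sup>2 = expectation (\<lambda>\<omega>. X 0 \<omega> * X 0 \<omega>) + 2 * (\<Sum>p. expectation (\<lambda>\<omega>. X 0 \<omega> * X (p + 1) \<omega>))"
        using s2 by (simp add: v_def)
    qed
    obtain B where B: "0 < B" "\<And>n. 1 \<le> n \<Longrightarrow> be_bound B n" using berry_esseen by blast
    have pt: "\<bar>prob {\<omega> \<in> space \<nu>. S X n \<omega> / sqrt (real n) \<le> x} - measure (centered_normal \<sigma>) {..x}\<bar> \<le> B / sqrt n" if n: "1 \<le> n" for n x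
    proof -
      have sn: "0 < sqrt (real n)" using n by simp
      have 1: "(S X n \<omega> / sqrt (real n) \<le> x) = (S X n \<omega> \<le> x * sqrt n)" for \<omega>
        using sn by (simp add: pos_divide_le_eq)
      have 2: "measure (centered_normal \<sigma>) {..x} = Phi (x * sqrt n / (\<sigma> * sqrt n))"
        using sn pos by (simp add: measure_centered_normal)
      show ?thesis unfolding 1 2 using B(2)[OF n] unfolding be_bound_def by blast
    qed
    \<comment> \<open>Convergence of the distribution functions at every point is read off from the
      rate \<open>B / sqrt n\<close>.\<close>
    have wc: "weak_conv_m (\<lambda>n. distr \<nu> borel (\<lambda>\<omega>. S X n \<omega> / sqrt (real n))) (centered_normal \<sigma>)"
      unfolding weak_conv_m_def weak_conv_def
    proof (intro allI impI)
      fix x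
      have c: "cdf (distr \<nu> borel (\<lambda>\<omega>. S X n \<omega> / sqrt (real n))) x = prob {\<omega> \<in> space \<nu>. S X n \<omega> / sqrt (real n) \<le> x}" for n
        unfolding cdf_def by (subst measure_distr) (auto intro!: arg_cong[where f=prob])
      have "(\<lambda>n. B / sqrt (real n)) \<longlonglongrightarrow> 0"
        by (intro tendsto_divide_0[OF tendsto_const] filterlim_at_top_imp_at_infinity
            filterlim_compose[OF sqrt_at_top] filterlim_real_sequentially)
      moreover have "\<forall>\<^sub>F n in sequentially. norm (cdf (distr \<nu> borel (\<lambda>\<omega>. S X n \<omega> / sqrt (real n))) x - cdf (centered_normal \<sigma>) x) \<le> B / sqrt (real n)"
        using pt[of _ x] unfolding c by (intro eventually_sequentiallyI[of 1]) (simp add: cdf_def)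
      ultimately have "(\<lambda>n. cdf (distr \<nu> borel (\<lambda>\<omega>. S X n \<omega> / sqrt (real n))) x - cdf (centered_normal \<sigma>) x) \<longlonglongrightarrow> 0"
        by (rule Lim_null_comparison[rotated])
      then show "(\<lambda>n. cdf (distr \<nu> borel (\<lambda>\<omega>. S X n \<omega> / sqrt (real n))) x) \<longlonglongrightarrow> cdf (centered_normal \<sigma>) x"
        by (simp add: LIM_zero_iff)
    qed
    show ?thesis using wc B(1) pt by (intro conjI exI[of _ B] allI impI cSUP_least) auto
  qed
  ultimately show ?thesis by blast
qed

end
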